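(* Let $r\le\frac d2-1$, $n=d-1$, and let $\mathcal{F}=(p_1)^{\otimes3}+\cdots+(p_r)^{\otimes3}\in\mathrm{S}^3(\mathbb{C}^d)$ with $p_i\in\mathbb{C}^d$ and $\xi\in\mathbb{C}^{n-r}$ satisfy the following conditions: (i) the leading (first) entry of each $p_i$ is nonzero; (ii) the subvectors $(p_1)_{2:r+1},\ldots,(p_r)_{2:r+1}$ are linearly independent; (iii) for each $j\in[r+1,n]$, the subvectors $(p_1)_{[r+2:j,\,j+2:d]},\ldots,(p_r)_{[r+2:j,\,j+2:d]}$ are linearly independent; (iv) the eigenvalues of the matrix $N(\xi)$ (defined from the generating matrix of $\mathcal{F}$ in the context) are distinct from each other. Given an approximation $\widehat{\mathcal{F}}_\Omega$ of the subtensor $\mathcal{F}_\Omega$, let $\hat p_i$, $p_i^*$ ($i=1,\ldots,r$) be the vectors produced by the incomplete symmetric tensor approximation algorithm described in the context, applied to $\widehat{\mathcal{F}}_\Omega$ and $r$ with the vector $\xi$. If $\epsilon:=\|(\widehat{\mathcal{F}}-\mathcal{F})_\Omega\|$ is small enough, then there exist scalars $\hat\tau_i,\tau_i^*\in\mathbb{C}$ such that, up to a permutation of $(p_1,\ldots,p_r)$, $$(\hat\tau_i)^3=(\tau_i^* )^3=1,\qquad \|\hat\tau_i\hat p_i-p_i\|=O(\epsilon),\qquad \|\tau_i^*p_i^*-p_i\|=O(\epsilon),\qquad i=1,\ldots,r,$$ where the constants inside $O(\cdot)$ depend only on $\mathcal{F}$ and on the choice of $\xi$.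
   Context: Notation. $[r]=\{1,\ldots,r\}$, $[r+1,n]=\{r+1,\ldots,n\}$. $\mathrm{S}^3(\mathbb{C}^d)$ is the space of third order symmetric tensors $(\mathcal{F}_{i_1i_2i_3})_{0\le i_1,i_2,i_3\le n}$, $n=d-1$ (tensor labels start at $0$). Vectors $p\in\mathbb{C}^d$ are labelled $p=(p_1,\ldots,p_d)$, so $(p^{\otimes 3})_{i_1i_2i_3}=p_{i_1+1}p_{i_2+1}p_{i_3+1}$. $(p)_{a:b}=(p_a,\ldots,p_b)$, and $(p)_{[r+2:j,\,j+2:d]}$ is the subvector with entries indexed by $\{r+2,\ldots,j\}\cup\{j+2,\ldots,d\}$ (i.e. $\{r+2,\dots,d\}\setminus\{j+1\}$). $\Omega$ is the set of labels $(i_1,i_2,i_3)$, $0\le i_1,i_2,i_3\le n$, with pairwise distinct entries. For a label set $J$, $\mathcal{F}_J$ is the subtensor of entries labelled by $J$, and its norm is the square root of the sum of squared moduli of its entries. $\sqrt[3]{\cdot}$ is the principal cube root, $^H$ the conjugate transpose. $\widehat{\mathcal{F}}_\Omega$ is a symmetric subtensor, i.e. its entries are invariant under permutations of labels. Matrices. For a symmetric subtensor $\mathcal{T}_\Omega$ and $i\in[r]$, $j\in[r+1,n]$, $A_{ij}[\mathcal{T}]\in\mathbb{C}^{(n-r-1)\times r}$ and $b_{ij}[\mathcal{T}]\in\mathbb{C}^{n-r-1}$ have rows labelled by $l\in[r+1,n]\setminus\{j\}$, with $A_{ij}[\mathcal{T}]_{l,k}=\mathcal{T}_{0kl}$ ($k\in[r]$)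 and $b_{ij}[\mathcal{T}]_l=\mathcal{T}_{ijl}$. Let $e_i$ be the $i$th standard unit vector and let $\mathscr{B}_1=\{e_i+e_j:i\in[r],j\in[r+1,n]\}$. For a matrix $G$ with entries $G(k,\alpha)$, $k\in[r]$, $\alpha\in\mathscr{B}_1$, and $l\in[r+1,n]$, $N_l(G)\in\mathbb{C}^{r\times r}$ is the matrix whose $(i,k)$ entry is $G(k,e_i+e_l)$. Generating matrix of $\mathcal{F}$ and $N(\xi)$. The generating matrix $G$ of $\mathcal{F}$ is the matrix (unique under (i)-(ii)) with $\sum_{k=1}^rG(k,e_i+e_j)\mathcal{F}_{0kt}=\mathcal{F}_{ijt}$ for all $i\in[r]$, $j\in[r+1,n]$, $t=0,\ldots,n$. For $\xi=(\xi_{r+1},\ldots,\xi_n)$, $N(\xi)=\xi_{r+1}N_{r+1}(G)+\cdots+\xi_nN_n(G)$. Algorithm (incomplete symmetric tensor approximation; input $\widehat{\mathcal{F}}_\Omega$ and $r\le\frac d2-1$). 1. For each $i\in[r]$, $j\in[r+1,n]$, let $\widehat G(:,e_i+e_j)$ be an optimizer of $\min_{g\in\mathbb{C}^r}\|A_{ij}[\widehat{\mathcal{F}}]g-b_{ij}[\widehat{\mathcal{F}}]\|^2$; these form the matrix $\widehat G$. 2. With the chosen (generic) vector $\xi$, let $\widehat N(\xi)=\xi_{r+1}N_{r+1}(\widehat G)+\cdots+\xi_nN_n(\widehat G)$. Let $\hat v_1,\ldots,\hat v_r$ be unit length eigenvectors of $\widehat N(\xi)$ and $\hat w_k=(\hat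 v_k^HN_{r+1}(\widehat G)\hat v_k,\ldots,\hat v_k^HN_n(\widehat G)\hat v_k)$. 3. Let $J_1=\{(0,i_1,i_2):i_1\in[r],i_2\in[r+1,n]\}$ and $J_2=\{(i_1,i_2,i_3):i_1\ne i_2,\ i_1,i_2\in[r],\ i_3\in[r+1,n]\}$. Let $(\hat\beta_1,\ldots,\hat\beta_r)$ be an optimizer of $\min_\beta\|\widehat{\mathcal{F}}_{J_1}-\sum_{k=1}^r\beta_k\,\hat v_k\otimes\hat w_k\|^2$ and $(\hat\theta_1,\ldots,\hat\theta_r)$ an optimizer of $\min_\theta\|\widehat{\mathcal{F}}_{J_2}-\sum_{k=1}^r\theta_k(\hat v_k\otimes\hat v_k\otimes\hat w_k)_{J_2}\|^2$, where the entries of $\hat v_k$ are labelled by $1,\ldots,r$ and those of $\hat w_k$ by $r+1,\ldots,n$. Set $\hat\lambda_k=(\hat\beta_k)^2/\hat\theta_k$, $\hat\gamma_k=\hat\theta_k/\hat\beta_k$. 4. Set $\hat p_k=\sqrt[3]{\hat\lambda_k}\,(1,\hat\gamma_k\hat v_k,\hat w_k)$, $k=1,\ldots,r$. 5. Using $\hat p_1,\ldots,\hat p_r$ as starting points, solve $\min_{(q_1,\ldots,q_r)}\big\|\big(\sum_{k=1}^r(q_k)^{\otimes3}-\widehat{\mathcal{F}}\big)_\Omega\big\|^2$ for a minimizer $(p_1^*,\ldots,p_r^* )$. Meaning of the conclusion: there are $\epsilon_0>0$ and $C>0$ depending only on $\mathcal{F}$ and $\xi$ such that for $\epsilon\le\epsilon_0$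 the estimates hold with $C\epsilon$ in place of $O(\epsilon)$; "up to a permutation" means that the $p_i$ may be relabelled to match the ordering of the computed vectors (the relabelling may differ for the $\hat p_i$ and for the $p_i^*$).
   Formalization: The estimate for the starting points p̂_i additionally assumes that each subvector (p_s)_{2:r+1} has at least two nonzero entries; otherwise θ̂_s is arbitrary even for exact data and the claim fails (e.g. r=1, where J_2 is empty). The estimate for p_i^* needs no such assumption. *)

theory Defs
  imports
    "HOL-Analysis.L2_Norm"
    "HOL-Analysis.Complex_Transcendental"
    "HOL-Combinatorics.Permutations"
    "Jordan_Normal_Form.Char_Poly"
    "Jordan_Normal_Form.Conjugate"
begin

text \<open>
  A vector of \<open>\<complex>\<^sup>d\<close>, \<open>d = n + 1\<close>, is a function read only on the labels \<open>0, \<dots>, n\<close>, which also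
  label tensors: \<open>p s i\<close> is the entry number \<open>i + 1\<close> of the vector \<open>p s\<close>. So the subvector of the
  entries number \<open>2, \<dots>, r + 1\<close> has labels \<open>{1..r}\<close>, and the one of the entries number
  \<open>r + 2, \<dots>, d\<close> without \<open>j + 1\<close> has labels \<open>{r + 1..n} - {j}\<close>.
\<close>

type_synonym tensor3 = "nat \<Rightarrow> nat \<Rightarrow> nat \<Rightarrow> complex"

definition \<Omega> :: "nat \<Rightarrow> (nat \<times> nat \<times> nat) set" where
  "\<Omega> n = {(i, j, k). i \<le> n \<and> j \<le> n \<and> k \<le> n \<and> i \<noteq> j \<and> i \<noteq> k \<and> j \<noteq> k}"

definition subtensor_norm :: "(nat \<times> nat \<times> nat) set \<Rightarrow> tensor3 \<Rightarrow> real" where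
  "subtensor_norm J T = L2_set (\<lambda>(i, j, k). cmod (T i j k)) J"

definition vector_norm :: "nat set \<Rightarrow> (nat \<Rightarrow> complex) \<Rightarrow> real" where
  "vector_norm I x = L2_set (\<lambda>i. cmod (x i)) I"

definition symmetric_on_\<Omega> :: "nat \<Rightarrow> tensor3 \<Rightarrow> bool" where
  "symmetric_on_\<Omega> n T \<longleftrightarrow> (\<forall>(i, j, k) \<in> \<Omega> n. T i j k = T j i k \<and> T i j k = T i k j)"

definition cube_sum :: "nat \<Rightarrow> (nat \<Rightarrow> nat \<Rightarrow> complex) \<Rightarrow> tensor3" where
  "cube_sum r p = (\<lambda>i j k. \<Sum>s=1..r. p s i * p s j * p s k)"

text \<open>Linear independence of the family of subvectors \<open>x 1, \<dots>, x r\<close> with entries labelled by \<open>I\<close>.\<close>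

definition lin_indep_family :: "nat \<Rightarrow> nat set \<Rightarrow> (nat \<Rightarrow> nat \<Rightarrow> complex) \<Rightarrow> bool" where
  "lin_indep_family r I x \<longleftrightarrow>
     (\<forall>c. (\<forall>i\<in>I. (\<Sum>s=1..r. c s * x s i) = 0) \<longrightarrow> (\<forall>s\<in>{1..r}. c s = 0))"

text \<open>
  The entry \<open>G(k, e\<^sub>i + e\<^sub>j)\<close> with \<open>k, i \<in> {1..r}\<close> and \<open>j \<in> {r + 1..n}\<close> is \<open>G k i j\<close>; the exponent
  \<open>e\<^sub>i + e\<^sub>j\<close> determines the pair \<open>(i, j)\<close>.
\<close>

definition generating_matrix :: "nat \<Rightarrow> nat \<Rightarrow> tensor3 \<Rightarrow> (nat \<Rightarrow> nat \<Rightarrow> nat \<Rightarrow> complex) \<Rightarrow> bool" where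
  "generating_matrix n r F G \<longleftrightarrow>
     (\<forall>i\<in>{1..r}. \<forall>j\<in>{r+1..n}. \<forall>t\<in>{0..n}. (\<Sum>k=1..r. G k i j * F 0 k t) = F i j t)"

text \<open>Rows and columns of a library matrix are counted from 0, hence the shifted labels.\<close>

definition N_mat :: "nat \<Rightarrow> (nat \<Rightarrow> nat \<Rightarrow> nat \<Rightarrow> complex) \<Rightarrow> nat \<Rightarrow> complex mat" where
  "N_mat r G l = mat r r (\<lambda>(i, k). G (k + 1) (i + 1) l)"

definition N_comb ::
  "nat \<Rightarrow> nat \<Rightarrow> (nat \<Rightarrow> complex) \<Rightarrow> (nat \<Rightarrow> nat \<Rightarrow> nat \<Rightarrow> complex) \<Rightarrow> complex mat" where
  "N_comb n r \<xi> G = mat r r (\<lambda>ik. \<Sum>l=r+1..n. \<xi> l * (N_mat r G l $$ ik))"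

definition distinct_eigenvalues :: "complex mat \<Rightarrow> bool" where
  "distinct_eigenvalues A \<longleftrightarrow> (\<exists>es. char_poly A = (\<Prod>e\<leftarrow>es. [:- e, 1:]) \<and> distinct es)"

text \<open>
  \<open>A_mat T i j\<close> has rows \<open>l \<in> {r + 1..n} - {j}\<close> and columns \<open>k \<in> {1..r}\<close>; its entries depend on neither
  \<open>i\<close> nor \<open>j\<close>, only its row set depends on \<open>j\<close>.
\<close>

definition A_mat :: "tensor3 \<Rightarrow> nat \<Rightarrow> nat \<Rightarrow> nat \<Rightarrow> nat \<Rightarrow> complex" where
  "A_mat T i j l k = T 0 k l"

definition b_vec :: "tensor3 \<Rightarrow> nat \<Rightarrow> nat \<Rightarrow> nat \<Rightarrow> complex" where
  "b_vec T i j l = T i j l"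

definition estimated_generating_matrix ::
  "nat \<Rightarrow> nat \<Rightarrow> tensor3 \<Rightarrow> (nat \<Rightarrow> nat \<Rightarrow> nat \<Rightarrow> complex) \<Rightarrow> bool" where
  "estimated_generating_matrix n r T G \<longleftrightarrow>
     (\<forall>i\<in>{1..r}. \<forall>j\<in>{r+1..n}.
        is_arg_min
          (\<lambda>g. (vector_norm ({r+1..n} - {j})
                  (\<lambda>l. (\<Sum>k=1..r. A_mat T i j l k * g k) - b_vec T i j l))\<^sup>2)
          (\<lambda>_. True) (\<lambda>k. G k i j))"

text \<open>
  ``Unit length eigenvectors \<open>v 1, \<dots>, v r\<close>'' is a full system: one for each eigenvalue when the
  eigenvalues are distinct, and a basis of eigenvectors in general.
\<close>

definition unit_eigenvectors :: "nat \<Rightarrow> complex mat \<Rightarrow> (nat \<Rightarrow> complex Matrix.vec) \<Rightarrow> bool" where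
  "unit_eigenvectors r A v \<longleftrightarrow>
     (\<forall>s\<in>{1..r}. (\<exists>\<mu>. eigenvector A (v s) \<mu>) \<and> vector_norm {0..<r} (vec_index (v s)) = 1) \<and>
     lin_indep_family r {0..<r} (\<lambda>s. vec_index (v s))"

definition w_vec ::
  "nat \<Rightarrow> (nat \<Rightarrow> nat \<Rightarrow> nat \<Rightarrow> complex) \<Rightarrow> (nat \<Rightarrow> complex Matrix.vec) \<Rightarrow> nat \<Rightarrow> nat \<Rightarrow> complex" where
  "w_vec r G v s l = (N_mat r G l *\<^sub>v v s) \<bullet>c v s"

definition J1 :: "nat \<Rightarrow> nat \<Rightarrow> (nat \<times> nat \<times> nat) set" where
  "J1 n r = {(0, i1, i2) | i1 i2. i1 \<in> {1..r} \<and> i2 \<in> {r+1..n}}"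

definition J2 :: "nat \<Rightarrow> nat \<Rightarrow> (nat \<times> nat \<times> nat) set" where
  "J2 n r = {(i1, i2, i3). i1 \<noteq> i2 \<and> i1 \<in> {1..r} \<and> i2 \<in> {1..r} \<and> i3 \<in> {r+1..n}}"

text \<open>The entry of \<open>v s\<close> labelled by \<open>i \<in> {1..r}\<close> sits at the library index \<open>i - 1\<close>.\<close>

definition beta_optimal ::
  "nat \<Rightarrow> nat \<Rightarrow> tensor3 \<Rightarrow> (nat \<Rightarrow> complex Matrix.vec) \<Rightarrow> (nat \<Rightarrow> nat \<Rightarrow> complex) \<Rightarrow> (nat \<Rightarrow> complex) \<Rightarrow> bool"
  where
  "beta_optimal n r T v w \<beta> \<longleftrightarrow>
     is_arg_min
       (\<lambda>b. (subtensor_norm (J1 n r)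
               (\<lambda>i0 i1 i2. T i0 i1 i2 - (\<Sum>s=1..r. b s * vec_index (v s) (i1 - 1) * w s i2)))\<^sup>2)
       (\<lambda>_. True) \<beta>"

definition theta_optimal ::
  "nat \<Rightarrow> nat \<Rightarrow> tensor3 \<Rightarrow> (nat \<Rightarrow> complex Matrix.vec) \<Rightarrow> (nat \<Rightarrow> nat \<Rightarrow> complex) \<Rightarrow> (nat \<Rightarrow> complex) \<Rightarrow> bool"
  where
  "theta_optimal n r T v w \<theta> \<longleftrightarrow>
     is_arg_min
       (\<lambda>t. (subtensor_norm (J2 n r)
               (\<lambda>i1 i2 i3. T i1 i2 i3 -
                  (\<Sum>s=1..r. t s * vec_index (v s) (i1 - 1) * vec_index (v s) (i2 - 1) * w s i3)))\<^sup>2)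
       (\<lambda>_. True) \<theta>"

text \<open>Complex \<open>powr\<close> uses the principal logarithm, so \<open>z powr (1/3)\<close> is the principal cube root.\<close>

definition assembled_vector ::
  "nat \<Rightarrow> complex \<Rightarrow> complex \<Rightarrow> complex Matrix.vec \<Rightarrow> (nat \<Rightarrow> complex) \<Rightarrow> nat \<Rightarrow> complex" where
  "assembled_vector r lam gam v w i =
     lam powr (1/3) * (if i = 0 then 1 else if i \<le> r then gam * vec_index v (i - 1) else w i)"

text \<open>
  The two outputs of the algorithm are relations, because the optimizers and eigenvectors it chooses
  need not be unique. \<open>algorithm_start n r \<xi> T q\<close>: the vectors \<open>q 1, \<dots>, q r\<close> are a possible choice of
  starting points computed from \<open>T\<close>. \<open>algorithm_refined n r T q\<close>: they are a (global) minimizer in the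
  final nonlinear least squares problem, on which the starting points impose no further constraint.
\<close>

definition algorithm_start ::
  "nat \<Rightarrow> nat \<Rightarrow> (nat \<Rightarrow> complex) \<Rightarrow> tensor3 \<Rightarrow> (nat \<Rightarrow> nat \<Rightarrow> complex) \<Rightarrow> bool" where
  "algorithm_start n r \<xi> T q \<longleftrightarrow>
     (\<exists>G v \<beta> \<theta>.
        estimated_generating_matrix n r T G \<and>
        unit_eigenvectors r (N_comb n r \<xi> G) v \<and>
        beta_optimal n r T v (w_vec r G v) \<beta> \<and>
        theta_optimal n r T v (w_vec r G v) \<theta> \<and>
        (\<forall>s\<in>{1..r}. \<forall>i\<in>{0..n}.
           q s i = assembled_vector r ((\<beta> s)\<^sup>2 / \<theta> s) (\<theta> s / \<beta> s) (v s) (w_vec r G v s) i))"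

definition algorithm_refined ::
  "nat \<Rightarrow> nat \<Rightarrow> tensor3 \<Rightarrow> (nat \<Rightarrow> nat \<Rightarrow> complex) \<Rightarrow> bool" where
  "algorithm_refined n r T q \<longleftrightarrow>
     is_arg_min
       (\<lambda>q. (subtensor_norm (\<Omega> n) (\<lambda>i j k. cube_sum r q i j k - T i j k))\<^sup>2)
       (\<lambda>_. True) q"

text \<open>
  If the subvector of \<open>p s\<close> labelled by \<open>{1..r}\<close> has only one nonzero entry, then the eigenvector
  \<open>v s\<close> is a multiple of a standard unit vector, \<open>v s \<otimes> v s \<otimes> w s\<close> vanishes on \<open>J2\<close>, and the optimizer
  \<open>\<theta> s\<close> is completely arbitrary even for exact data (for \<open>r = 1\<close>, \<open>J2\<close> is empty). The starting points
  can be accurate only if this does not happen.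
\<close>

definition theta_determined :: "nat \<Rightarrow> (nat \<Rightarrow> nat \<Rightarrow> complex) \<Rightarrow> bool" where
  "theta_determined r p \<longleftrightarrow>
     (\<forall>s\<in>{1..r}. \<exists>i\<in>{1..r}. \<exists>j\<in>{1..r}. i \<noteq> j \<and> p s i \<noteq> 0 \<and> p s j \<noteq> 0)"

text \<open>The vectors \<open>q\<close> agree with \<open>p\<close> up to relabelling, cube roots of unity, and an error of \<open>e\<close>.\<close>

definition recovers_within ::
  "nat \<Rightarrow> nat \<Rightarrow> (nat \<Rightarrow> nat \<Rightarrow> complex) \<Rightarrow> (nat \<Rightarrow> nat \<Rightarrow> complex) \<Rightarrow> real \<Rightarrow> bool" where
  "recovers_within n r p q e \<longleftrightarrow>
     (\<exists>\<pi> \<tau>. \<pi> permutes {1..r} \<and>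
        (\<forall>s\<in>{1..r}. (\<tau> s) ^ 3 = (1 :: complex) \<and>
           vector_norm {0..n} (\<lambda>i. \<tau> s * q s i - p (\<pi> s) i) \<le> e))"

end

theory Submission
  imports Defs "HOL-Library.Landau_Symbols"
begin

text \<open>
  All estimates are first order perturbation estimates along a filter on which the data error \<open>e\<close>
  tends to 0: \<open>near f a\<close> says \<open>f = a + O(e)\<close>. For exact data the subvectors \<open>u\<^sub>s\<close> of \<open>p\<^sub>s\<close> labelled
  by \<open>{1..r}\<close> are eigenvectors of every \<open>N\<^sub>l(G)\<close> with eigenvalue \<open>p\<^sub>s\<^sub>l / p\<^sub>s\<^sub>0\<close>. Least squares problems with an injective
  limit are stable, so the estimated generating matrix, its eigenvectors (up to order and scale, because
  the eigenvalues of \<open>N(\<xi>)\<close> are distinct) and the Rayleigh quotients \<open>w\<^sub>s\<close> are accurate. After rescaling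
  the eigenvectors to approximate \<open>u\<^sub>s\<close>, the two remaining least squares problems have the exact
  solutions \<open>\<beta>\<^sub>s = (p\<^sub>s\<^sub>0)\<^sup>2\<close> and \<open>\<theta>\<^sub>s = p\<^sub>s\<^sub>0\<close>, hence \<open>\<lambda>\<^sub>s = (p\<^sub>s\<^sub>0)\<^sup>3\<close>.

  A global minimizer \<open>q\<close> of the last problem satisfies \<open>\<Sum> q\<^sub>s\<^sup>\<otimes>\<^sup>3 = F + O(e)\<close> on \<open>\<Omega>\<close>. The block of the entries
  \<open>(0, k, l)\<close> is then still injective, which forces \<open>q\<close> to be nondegenerate, so it has a generating matrix
  of its own and the same perturbation argument applies to it. The scale of \<open>q\<^sub>s\<close> cannot be read off \<open>\<theta>\<close>,
  which may be undetermined; it comes from the entries \<open>(0, j, l)\<close> with \<open>j \<noteq> l\<close> in \<open>{r+1..n}\<close>, where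
  \<open>F = \<Sum> (p\<^sub>s\<^sub>0)\<^sup>3 w\<^sub>s\<^sub>j w\<^sub>s\<^sub>l\<close>. Applied to exact data, this shows that any two admissible decompositions of \<open>F\<close>
  agree up to order and cube roots of unity, so constants obtained for one of them serve for all.
\<close>

section \<open>Linear algebra\<close>

text \<open>Induction on the family: the part of the new member outside the span of the old ones has
  a nonzero entry, and evaluation at that entry, corrected by the old functionals, gives the
  functional dual to the new member.\<close>

lemma dual_family_exists:
  fixes x :: "'a \<Rightarrow> 'i \<Rightarrow> 'k::field"
  assumes "finite S" "finite I"
    and "\<And>c. (\<forall>i\<in>I. (\<Sum>s\<in>S. c s * x s i) = 0) \<Longrightarrow> \<forall>s\<in>S. c s = 0"
  shows "\<exists>L. \<forall>s\<in>S. \<forall>t\<in>S. (\<Sum>i\<in>I. L s i * x t i) = (if s = t then 1 else 0)"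
  using assms(1,3)
proof (induction S rule: finite_induct)
  case (insert a S)
  have indep: "\<forall>s\<in>S. c s = 0" if c: "\<forall>i\<in>I. (\<Sum>s\<in>S. c s * x s i) = 0" for c
  proof -
    have "(\<Sum>s\<in>insert a S. (c(a := 0)) s * x s i) = 0" if "i \<in> I" for i
    proof -
      have "(\<Sum>s\<in>S. (c(a := 0)) s * x s i) = (\<Sum>s\<in>S. c s * x s i)"
        using insert.hyps by (intro sum.cong) auto
      then show ?thesis using c that insert.hyps by simp
    qed
    then have "\<forall>s\<in>insert a S. (c(a := 0)) s = 0" by (intro insert.prems) blast
    moreover have "(c(a := 0)) s = c s" if "s \<in> S" for s using that insert.hyps by auto
    ultimately show ?thesis by simp
  qed
  have "\<exists>L. \<forall>s\<in>S. \<forall>t\<in>S. (\<Sum>i\<in>I. L s i * x t i) = (if s = t then 1 else 0)"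
    by (rule insert.IH) (rule indep)
  then obtain L where L': "\<forall>s\<in>S. \<forall>t\<in>S. (\<Sum>i\<in>I. L s i * x t i) = (if s = t then 1 else 0)" ..
  then have L: "(\<Sum>i\<in>I. L s i * x t i) = (if s = t then 1 else 0)" if "s \<in> S" "t \<in> S" for s t
    using that by blast
  \<comment> \<open>\<open>z\<close> holds the coordinates of \<open>x a\<close> along the old
    family as read by \<open>L\<close>, and \<open>y\<close> is what remains of
    \<open>x a\<close>.\<close>
  define z where "z t = (\<Sum>i\<in>I. L t i * x a i)" for t
  define y where "y i = x a i - (\<Sum>t\<in>S. z t * x t i)" for i
  \<comment> \<open>If \<open>y\<close> vanished on \<open>I\<close>, there would be a relation with
    coefficient 1 at \<open>a\<close>.\<close>
  obtain i0 where i0: "i0 \<in> I" "y i0 \<noteq> 0"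
  proof (rule ccontr)
    assume H: "\<not> thesis"
    define c where "c s = (if s = a then 1 else - z s)" for s
    have "(\<Sum>s\<in>insert a S. c s * x s i) = y i" for i
    proof -
      have "(\<Sum>s\<in>S. c s * x s i) = (\<Sum>s\<in>S. - (z s * x s i))"
        using insert.hyps by (intro sum.cong) (auto simp: c_def)
      then show ?thesis using insert.hyps by (simp add: y_def c_def sum_negf)
    qed
    then have "\<forall>s\<in>insert a S. c s = 0" using insert.prems[of c] H that by auto
    then show False by (simp add: c_def)
  qed
  \<comment> \<open>\<open>M\<close> takes the entry at \<open>i0\<close> of the part not seen by
    \<open>L\<close>, divided by \<open>y i0\<close>; so it kills the old members and is 1 on
    \<open>x a\<close>.\<close>
  define M where "M i = ((if i = i0 then 1 else 0) - (\<Sum>t\<in>S. L t i * x t i0)) / y i0" for i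
  have M: "(\<Sum>i\<in>I. M i * f i) = (f i0 - (\<Sum>t\<in>S. (\<Sum>i\<in>I. L t i * f i) * x t i0)) / y i0" for f
  proof -
    have "(\<Sum>i\<in>I. M i * f i) =
      (\<Sum>i\<in>I. ((if i = i0 then f i else 0) - (\<Sum>t\<in>S. L t i * f i * x t i0)) / y i0)"
      by (intro sum.cong refl) (auto simp: M_def field_simps sum_distrib_right sum_distrib_left)
    also have "\<dots> = ((\<Sum>i\<in>I. if i = i0 then f i else 0) - (\<Sum>i\<in>I. \<Sum>t\<in>S. L t i * f i * x t i0)) / y i0"
      by (simp add: sum_subtractf sum_divide_distrib[symmetric])
    also have "(\<Sum>i\<in>I. \<Sum>t\<in>S. L t i * f i * x t i0) = (\<Sum>t\<in>S. (\<Sum>i\<in>I. L t i * f i) * x t i0)"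
      by (subst sum.swap) (simp add: sum_distrib_right)
    finally show ?thesis using i0 assms(2) by simp
  qed
  have Ma: "(\<Sum>i\<in>I. M i * x a i) = 1"
    using i0 by (subst M) (simp add: z_def[symmetric] y_def)
  have Mt: "(\<Sum>i\<in>I. M i * x u i) = 0" if "u \<in> S" for u
  proof -
    have "(\<Sum>t\<in>S. (\<Sum>i\<in>I. L t i * x u i) * x t i0) = (\<Sum>t\<in>S. if t = u then x t i0 else 0)"
      using that L by (intro sum.cong) auto
    then show ?thesis using that insert.hyps by (subst M) simp
  qed
  \<comment> \<open>Subtracting \<open>z s\<close> times \<open>M\<close> makes an old functional
    vanish on \<open>x a\<close> without changing its values on the old members.\<close>
  define L' where "L' s i = (if s = a then M i else L s i - z s * M i)" for s i
  have "(\<Sum>i\<in>I. L' s i * x t i) = (if s = t then 1 else 0)"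
    if st: "s \<in> insert a S" "t \<in> insert a S" for s t
  proof (cases "s = a")
    case True
    then show ?thesis using st Ma Mt by (auto simp: L'_def)
  next
    case False
    then have s: "s \<in> S" using st by auto
    have "(\<Sum>i\<in>I. L' s i * x t i) = (\<Sum>i\<in>I. L s i * x t i) - z s * (\<Sum>i\<in>I. M i * x t i)"
      using False by (simp add: L'_def algebra_simps sum_subtractf sum_distrib_left)
    then show ?thesis using False s st L Ma Mt by (auto simp: z_def)
  qed
  then show ?case by blast
qed simp

text \<open>For \<open>r\<close> vectors with \<open>r\<close> entries the dual family is a left
  inverse of a square matrix, hence also a right inverse; the second identity expands vectors in the
  family \<open>x\<close>.\<close>

lemma square_dual_family_exists:
  assumes "lin_indep_family r {1..r} x"
  shows "\<exists>L. (\<forall>s\<in>{1..r}. \<forall>t\<in>{1..r}. (\<Sum>i=1..r. L s i * x t i) = (if s = t then 1 else 0)) \<and>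
             (\<forall>i\<in>{1..r}. \<forall>j\<in>{1..r}. (\<Sum>s=1..r. x s i * L s j) = (if i = j then 1 else 0))"
proof -
  have "\<exists>L. \<forall>s\<in>{1..r}. \<forall>t\<in>{1..r}. (\<Sum>i=1..r. L s i * x t i) = (if s = t then 1 else 0)"
    using assms unfolding lin_indep_family_def by (intro dual_family_exists) auto
  then obtain L where L: "\<forall>s\<in>{1..r}. \<forall>t\<in>{1..r}. (\<Sum>i=1..r. L s i * x t i) = (if s = t then 1 else 0)" ..
  let ?A = "mat r r (\<lambda>(s, i). L (s + 1) (i + 1))"
  let ?B = "mat r r (\<lambda>(i, t). x (t + 1) (i + 1))"
  have shift: "(\<Sum>k = 0..<r. f (k + 1)) = (\<Sum>k=1..r. f k)" for f :: "nat \<Rightarrow> complex"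
    by (rule sum.reindex_bij_witness[of _ "\<lambda>k. k - 1" "\<lambda>k. k + 1"]) auto
  have "?A * ?B = 1\<^sub>m r"
  proof (rule eq_matI)
    fix s t assume "s < dim_row (1\<^sub>m r :: complex mat)" "t < dim_col (1\<^sub>m r :: complex mat)"
    then show "(?A * ?B) $$ (s, t) = 1\<^sub>m r $$ (s, t)"
      using L[THEN bspec, THEN bspec, of "s + 1" "t + 1"] shift[of "\<lambda>i. L (s + 1) i * x (t + 1) i"]
      by (simp add: scalar_prod_def)
  qed auto
  then have BA: "?B * ?A = 1\<^sub>m r"
    by (rule mat_mult_left_right_inverse[rotated 2]) auto
  have "(\<Sum>s=1..r. x s i * L s j) = (if i = j then 1 else 0)" if "i \<in> {1..r}" "j \<in> {1..r}" for i j
  proof -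
    have "(?B * ?A) $$ (i - 1, j - 1) = (1\<^sub>m r :: complex mat) $$ (i - 1, j - 1)" using BA by simp
    moreover have "i - 1 < r" "j - 1 < r" "i - 1 = j - 1 \<longleftrightarrow> i = j" "Suc (i - 1) = i" "Suc (j - 1) = j"
      using that by auto
    ultimately show ?thesis
      using shift[of "\<lambda>s. x s i * L s j"] by (simp add: scalar_prod_def)
  qed
  with L show ?thesis by blast
qed

text \<open>
  In an eigenbasis of the unperturbed matrix, the perturbed one is \<open>diag \<mu> + E\<close>; it has the
  eigenpairs \<open>(m s, a s)\<close>.
\<close>

lemma eigenvector_matching:
  fixes \<mu> m :: "nat \<Rightarrow> complex" and E a :: "nat \<Rightarrow> nat \<Rightarrow> complex"
  assumes gap: "\<And>s t. s \<in> {1..r} \<Longrightarrow> t \<in> {1..r} \<Longrightarrow> s \<noteq> t \<Longrightarrow> gap \<le> cmod (\<mu> s - \<mu> t)"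
    and E: "\<And>s t. s \<in> {1..r} \<Longrightarrow> t \<in> {1..r} \<Longrightarrow> cmod (E s t) \<le> \<delta>"
    and small: "4 * (real r * \<delta>) < gap"
    and eig: "\<And>s t. s \<in> {1..r} \<Longrightarrow> t \<in> {1..r} \<Longrightarrow>
                \<mu> t * a s t + (\<Sum>k=1..r. E t k * a s k) = m s * a s t"
    and indep: "lin_indep_family r {1..r} a"
  shows "\<exists>\<pi>. \<pi> permutes {1..r} \<and> (\<forall>s\<in>{1..r}. a s (\<pi> s) \<noteq> 0 \<and>
           (\<forall>t\<in>{1..r}. t \<noteq> \<pi> s \<longrightarrow> gap * cmod (a s t) \<le> 2 * (real r * \<delta>) * cmod (a s (\<pi> s))))"
proof (cases "r = 0")
  case True
  then show ?thesis by (intro exI[of _ id]) (auto simp: permutes_id)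
next
  case False
  have "0 \<le> \<delta>" using order_trans[OF norm_ge_zero E[of 1 1]] False by simp
  then have \<delta>: "0 \<le> \<delta>" "0 \<le> real r * \<delta>" by auto
  \<comment> \<open>Each eigenvector is represented by a coordinate of largest modulus; these
    coordinates will form the permutation.\<close>
  have "\<exists>u. u \<in> {1..r} \<and> (\<forall>t\<in>{1..r}. cmod (a s t) \<le> cmod (a s u))" for s
  proof -
    have "Max ((\<lambda>t. cmod (a s t)) ` {1..r}) \<in> (\<lambda>t. cmod (a s t)) ` {1..r}"
      using False by (intro Max_in) auto
    then obtain u where "u \<in> {1..r}" "cmod (a s u) = Max ((\<lambda>t. cmod (a s t)) ` {1..r})" by force
    then show ?thesis by (intro exI[of _ u]) auto
  qed
  then obtain u where u: "\<And>s. u s \<in> {1..r}" "\<And>s t. t \<in> {1..r} \<Longrightarrow> cmod (a s t) \<le> cmod (a s (u s))"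
    by metis
  have Eb: "cmod (\<Sum>k=1..r. E t k * f k) \<le> real r * \<delta> * D"
    if "t \<in> {1..r}" "\<And>k. k \<in> {1..r} \<Longrightarrow> cmod (f k) \<le> D" for t f D
  proof -
    have "cmod (\<Sum>k=1..r. E t k * f k) \<le> (\<Sum>k=1..r. \<delta> * D)"
    proof (rule order_trans[OF norm_sum], rule sum_mono)
      fix k assume "k \<in> {1..r}"
      then show "cmod (E t k * f k) \<le> \<delta> * D"
        using E[of t k] that \<delta> by (auto simp: norm_mult intro!: mult_mono)
    qed
    then show ?thesis by simp
  qed
  have nz: "a s (u s) \<noteq> 0" if s: "s \<in> {1..r}" for s
  proof
    assume "a s (u s) = 0"
    then have "a s t = 0" if "t \<in> {1..r}" for t using u(2)[OF that, of s] by simp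
    moreover define c where "c t = (if t = s then 1 else 0 :: complex)" for t
    ultimately have "\<forall>i\<in>{1..r}. (\<Sum>t=1..r. c t * a t i) = 0"
      using s by (simp add: c_def if_distrib[of "\<lambda>c. c * _"] cong: if_cong)
    with indep s have "c s = 0" unfolding lin_indep_family_def by blast
    then show False by (simp add: c_def)
  qed
  have eig': "cmod (m s - \<mu> t) * cmod (a s t) \<le> real r * \<delta> * cmod (a s (u s))"
    if "s \<in> {1..r}" "t \<in> {1..r}" for s t
  proof -
    have "(m s - \<mu> t) * a s t = (\<Sum>k=1..r. E t k * a s k)"
      using eig[OF that] by (simp add: algebra_simps)
    then show ?thesis using Eb[OF that(2), of "a s"] u(2) by (metis norm_mult)
  qed
  \<comment> \<open>At the dominant coordinate the entry cancels, so \<open>m s\<close> lies within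
    \<open>r * \<delta>\<close> of one of the unperturbed eigenvalues.\<close>
  have near: "cmod (m s - \<mu> (u s)) \<le> real r * \<delta>" if "s \<in> {1..r}" for s
    using eig'[OF that u(1)[of s]] nz[OF that] by simp
  \<comment> \<open>The triangle inequality costs at most \<open>r * \<delta>\<close>, less than a
    quarter of the gap, so at least half of the gap survives.\<close>
  have far: "gap \<le> 2 * cmod (m s - \<mu> t)" if "s \<in> {1..r}" "t \<in> {1..r}" "t \<noteq> u s" for s t
  proof -
    have "gap \<le> cmod (\<mu> (u s) - \<mu> t)" using gap[of "u s" t] u(1) that by auto
    also have "\<dots> \<le> cmod (m s - \<mu> t) + cmod (m s - \<mu> (u s))"
      using norm_triangle_ineq4[of "m s - \<mu> t" "m s - \<mu> (u s)"] by (simp add: algebra_simps)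
    finally show ?thesis using near[OF that(1)] small \<delta> by linarith
  qed
  have small_coord: "gap * cmod (a s t) \<le> 2 * (real r * \<delta>) * cmod (a s (u s))"
    if "s \<in> {1..r}" "t \<in> {1..r}" "t \<noteq> u s" for s t
  proof -
    have "gap * cmod (a s t) \<le> 2 * cmod (m s - \<mu> t) * cmod (a s t)"
      using far[OF that] by (intro mult_right_mono) auto
    then show ?thesis using eig'[OF that(1,2)] by simp
  qed
  \<comment> \<open>If two eigenvectors have the same dominant coordinate, the largest entry of the difference \<open>d\<close> of
    their normalizations is bounded by a proper fraction of itself.\<close>
  have inj: "inj_on u {1..r}"
  proof (rule inj_onI, rule ccontr)
    fix s s' assume s: "s \<in> {1..r}" "s' \<in> {1..r}" and eq: "u s = u s'" and ne: "s \<noteq> s'"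
    define b where "b t = a s t / a s (u s)" for t
    define b' where "b' t = a s' t / a s' (u s)" for t
    define d where "d t = b t - b' t" for t
    have b1: "cmod (b' t) \<le> 1" if "t \<in> {1..r}" for t
      using u(2)[OF that, of s'] nz[OF s(2)] eq by (simp add: b'_def norm_divide)
    have eb: "\<mu> t * b t + (\<Sum>k=1..r. E t k * b k) = m s * b t" if "t \<in> {1..r}" for t
      using arg_cong[OF eig[OF s(1) that], of "\<lambda>z. z / a s (u s)"]
      by (simp add: b_def add_divide_distrib sum_divide_distrib)
    have eb': "\<mu> t * b' t + (\<Sum>k=1..r. E t k * b' k) = m s' * b' t" if "t \<in> {1..r}" for t
      using arg_cong[OF eig[OF s(2) that], of "\<lambda>z. z / a s' (u s)"]
      by (simp add: b'_def add_divide_distrib sum_divide_distrib)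
    \<comment> \<open>Difference of the two normalized eigenvalue equations.\<close>
    have ed: "(\<Sum>k=1..r. E t k * d k) = (m s - \<mu> t) * d t + (m s - m s') * b' t" if "t \<in> {1..r}" for t
    proof -
      have "(\<Sum>k=1..r. E t k * d k) = (\<Sum>k=1..r. E t k * b k) - (\<Sum>k=1..r. E t k * b' k)"
        by (simp add: d_def right_diff_distrib sum_subtractf)
      also have "(\<Sum>k=1..r. E t k * b k) = (m s - \<mu> t) * b t"
        using eb[OF that] by (simp add: algebra_simps)
      also have "(\<Sum>k=1..r. E t k * b' k) = (m s' - \<mu> t) * b' t"
        using eb'[OF that] by (simp add: algebra_simps)
      finally show ?thesis by (simp add: d_def algebra_simps)
    qed
    have du: "d (u s) = 0" "b' (u s) = 1"
      using nz[OF s(1)] nz[OF s(2)] eq by (auto simp: d_def b_def b'_def)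
    obtain t where t: "t \<in> {1..r}" "\<And>k. k \<in> {1..r} \<Longrightarrow> cmod (d k) \<le> cmod (d t)"
    proof -
      have "Max ((\<lambda>t. cmod (d t)) ` {1..r}) \<in> (\<lambda>t. cmod (d t)) ` {1..r}"
        using False by (intro Max_in) auto
      then obtain t where "t \<in> {1..r}" "cmod (d t) = Max ((\<lambda>t. cmod (d t)) ` {1..r})" by force
      then show ?thesis using that[of t] by auto
    qed
    \<comment> \<open>At the common dominant coordinate \<open>d\<close> is 0 and \<open>b'\<close>
      is 1, so the equation for \<open>d\<close> isolates \<open>m s - m s'\<close>.\<close>
    have mm: "cmod (m s - m s') \<le> real r * \<delta> * cmod (d t)"
      using ed[OF u(1), of s] du Eb[OF u(1)[of s], of d, OF t(2)] by simp
    have "d t = 0"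
    proof (rule ccontr)
      assume "d t \<noteq> 0"
      then have tu: "t \<noteq> u s" using du by auto
      have "(m s - \<mu> t) * d t = (\<Sum>k=1..r. E t k * d k) - (m s - m s') * b' t"
        using ed[OF t(1)] by simp
      then have "cmod (m s - \<mu> t) * cmod (d t) \<le> cmod (\<Sum>k=1..r. E t k * d k) + cmod (m s - m s') * cmod (b' t)"
        by (metis norm_mult norm_triangle_ineq4)
      also have "\<dots> \<le> real r * \<delta> * cmod (d t) + real r * \<delta> * cmod (d t) * 1"
        using Eb[OF t(1), of d, OF t(2)] mm b1[OF t(1)] \<delta> by (intro add_mono mult_mono) auto
      finally have "cmod (m s - \<mu> t) \<le> 2 * (real r * \<delta>)"
        using \<open>d t \<noteq> 0\<close> by (simp add: field_simps)
      then show False using far[OF s(1) t(1) tu] small \<delta> by linarith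
    qed
    then have d0: "a s k / a s (u s) = a s' k / a s' (u s)" if "k \<in> {1..r}" for k
      using t(2)[OF that] by (simp add: d_def b_def b'_def)
    \<comment> \<open>Proportional eigenvectors give a nontrivial linear relation.\<close>
    define c where "c k = (if k = s then 1 / a s (u s) else if k = s' then - (1 / a s' (u s)) else 0)" for k
    have "\<forall>i\<in>{1..r}. (\<Sum>k=1..r. c k * a k i) = 0"
    proof
      fix i assume i: "i \<in> {1..r}"
      have "(\<Sum>k=1..r. c k * a k i) = (\<Sum>k\<in>{s, s'}. c k * a k i)"
        using s by (intro sum.mono_neutral_right) (auto simp: c_def)
      then show "(\<Sum>k=1..r. c k * a k i) = 0" using ne d0[OF i] by (simp add: c_def)
    qed
    with indep s(1) have "c s = 0" unfolding lin_indep_family_def by blast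
    then show False using nz[OF s(1)] by (simp add: c_def)
  qed
  then have "bij_betw u {1..r} {1..r}"
    using u(1) by (intro bij_betw_imageI endo_inj_surj) auto
  then have "bij_betw (\<lambda>s. if s \<in> {1..r} then u s else s) {1..r} {1..r}"
    by (subst bij_betw_cong[where g = u]) auto
  then have "(\<lambda>s. if s \<in> {1..r} then u s else s) permutes {1..r}"
    by (rule bij_imp_permutes) auto
  then show ?thesis
    using nz small_coord by (intro exI[of _ "\<lambda>s. if s \<in> {1..r} then u s else s"]) auto
qed

text \<open>The difference of the cubes is the product of the differences between \<open>a\<close>
  and the three multiples of \<open>z\<close> by cube roots of unity. For the nearest multiple the
  other two distances are at least \<open>sqrt 3 / 2 * cmod a\<close>, because a nontrivial root
  moves \<open>a\<close> by \<open>sqrt 3 * cmod a\<close>. This gives the constant.\<close>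

lemma cube_root_near:
  fixes z a :: complex
  assumes "a \<noteq> 0"
  shows "\<exists>\<tau>. \<tau> ^ 3 = 1 \<and> cmod (\<tau> * z - a) \<le> 4 / (3 * (cmod a)\<^sup>2) * cmod (z ^ 3 - a ^ 3)"
proof -
  define \<omega> where "\<omega> = Complex (-1/2) (sqrt 3 / 2)"
  have \<omega>2: "\<omega>\<^sup>2 = - 1 - \<omega>" by (simp add: \<omega>_def power2_eq_square complex_eq_iff)
  have \<omega>3: "\<omega> ^ 3 = 1" by (simp add: \<omega>_def power3_eq_cube complex_eq_iff)
  have \<omega>1: "cmod (\<omega> - 1) = sqrt 3" "cmod (\<omega>\<^sup>2 - 1) = sqrt 3"
    by (simp_all add: \<omega>_def power2_eq_square cmod_def)
  have n\<omega>: "cmod \<omega> = 1" by (simp add: \<omega>_def cmod_def power2_eq_square)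
  have factor: "y ^ 3 - a ^ 3 = (y - a) * (\<omega> * y - a) * (\<omega>\<^sup>2 * y - a)" for y
  proof -
    have "(\<omega> * y - a) * (\<omega>\<^sup>2 * y - a) = \<omega> ^ 3 * y\<^sup>2 - (\<omega> + \<omega>\<^sup>2) * (a * y) + a\<^sup>2"
      by (simp add: algebra_simps power2_eq_square power3_eq_cube)
    also have "\<dots> = y\<^sup>2 + a * y + a\<^sup>2" by (simp add: \<omega>2 \<omega>3)
    finally show ?thesis
      by (simp add: mult.assoc) (simp add: algebra_simps power2_eq_square power3_eq_cube)
  qed
  have bound: "cmod (y - a) \<le> 4 / (3 * (cmod a)\<^sup>2) * cmod (y ^ 3 - a ^ 3)"
    if le: "cmod (y - a) \<le> cmod (\<omega> * y - a)" "cmod (y - a) \<le> cmod (\<omega>\<^sup>2 * y - a)" for y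
  proof -
    have other: "sqrt 3 / 2 * cmod a \<le> cmod (w * y - a)"
      if w: "cmod w = 1" "cmod (w - 1) = sqrt 3" "cmod (y - a) \<le> cmod (w * y - a)" for w
    proof -
      have "cmod (w - 1) * cmod a = cmod ((w * y - a) - w * (y - a))"
        by (subst norm_mult[symmetric]) (simp add: algebra_simps)
      also have "\<dots> \<le> cmod (w * y - a) + cmod (w * (y - a))" by (rule norm_triangle_ineq4)
      also have "\<dots> \<le> 2 * cmod (w * y - a)" using w by (simp add: norm_mult)
      finally show ?thesis using w by simp
    qed
    have "(sqrt 3 / 2 * cmod a) * (sqrt 3 / 2 * cmod a) \<le> cmod (\<omega> * y - a) * cmod (\<omega>\<^sup>2 * y - a)"
      using other[of \<omega>] other[of "\<omega>\<^sup>2"] le \<omega>1 n\<omega> by (intro mult_mono) (auto simp: norm_power)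
    moreover have "(sqrt 3 / 2 * cmod a)\<^sup>2 = 3 / 4 * (cmod a)\<^sup>2"
      by (simp add: power_mult_distrib power_divide)
    ultimately have "3 / 4 * (cmod a)\<^sup>2 \<le> cmod (\<omega> * y - a) * cmod (\<omega>\<^sup>2 * y - a)"
      by (simp only: power2_eq_square)
    then have "3 / 4 * (cmod a)\<^sup>2 * cmod (y - a) \<le> cmod (\<omega> * y - a) * cmod (\<omega>\<^sup>2 * y - a) * cmod (y - a)"
      by (intro mult_right_mono) auto
    also have "\<dots> = cmod (y ^ 3 - a ^ 3)" by (simp add: factor norm_mult)
    finally show ?thesis using assms by (simp add: field_simps)
  qed
  have w3: "\<omega> * \<omega>\<^sup>2 = 1" "\<omega>\<^sup>2 * \<omega>\<^sup>2 = \<omega>"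
    using \<omega>3 by (simp_all add: power2_eq_square power3_eq_cube mult.assoc)
  \<comment> \<open>The nearest of the three multiples decides the choice of the root; in the last
    two cases the bound is applied to a rotated \<open>z\<close>, whose cube is the same.\<close>
  consider "cmod (z - a) \<le> cmod (\<omega> * z - a)" "cmod (z - a) \<le> cmod (\<omega>\<^sup>2 * z - a)"
    | "cmod (\<omega> * z - a) \<le> cmod (z - a)" "cmod (\<omega> * z - a) \<le> cmod (\<omega>\<^sup>2 * z - a)"
    | "cmod (\<omega>\<^sup>2 * z - a) \<le> cmod (z - a)" "cmod (\<omega>\<^sup>2 * z - a) \<le> cmod (\<omega> * z - a)"
    by linarith
  then show ?thesis
  proof cases
    case 1
    then show ?thesis using bound[of z] by (intro exI[of _ 1]) simp
  next
    case 2
    have eqs: "\<omega> * (\<omega> * z) = \<omega>\<^sup>2 * z" "\<omega>\<^sup>2 * (\<omega> * z) = z" "(\<omega> * z) ^ 3 = z ^ 3"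
      using w3 \<omega>3
      by (simp_all only: power_mult_distrib mult.assoc[symmetric] mult.commute[of "\<omega>\<^sup>2" \<omega>] mult_1_left)
        (simp add: power2_eq_square)
    show ?thesis using 2 bound[of "\<omega> * z", unfolded eqs] \<omega>3 by (intro exI[of _ \<omega>] conjI)
  next
    case 3
    have cube: "(\<omega>\<^sup>2) ^ 3 = 1" by (metis \<omega>3 power_mult mult.commute power_one)
    then have eqs: "\<omega> * (\<omega>\<^sup>2 * z) = z" "\<omega>\<^sup>2 * (\<omega>\<^sup>2 * z) = \<omega> * z" "(\<omega>\<^sup>2 * z) ^ 3 = z ^ 3"
      using w3 by (simp_all add: power_mult_distrib mult.assoc[symmetric])
    show ?thesis using 3 bound[of "\<omega>\<^sup>2 * z", unfolded eqs] cube by (intro exI[of _ "\<omega>\<^sup>2"] conjI)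
  qed
qed

declare One_nat_def [simp del]

section \<open>First order perturbation estimates\<close>

text \<open>A left inverse of the limit matrix recovers \<open>h\<close> from its image up to an
  error matrix that tends to 0, and this error is absorbed. The gauge \<open>g\<close> is arbitrary:
  the data error gives stability, and 0 gives injectivity near the limit.\<close>

lemma stable_injective:
  fixes A :: "'x \<Rightarrow> 'i \<Rightarrow> 's \<Rightarrow> complex" and h :: "'x \<Rightarrow> 's \<Rightarrow> complex"
  assumes fin: "finite I" "finite S"
    and inj: "\<And>c. (\<forall>i\<in>I. (\<Sum>s\<in>S. A0 i s * c s) = 0) \<Longrightarrow> \<forall>s\<in>S. c s = 0"
    and lim: "\<And>i s. i \<in> I \<Longrightarrow> s \<in> S \<Longrightarrow> ((\<lambda>x. A x i s) \<longlongrightarrow> A0 i s) \<FF>"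
    and O: "\<And>i. i \<in> I \<Longrightarrow> (\<lambda>x. \<Sum>s\<in>S. A x i s * h x s) \<in> O[\<FF>](g)"
    and k: "k \<in> S"
  shows "(\<lambda>x. h x k) \<in> O[\<FF>](g)"
proof -
  have "\<exists>L. \<forall>s\<in>S. \<forall>t\<in>S. (\<Sum>i\<in>I. L s i * A0 i t) = (if s = t then 1 else 0)"
    using fin inj by (intro dual_family_exists) (auto simp: mult.commute)
  then obtain L where L': "\<forall>s\<in>S. \<forall>t\<in>S. (\<Sum>i\<in>I. L s i * A0 i t) = (if s = t then 1 else 0)" ..
  then have L: "(\<Sum>i\<in>I. L s i * A0 i t) = (if s = t then 1 else 0)" if "s \<in> S" "t \<in> S" for s t
    using that by blast
  define R where "R k x = (\<Sum>i\<in>I. L k i * (\<Sum>s\<in>S. A x i s * h x s))" for k x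
  define B where "B k s x = (\<Sum>i\<in>I. L k i * (A0 i s - A x i s))" for k s x
  define b where "b x = (\<Sum>k\<in>S. \<Sum>s\<in>S. cmod (B k s x))" for x
  define H where "H x = (\<Sum>k\<in>S. cmod (h x k))" for x
  \<comment> \<open>The identity \<open>h = L A h + L (A0 - A) h\<close> in coordinates.\<close>
  have h: "h x k = R k x + (\<Sum>s\<in>S. B k s x * h x s)" if "k \<in> S" for x k
  proof -
    have "R k x = (\<Sum>s\<in>S. (\<Sum>i\<in>I. L k i * A x i s) * h x s)"
      unfolding R_def sum_distrib_left sum_distrib_right by (subst sum.swap) (simp add: mult.assoc)
    then have "R k x + (\<Sum>s\<in>S. B k s x * h x s) = (\<Sum>s\<in>S. (\<Sum>i\<in>I. L k i * A0 i s) * h x s)"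
      by (simp add: B_def sum.distrib[symmetric] algebra_simps sum_subtractf)
    also have "\<dots> = (\<Sum>s\<in>S. if k = s then h x s else 0)"
      using L that by (intro sum.cong) auto
    finally show ?thesis using that fin by simp
  qed
  have "((\<lambda>x. B k s x) \<longlongrightarrow> (\<Sum>i\<in>I. L k i * (A0 i s - A0 i s))) \<FF>" if "s \<in> S" for k s
    unfolding B_def using that lim by (intro tendsto_intros) auto
  then have "(b \<longlongrightarrow> (\<Sum>k\<in>S. \<Sum>s\<in>S. cmod 0)) \<FF>"
    unfolding b_def by (intro tendsto_sum tendsto_norm) auto
  then have "(b \<longlongrightarrow> 0) \<FF>" by simp
  \<comment> \<open>Once the total error is below 1/2, the sum \<open>H\<close> is at most half of
    itself plus the controlled term, whence the factor 2.\<close>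
  then have "eventually (\<lambda>x. b x < 1/2) \<FF>" by (rule order_tendstoD(2)) simp
  then have le: "eventually (\<lambda>x. cmod (h x k) \<le> 2 * (\<Sum>k\<in>S. cmod (R k x))) \<FF>"
  proof eventually_elim
    case (elim x)
    have H: "cmod (h x s) \<le> H x" if "s \<in> S" for s
      unfolding H_def using that fin by (intro member_le_sum) auto
    have "cmod (h x k) \<le> cmod (R k x) + (\<Sum>s\<in>S. cmod (B k s x) * H x)" if "k \<in> S" for k
    proof -
      have "cmod (h x k) \<le> cmod (R k x) + cmod (\<Sum>s\<in>S. B k s x * h x s)"
        by (subst h[OF that]) (rule norm_triangle_ineq)
      also have "cmod (\<Sum>s\<in>S. B k s x * h x s) \<le> (\<Sum>s\<in>S. cmod (B k s x) * H x)"
        by (rule order_trans[OF norm_sum], rule sum_mono) (auto simp: norm_mult intro!: mult_left_mono H)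
      finally show ?thesis by simp
    qed
    then have "H x \<le> (\<Sum>k\<in>S. cmod (R k x) + (\<Sum>s\<in>S. cmod (B k s x) * H x))"
      unfolding H_def by (rule sum_mono)
    also have "\<dots> = (\<Sum>k\<in>S. cmod (R k x)) + b x * H x"
      by (simp add: sum.distrib b_def sum_distrib_right)
    also have "b x * H x \<le> 1/2 * H x"
      using elim by (intro mult_right_mono) (auto simp: H_def intro: sum_nonneg)
    finally have "H x \<le> 2 * (\<Sum>k\<in>S. cmod (R k x))" by simp
    then show ?case using H[OF k] by simp
  qed
  have R: "R k \<in> O[\<FF>](g)" for k
    unfolding R_def by (rule big_sum_in_bigo) (simp add: O)
  have "\<exists>c. eventually (\<lambda>x. cmod (R k x) \<le> c * cmod (g x)) \<FF>" for k
    using R[of k] by (elim landau_o.bigE) blast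
  then obtain c where "\<And>k. eventually (\<lambda>x. cmod (R k x) \<le> c k * cmod (g x)) \<FF>" by metis
  then have "eventually (\<lambda>x. \<forall>k\<in>S. cmod (R k x) \<le> c k * cmod (g x)) \<FF>"
    using fin by (intro eventually_ball_finite) auto
  with le have "eventually (\<lambda>x. cmod (h x k) \<le> (2 * (\<Sum>k\<in>S. c k)) * cmod (g x)) \<FF>"
  proof eventually_elim
    case (elim x)
    have "(\<Sum>k\<in>S. cmod (R k x)) \<le> (\<Sum>k\<in>S. c k) * cmod (g x)"
      unfolding sum_distrib_right using elim by (intro sum_mono) auto
    then show ?case using elim by simp
  qed
  then show ?thesis by (rule bigoI)
qed

section \<open>Arithmetic of first order estimates\<close>

text \<open>A point of the filter stands for a problem instance together with the choices made by
  the algorithm, and \<open>e\<close> is its data error. The error is complex-valued because the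
  Landau symbols compare functions into one field.\<close>

locale approximation =
  fixes \<FF> :: "'x filter" and e :: "'x \<Rightarrow> complex"
  assumes e_lim: "(e \<longlongrightarrow> 0) \<FF>"
begin

definition near :: "('x \<Rightarrow> complex) \<Rightarrow> complex \<Rightarrow> bool" where
  "near f a \<longleftrightarrow> (\<lambda>x. f x - a) \<in> O[\<FF>](e)"

lemma near_const [simp]: "near (\<lambda>_. a) a"
  by (simp add: near_def)

lemma near_cong:
  assumes "eventually (\<lambda>x. f x = g x) \<FF>" "near f a"
  shows "near g a"
  using assms landau_o.big.in_cong[of "\<lambda>x. f x - a" "\<lambda>x. g x - a" \<FF> e]
  by (auto simp: near_def elim: eventually_mono)

lemma near_add: "near f a \<Longrightarrow> near g b \<Longrightarrow> near (\<lambda>x. f x + g x) (a + b)"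
  unfolding near_def using sum_in_bigo(1)[of "\<lambda>x. f x - a" \<FF> e "\<lambda>x. g x - b"]
  by (simp add: algebra_simps)

lemma near_diff: "near f a \<Longrightarrow> near g b \<Longrightarrow> near (\<lambda>x. f x - g x) (a - b)"
  unfolding near_def using sum_in_bigo(2)[of "\<lambda>x. f x - a" \<FF> e "\<lambda>x. g x - b"]
  by (simp add: algebra_simps)

lemma near_sum: "(\<And>i. i \<in> I \<Longrightarrow> near (f i) (a i)) \<Longrightarrow> near (\<lambda>x. \<Sum>i\<in>I. f i x) (\<Sum>i\<in>I. a i)"
  unfolding near_def sum_subtractf[symmetric] by (rule big_sum_in_bigo)

lemma near_tendsto:
  assumes "near f a"
  shows "(f \<longlongrightarrow> a) \<FF>"
proof -
  obtain c where "eventually (\<lambda>x. cmod (f x - a) \<le> c * cmod (e x)) \<FF>"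
    using assms unfolding near_def by (elim landau_o.bigE)
  moreover have "((\<lambda>x. c * cmod (e x)) \<longlongrightarrow> 0) \<FF>"
    using tendsto_mult_right_zero[OF tendsto_norm_zero[OF e_lim]] .
  ultimately have "((\<lambda>x. f x - a) \<longlongrightarrow> 0) \<FF>" by (rule Lim_null_comparison)
  then show ?thesis by (rule LIM_zero_cancel)
qed

lemma tendsto_imp_bigo_1: "(f \<longlongrightarrow> a) \<FF> \<Longrightarrow> f \<in> O[\<FF>](\<lambda>_. 1 :: complex)"
  by (rule bigoI_tendsto[of _ _ a]) auto

lemma near_mult:
  assumes "near f a" "near g b"
  shows "near (\<lambda>x. f x * g x) (a * b)"
proof -
  have "(\<lambda>x. (f x - a) * g x) \<in> O[\<FF>](\<lambda>x. e x * 1)"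
    using assms tendsto_imp_bigo_1[OF near_tendsto[OF assms(2)]]
    unfolding near_def by (intro landau_o.big.mult)
  moreover have "(\<lambda>x. a * (g x - b)) \<in> O[\<FF>](e)" using assms(2) by (simp add: near_def)
  ultimately have "(\<lambda>x. (f x - a) * g x + a * (g x - b)) \<in> O[\<FF>](e)"
    by (intro sum_in_bigo) auto
  then show ?thesis by (simp add: near_def algebra_simps)
qed

lemma near_eventually_nonzero: "near f a \<Longrightarrow> a \<noteq> 0 \<Longrightarrow> eventually (\<lambda>x. f x \<noteq> 0) \<FF>"
  by (rule tendsto_imp_eventually_ne[OF near_tendsto])

lemma near_inverse:
  assumes "near f a" "a \<noteq> 0"
  shows "near (\<lambda>x. inverse (f x)) (inverse a)"
proof -
  have "((\<lambda>x. - (inverse (f x) * inverse a)) \<longlongrightarrow> - (inverse a * inverse a)) \<FF>"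
    using assms by (intro tendsto_intros near_tendsto) auto
  from tendsto_imp_bigo_1[OF this]
  have "(\<lambda>x. (f x - a) * - (inverse (f x) * inverse a)) \<in> O[\<FF>](\<lambda>x. e x * 1)"
    using assms(1) unfolding near_def by (intro landau_o.big.mult)
  then have big: "(\<lambda>x. (f x - a) * - (inverse (f x) * inverse a)) \<in> O[\<FF>](e)" by simp
  have ev: "eventually (\<lambda>x. (f x - a) * - (inverse (f x) * inverse a) = inverse (f x) - inverse a) \<FF>"
    using near_eventually_nonzero[OF assms] by eventually_elim (use assms(2) in \<open>simp add: field_simps\<close>)
  show ?thesis
    unfolding near_def by (rule landau_o.big.in_cong[OF ev, THEN iffD1, OF big])
qed

lemma near_divide: "near f a \<Longrightarrow> near g b \<Longrightarrow> b \<noteq> 0 \<Longrightarrow> near (\<lambda>x. f x / g x) (a / b)"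
  unfolding divide_inverse by (intro near_mult near_inverse)

lemma near_power: "near f a \<Longrightarrow> near (\<lambda>x. f x ^ k) (a ^ k)"
  by (induction k) (auto intro: near_mult)

lemma near_cnj: "near f a \<Longrightarrow> near (\<lambda>x. cnj (f x)) (cnj a)"
  unfolding near_def
  by (subst (asm) landau_o.big.norm_iff[symmetric], subst landau_o.big.norm_iff[symmetric])
    (simp flip: complex_cnj_diff)

lemma near_zero_le:
  assumes "near f 0" "eventually (\<lambda>x. cmod (g x - a) \<le> C * cmod (f x)) \<FF>"
  shows "near g a"
  using assms unfolding near_def by (simp add: landau_o.big_trans[OF bigoI])

lemma near_zero_norm: "near f 0 \<Longrightarrow> near (\<lambda>x. of_real (cmod (f x))) 0"
  by (erule near_zero_le[where C = 1]) simp

lemmas near_intros = near_const near_add near_diff near_sum near_mult near_cnj near_power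

section \<open>Stability of least squares solutions and eigenvectors\<close>

text \<open>The residual at \<open>g0\<close> is of first order because \<open>g0\<close> solves the
  limit problem exactly, and the computed residual is no larger. Their difference is
  \<open>A x\<close> applied to \<open>g x - g0\<close>, so the stability of injective systems
  applies. The only competitor in \<open>opt\<close> is \<open>g0\<close>, so exact solutions
  qualify as well as optimizers.\<close>

lemma least_squares_near:
  fixes A :: "'x \<Rightarrow> 'i \<Rightarrow> 's \<Rightarrow> complex"
  assumes fin: "finite I" "finite S"
    and inj: "\<And>c. (\<forall>i\<in>I. (\<Sum>s\<in>S. A0 i s * c s) = 0) \<Longrightarrow> \<forall>s\<in>S. c s = 0"
    and A: "\<And>i s. i \<in> I \<Longrightarrow> s \<in> S \<Longrightarrow> near (\<lambda>x. A x i s) (A0 i s)"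
    and b: "\<And>i. i \<in> I \<Longrightarrow> near (\<lambda>x. b x i) (\<Sum>s\<in>S. A0 i s * g0 s)"
    and opt: "eventually (\<lambda>x. L2_set (\<lambda>i. cmod (b x i - (\<Sum>s\<in>S. A x i s * g x s))) I
                        \<le> L2_set (\<lambda>i. cmod (b x i - (\<Sum>s\<in>S. A x i s * g0 s))) I) \<FF>"
    and k: "k \<in> S"
  shows "near (\<lambda>x. g x k) (g0 k)"
proof -
  define res where "res g x i = b x i - (\<Sum>s\<in>S. A x i s * g s)" for g x i
  have res0: "near (\<lambda>x. res g0 x i) 0" if "i \<in> I" for i
  proof -
    have "near (\<lambda>x. res g0 x i) ((\<Sum>s\<in>S. A0 i s * g0 s) - (\<Sum>s\<in>S. A0 i s * g0 s))"
      unfolding res_def using that by (intro near_intros A b)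
    then show ?thesis by simp
  qed
  then have "near (\<lambda>x. \<Sum>i\<in>I. of_real (cmod (res g0 x i))) (\<Sum>i\<in>I. 0)"
    by (intro near_sum near_zero_norm)
  then have tot: "near (\<lambda>x. \<Sum>i\<in>I. of_real (cmod (res g0 x i))) 0" by simp
  have res: "near (\<lambda>x. res (g x) x i) 0" if i: "i \<in> I" for i
    using tot
  proof (rule near_zero_le[where C = 1])
    show "eventually (\<lambda>x. cmod (res (g x) x i - 0) \<le> 1 * cmod (\<Sum>i\<in>I. of_real (cmod (res g0 x i)))) \<FF>"
      using opt
    proof eventually_elim
      case (elim x)
      have "cmod (res (g x) x i) \<le> L2_set (\<lambda>i. cmod (res (g x) x i)) I"
        using fin i by (intro member_le_L2_set)
      also have "\<dots> \<le> L2_set (\<lambda>i. cmod (res g0 x i)) I" using elim by (simp add: res_def)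
      also have "\<dots> \<le> (\<Sum>i\<in>I. cmod (res g0 x i))" by (rule L2_set_le_sum) auto
      also have "\<dots> = cmod (\<Sum>i\<in>I. of_real (cmod (res g0 x i)))"
        by (simp add: sum_nonneg flip: of_real_sum)
      finally show ?case by simp
    qed
  qed
  have "near (\<lambda>x. res g0 x i - res (g x) x i) (0 - 0)" if "i \<in> I" for i
    using res0 res that by (intro near_diff)
  moreover have "res g0 x i - res (g x) x i = (\<Sum>s\<in>S. A x i s * (g x s - g0 s))" for x i
    by (simp add: res_def algebra_simps sum_subtractf)
  ultimately have "(\<lambda>x. \<Sum>s\<in>S. A x i s * (g x s - g0 s)) \<in> O[\<FF>](e)" if "i \<in> I" for i
    using that by (simp add: near_def)
  from stable_injective[OF fin inj near_tendsto[OF A] this k]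
  show ?thesis by (simp add: near_def)
qed

text \<open>In the basis \<open>u\<close> the limit matrix is diagonal and the perturbation is of
  first order, so eigenvectors can be matched at each point of the filter. Division by the dominant
  coordinate fixes their scale. The permutation may vary from point to point.\<close>

lemma eigenvectors_near:
  fixes M :: "'x \<Rightarrow> nat \<Rightarrow> nat \<Rightarrow> complex"
  assumes U: "lin_indep_family r {1..r} u"
    and eig0: "\<And>s i. s \<in> {1..r} \<Longrightarrow> i \<in> {1..r} \<Longrightarrow> (\<Sum>k=1..r. M0 i k * u s k) = \<mu> s * u s i"
    and inj: "inj_on \<mu> {1..r}"
    and M: "\<And>i k. i \<in> {1..r} \<Longrightarrow> k \<in> {1..r} \<Longrightarrow> near (\<lambda>x. M x i k) (M0 i k)"
    and eig: "eventually (\<lambda>x. \<forall>s\<in>{1..r}. \<forall>i\<in>{1..r}. (\<Sum>k=1..r. M x i k * v x s k) = m x s * v x s i) \<FF>"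
    and indep: "eventually (\<lambda>x. lin_indep_family r {1..r} (v x)) \<FF>"
  shows "\<exists>\<sigma> c. eventually (\<lambda>x. \<sigma> x permutes {1..r} \<and> (\<forall>s\<in>{1..r}. c x s \<noteq> 0)) \<FF> \<and>
           (\<forall>s\<in>{1..r}. \<forall>i\<in>{1..r}. near (\<lambda>x. v x (\<sigma> x s) i / c x s) (u s i))"
proof -
  obtain L where L: "\<And>s t. s \<in> {1..r} \<Longrightarrow> t \<in> {1..r} \<Longrightarrow> (\<Sum>i=1..r. L s i * u t i) = (if s = t then 1 else 0)"
      "\<And>i j. i \<in> {1..r} \<Longrightarrow> j \<in> {1..r} \<Longrightarrow> (\<Sum>s=1..r. u s i * L s j) = (if i = j then 1 else 0)"
    using square_dual_family_exists[OF U] by blast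
  \<comment> \<open>\<open>a x s\<close> lists the coordinates of \<open>v x s\<close> in the basis
    \<open>u\<close>, and \<open>E x\<close> is the perturbation written in that basis.\<close>
  define a where "a x s t = (\<Sum>i=1..r. L t i * v x s i)" for x s t
  define E where "E x t k = (\<Sum>i=1..r. \<Sum>j=1..r. L t i * (M x i j - M0 i j) * u k j)" for x t k
  have v: "v x s i = (\<Sum>t=1..r. u t i * a x s t)" if "i \<in> {1..r}" for x s i
  proof -
    have "(\<Sum>t=1..r. u t i * a x s t) = (\<Sum>j=1..r. (\<Sum>t=1..r. u t i * L t j) * v x s j)"
      unfolding a_def sum_distrib_left sum_distrib_right by (subst sum.swap) (simp add: mult.assoc)
    also have "\<dots> = (\<Sum>j=1..r. if i = j then v x s j else 0)"
      using that by (intro sum.cong refl) (simp add: L)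
    finally show ?thesis using that by simp
  qed
  have Ea: "(\<Sum>k=1..r. E x t k * a x s k) = (\<Sum>i=1..r. L t i * (\<Sum>j=1..r. (M x i j - M0 i j) * v x s j))" for x t s
  proof -
    have "(\<Sum>k=1..r. E x t k * a x s k) =
        (\<Sum>k=1..r. \<Sum>i=1..r. \<Sum>j=1..r. L t i * (M x i j - M0 i j) * u k j * a x s k)"
      unfolding E_def sum_distrib_right ..
    also have "\<dots> = (\<Sum>i=1..r. \<Sum>k=1..r. \<Sum>j=1..r. L t i * (M x i j - M0 i j) * u k j * a x s k)"
      by (rule sum.swap)
    also have "\<dots> = (\<Sum>i=1..r. \<Sum>j=1..r. \<Sum>k=1..r. L t i * (M x i j - M0 i j) * u k j * a x s k)"
      by (intro sum.cong refl sum.swap)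
    also have "\<dots> = (\<Sum>i=1..r. L t i * (\<Sum>j=1..r. (M x i j - M0 i j) * v x s j))"
      by (intro sum.cong refl) (simp add: v sum_distrib_left mult.assoc)
    finally show ?thesis .
  qed
  have M0v: "(\<Sum>i=1..r. L t i * (\<Sum>j=1..r. M0 i j * v x s j)) = \<mu> t * a x s t" if t: "t \<in> {1..r}" for x s t
  proof -
    have "(\<Sum>j=1..r. M0 i j * v x s j) = (\<Sum>k=1..r. \<mu> k * u k i * a x s k)" if "i \<in> {1..r}" for i
    proof -
      have "(\<Sum>j=1..r. M0 i j * v x s j) = (\<Sum>j=1..r. \<Sum>k=1..r. M0 i j * u k j * a x s k)"
        by (intro sum.cong refl) (simp add: v sum_distrib_left mult.assoc)
      also have "\<dots> = (\<Sum>k=1..r. \<Sum>j=1..r. M0 i j * u k j * a x s k)" by (rule sum.swap)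
      also have "\<dots> = (\<Sum>k=1..r. \<mu> k * u k i * a x s k)"
        using eig0 that by (intro sum.cong refl) (simp flip: sum_distrib_right)
      finally show ?thesis .
    qed
    then have "(\<Sum>i=1..r. L t i * (\<Sum>j=1..r. M0 i j * v x s j)) =
        (\<Sum>i=1..r. \<Sum>k=1..r. L t i * (\<mu> k * u k i * a x s k))"
      by (intro sum.cong refl) (simp add: sum_distrib_left)
    also have "\<dots> = (\<Sum>k=1..r. \<Sum>i=1..r. L t i * (\<mu> k * u k i * a x s k))" by (rule sum.swap)
    also have "\<dots> = (\<Sum>k=1..r. (\<Sum>i=1..r. L t i * u k i) * (\<mu> k * a x s k))"
      by (intro sum.cong refl) (simp add: sum_distrib_left sum_distrib_right algebra_simps)
    also have "\<dots> = (\<Sum>k=1..r. if t = k then \<mu> k * a x s k else 0)"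
      using t by (intro sum.cong refl) (simp add: L)
    finally show ?thesis using t by simp
  qed
  have E0: "near (\<lambda>x. E x t k) 0" for t k
  proof -
    have "near (\<lambda>x. E x t k) (\<Sum>i=1..r. \<Sum>j=1..r. L t i * (M0 i j - M0 i j) * u k j)"
      unfolding E_def by (intro near_intros M)
    then show ?thesis by simp
  qed
  \<comment> \<open>The sum of all moduli is a common bound for the entries that is itself of first
    order.\<close>
  define \<delta> where "\<delta> x = (\<Sum>t=1..r. \<Sum>k=1..r. cmod (E x t k))" for x
  have \<delta>near: "near (\<lambda>x. of_real (\<delta> x)) 0"
  proof -
    have "near (\<lambda>x. of_real (\<delta> x)) (\<Sum>t=1..r. \<Sum>k=1..r. 0)"
      unfolding \<delta>_def of_real_sum by (intro near_sum near_zero_norm E0)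
    then show ?thesis by simp
  qed
  have \<delta>: "(\<delta> \<longlongrightarrow> 0) \<FF>"
    using tendsto_Re[OF near_tendsto[OF \<delta>near]] by simp
  \<comment> \<open>The inserted 1 keeps the minimum defined when there are no pairs, that is, for
    \<open>r\<close> at most 1.\<close>
  define gap where "gap = Min (insert 1 ((\<lambda>(s, t). cmod (\<mu> s - \<mu> t)) ` {(s, t) \<in> {1..r} \<times> {1..r}. s \<noteq> t}))"
  have gapfin: "finite ((\<lambda>(s, t). cmod (\<mu> s - \<mu> t)) ` {(s, t) \<in> {1..r} \<times> {1..r}. s \<noteq> t})"
    by (rule finite_imageI, rule finite_subset[of _ "{1..r} \<times> {1..r}"]) auto
  have gap0: "0 < gap"
    unfolding gap_def using gapfin by (subst Min_gr_iff) (auto simp: inj_on_eq_iff[OF inj])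
  have gap: "gap \<le> cmod (\<mu> s - \<mu> t)" if "s \<in> {1..r}" "t \<in> {1..r}" "s \<noteq> t" for s t
  proof -
    have "(\<lambda>(s, t). cmod (\<mu> s - \<mu> t)) (s, t) \<in> (\<lambda>(s, t). cmod (\<mu> s - \<mu> t)) ` {(s, t) \<in> {1..r} \<times> {1..r}. s \<noteq> t}"
      by (rule imageI) (use that in simp)
    then show ?thesis unfolding gap_def using gapfin by (intro Min_le) auto
  qed
  define P where "P x \<pi> \<longleftrightarrow> \<pi> permutes {1..r} \<and> (\<forall>s\<in>{1..r}. a x s (\<pi> s) \<noteq> 0 \<and>
           (\<forall>t\<in>{1..r}. t \<noteq> \<pi> s \<longrightarrow> gap * cmod (a x s t) \<le> 2 * (real r * \<delta> x) * cmod (a x s (\<pi> s))))" for x \<pi>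
  have "((\<lambda>x. 4 * (real r * \<delta> x)) \<longlongrightarrow> 4 * (real r * 0)) \<FF>" by (intro tendsto_intros \<delta>)
  then have "eventually (\<lambda>x. 4 * (real r * \<delta> x) < gap) \<FF>"
    using gap0 by (auto intro: order_tendstoD)
  then have "eventually (\<lambda>x. \<exists>\<pi>. P x \<pi>) \<FF>"
    using eig indep
  proof eventually_elim
    case (elim x)
    show ?case unfolding P_def
    proof (rule eigenvector_matching[where gap = gap and \<mu> = \<mu> and E = "E x" and m = "m x"])
      show "gap \<le> cmod (\<mu> s - \<mu> t)" if "s \<in> {1..r}" "t \<in> {1..r}" "s \<noteq> t" for s t
        using that by (rule gap)
      show "cmod (E x s t) \<le> \<delta> x" if "s \<in> {1..r}" "t \<in> {1..r}" for s t
      proof -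
        have "cmod (E x s t) \<le> (\<Sum>k=1..r. cmod (E x s k))"
          using that by (intro member_le_sum[of t _ "\<lambda>k. cmod (E x s k)"]) auto
        also have "\<dots> \<le> \<delta> x" unfolding \<delta>_def
          using that by (intro member_le_sum[of s _ "\<lambda>s. \<Sum>k=1..r. cmod (E x s k)"]) (auto intro: sum_nonneg)
        finally show ?thesis .
      qed
      show "4 * (real r * \<delta> x) < gap" by fact
      show "\<mu> t * a x s t + (\<Sum>k=1..r. E x t k * a x s k) = m x s * a x s t"
        if st: "s \<in> {1..r}" "t \<in> {1..r}" for s t
      proof -
        have "\<mu> t * a x s t + (\<Sum>k=1..r. E x t k * a x s k) =
            (\<Sum>i=1..r. L t i * (\<Sum>j=1..r. M x i j * v x s j))"
          unfolding Ea M0v[OF st(2), symmetric] sum.distrib[symmetric]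
          by (simp add: algebra_simps sum_subtractf)
        also have "\<dots> = (\<Sum>i=1..r. L t i * (m x s * v x s i))"
          using elim st by (intro sum.cong refl) simp
        finally show ?thesis by (simp add: a_def sum_distrib_left algebra_simps)
      qed
      \<comment> \<open>A relation among the coordinate vectors is the same relation among the
        eigenvectors.\<close>
      show "lin_indep_family r {1..r} (a x)"
        unfolding lin_indep_family_def
      proof (intro allI impI)
        fix c assume c: "\<forall>t\<in>{1..r}. (\<Sum>s=1..r. c s * a x s t) = 0"
        have "(\<Sum>s=1..r. c s * v x s i) = 0" if "i \<in> {1..r}" for i
        proof -
          have "(\<Sum>s=1..r. c s * v x s i) = (\<Sum>s=1..r. \<Sum>t=1..r. u t i * (c s * a x s t))"
            using that by (intro sum.cong refl) (simp add: v sum_distrib_left algebra_simps)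
          also have "\<dots> = (\<Sum>t=1..r. u t i * (\<Sum>s=1..r. c s * a x s t))"
            by (subst sum.swap) (simp add: sum_distrib_left)
          finally show ?thesis using c by simp
        qed
        then show "\<forall>s\<in>{1..r}. c s = 0" using elim unfolding lin_indep_family_def by blast
      qed
    qed
  qed
  then have "eventually (\<lambda>x. P x (SOME \<pi>. P x \<pi>)) \<FF>"
    by (rule eventually_mono) (drule someI_ex, assumption)
  then obtain \<pi> where P: "eventually (\<lambda>x. P x (\<pi> x)) \<FF>" by (rule that)
  \<comment> \<open>\<open>\<pi> x\<close> sends computed eigenvectors to exact ones; its inverse
    lists the computed ones in the order of \<open>u\<close>, and \<open>c x s\<close> is the
    dominant coordinate.\<close>
  define \<sigma> where "\<sigma> x = inv_into UNIV (\<pi> x)" for x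
  define c where "c x s = a x (\<sigma> x s) s" for x s
  have \<sigma>: "\<sigma> x permutes {1..r}" "s \<in> {1..r} \<Longrightarrow> \<sigma> x s \<in> {1..r}" "\<pi> x (\<sigma> x s) = s" if "P x (\<pi> x)" for x s
  proof -
    have p: "\<pi> x permutes {1..r}" using that by (simp add: P_def)
    then show p': "\<sigma> x permutes {1..r}" unfolding \<sigma>_def by (rule permutes_inv)
    show "s \<in> {1..r} \<Longrightarrow> \<sigma> x s \<in> {1..r}" using permutes_in_image[OF p'] by simp
    show "\<pi> x (\<sigma> x s) = s" unfolding \<sigma>_def using p by (rule permutes_inverses)
  qed
  have c0: "eventually (\<lambda>x. \<sigma> x permutes {1..r} \<and> (\<forall>s\<in>{1..r}. c x s \<noteq> 0)) \<FF>"
    using P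
  proof eventually_elim
    case (elim x)
    have "c x s \<noteq> 0" if "s \<in> {1..r}" for s
    proof -
      have "a x (\<sigma> x s) (\<pi> x (\<sigma> x s)) \<noteq> 0"
        using elim \<sigma>(2)[OF elim that] unfolding P_def by blast
      then show ?thesis by (simp add: c_def \<sigma>(3)[OF elim])
    qed
    then show ?case using \<sigma>(1)[OF elim] by blast
  qed
  have ac: "near (\<lambda>x. a x (\<sigma> x s) t / c x s) (if t = s then 1 else 0)" if st: "s \<in> {1..r}" "t \<in> {1..r}" for s t
  proof (cases "t = s")
    case True
    have "eventually (\<lambda>x. 1 = a x (\<sigma> x s) s / c x s) \<FF>"
      using c0 by eventually_elim (use st in \<open>auto simp: c_def\<close>)
    from near_cong[OF this near_const] show ?thesis using True by simp
  next
    case False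
    have "near (\<lambda>x. a x (\<sigma> x s) t / c x s) 0"
      using \<delta>near
    \<comment> \<open>The constant is that of the matching, divided by the gap.\<close>
    proof (rule near_zero_le[where C = "2 * real r / gap"])
      show "eventually (\<lambda>x. cmod (a x (\<sigma> x s) t / c x s - 0) \<le> 2 * real r / gap * cmod (of_real (\<delta> x))) \<FF>"
        using P c0
      proof eventually_elim
        case (elim x)
        have "t \<noteq> \<pi> x (\<sigma> x s)" using False by (simp add: \<sigma>(3)[OF elim(1)])
        then have "gap * cmod (a x (\<sigma> x s) t) \<le> 2 * (real r * \<delta> x) * cmod (a x (\<sigma> x s) (\<pi> x (\<sigma> x s)))"
          using elim(1) \<sigma>(2)[OF elim(1) st(1)] st unfolding P_def by blast
        then have "gap * cmod (a x (\<sigma> x s) t) \<le> 2 * (real r * \<delta> x) * cmod (c x s)"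
          by (simp add: c_def \<sigma>(3)[OF elim(1)])
        moreover have "0 \<le> \<delta> x" unfolding \<delta>_def by (intro sum_nonneg) auto
        ultimately show ?case using elim(2) st gap0 by (simp add: norm_divide field_simps)
      qed
    qed
    then show ?thesis using False by simp
  qed
  have "near (\<lambda>x. v x (\<sigma> x s) i / c x s) (u s i)" if si: "s \<in> {1..r}" "i \<in> {1..r}" for s i
  proof -
    have "near (\<lambda>x. \<Sum>t=1..r. u t i * (a x (\<sigma> x s) t / c x s)) (\<Sum>t=1..r. u t i * (if t = s then 1 else 0))"
      using si by (intro near_sum near_mult near_const ac) auto
    moreover have "(\<Sum>t=1..r. u t i * (if t = s then 1 else 0)) = u s i"
      using si by (simp add: if_distrib[of "\<lambda>c. _ * c"] cong: if_cong)
    ultimately show ?thesis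
      by (simp add: v[OF si(2)] sum_divide_distrib)
  qed
  with c0 show ?thesis by blast
qed

lemma cube_root_of_near:
  assumes "near (\<lambda>x. z x ^ 3) (a ^ 3)" "a \<noteq> 0"
  shows "\<exists>\<tau>. (\<forall>x. \<tau> x ^ 3 = 1) \<and> near (\<lambda>x. \<tau> x * z x) a"
proof -
  have "\<forall>x. \<exists>\<tau>. \<tau> ^ 3 = 1 \<and> cmod (\<tau> * z x - a) \<le> 4 / (3 * (cmod a)\<^sup>2) * cmod (z x ^ 3 - a ^ 3)"
    using cube_root_near[OF assms(2)] by blast
  from choice[OF this] obtain \<tau> where \<tau>: "\<And>x. \<tau> x ^ 3 = 1"
      "\<And>x. cmod (\<tau> x * z x - a) \<le> 4 / (3 * (cmod a)\<^sup>2) * cmod (z x ^ 3 - a ^ 3)"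
    by blast
  have "near (\<lambda>x. z x ^ 3 - a ^ 3) 0" using assms(1) by (simp add: near_def)
  then have "near (\<lambda>x. \<tau> x * z x) a"
    by (rule near_zero_le[OF _ always_eventually[OF allI[OF \<tau>(2)]]])
  then show ?thesis using \<tau>(1) by blast
qed

end

section \<open>Nondegenerate families\<close>

text \<open>Allows two factorizations of a polynomial to be compared through the multiset of
  roots.\<close>

lemma proots_prod_linear: "proots (\<Prod>e\<leftarrow>es. [:- e, 1:]) = mset (es :: 'a::idom list)"
proof (induction es)
  case (Cons e es)
  have "(\<Prod>e\<leftarrow>es. [:- e, 1:]) \<noteq> 0" by (auto simp: prod_list_zero_iff)
  then show ?case using Cons by (simp add: proots_mult del: mult_pCons_left)
qed simp

lemma sum_shift_index: "(\<Sum>k = 0..<r. f (k + 1)) = (\<Sum>k=1..r. f k)" for f :: "nat \<Rightarrow> 'a::comm_monoid_add"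
  by (rule sum.reindex_bij_witness[of _ "\<lambda>k. k - 1" "\<lambda>k. k + 1"]) auto

text \<open>The \<open>r\<close> independent eigenvectors diagonalize \<open>M\<close>, so the
  values \<open>\<mu> s\<close> are its eigenvalues with multiplicity, and the characteristic
  polynomial has no repeated root.\<close>

lemma distinct_eigenvalues_imp_inj_on:
  assumes M: "M \<in> carrier_mat r r"
    and U: "lin_indep_family r {1..r} u"
    and eig: "\<And>s i. s \<in> {1..r} \<Longrightarrow> i \<in> {1..r} \<Longrightarrow>
                (\<Sum>k=1..r. M $$ (i - 1, k - 1) * u s k) = \<mu> s * u s i"
    and dist: "distinct_eigenvalues M"
  shows "inj_on \<mu> {1..r}"
proof -
  obtain L where L: "\<forall>s\<in>{1..r}. \<forall>t\<in>{1..r}. (\<Sum>i=1..r. L s i * u t i) = (if s = t then 1 else 0)"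
      "\<forall>i\<in>{1..r}. \<forall>j\<in>{1..r}. (\<Sum>s=1..r. u s i * L s j) = (if i = j then 1 else 0)"
    using square_dual_family_exists[OF U] by (elim exE conjE)
  \<comment> \<open>The columns of \<open>P\<close> are the eigenvectors and \<open>Q\<close> is its
    inverse; library indices start at 0, hence the shifts by 1.\<close>
  define P where "P = mat r r (\<lambda>(i, s). u (s + 1) (i + 1))"
  define Q where "Q = mat r r (\<lambda>(s, i). L (s + 1) (i + 1))"
  define D where "D = mat r r (\<lambda>(s, t). if s = t then \<mu> (s + 1) else 0)"
  have car: "P \<in> carrier_mat r r" "Q \<in> carrier_mat r r" "D \<in> carrier_mat r r"
    by (auto simp: P_def Q_def D_def)
  have PQ: "P * Q = 1\<^sub>m r"
  proof (rule eq_matI)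
    fix i j assume "i < dim_row (1\<^sub>m r :: complex mat)" "j < dim_col (1\<^sub>m r :: complex mat)"
    then show "(P * Q) $$ (i, j) = 1\<^sub>m r $$ (i, j)"
      using L(2)[THEN bspec, THEN bspec, of "i + 1" "j + 1"] sum_shift_index[of "\<lambda>s. u s (i + 1) * L s (j + 1)" r]
      by (simp add: P_def Q_def scalar_prod_def)
  qed (auto simp: P_def Q_def)
  have QP: "Q * P = 1\<^sub>m r" using mat_mult_left_right_inverse[OF car(1,2) PQ] .
  have MP: "M * P = P * D"
  proof (rule eq_matI)
    fix i s assume "i < dim_row (P * D)" "s < dim_col (P * D)"
    then have bnd: "i < r" "s < r" by (auto simp: P_def D_def)
    have "(M * P) $$ (i, s) = (\<Sum>k=0..<r. M $$ (i, k) * u (s + 1) (k + 1))"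
      using bnd M by (simp add: P_def scalar_prod_def)
    also have "\<dots> = \<mu> (s + 1) * u (s + 1) (i + 1)"
      using eig[of "s + 1" "i + 1"] sum_shift_index[of "\<lambda>k. M $$ (i, k - 1) * u (s + 1) k" r] bnd by simp
    also have "\<dots> = (\<Sum>k=0..<r. u (k + 1) (i + 1) * (if k = s then \<mu> (k + 1) else 0))"
      using bnd by (simp add: if_distrib[of "\<lambda>c. _ * c"] cong: if_cong)
    also have "\<dots> = (P * D) $$ (i, s)"
      using bnd by (simp add: P_def D_def scalar_prod_def)
    finally show "(M * P) $$ (i, s) = (P * D) $$ (i, s)" .
  qed (use M in \<open>auto simp: P_def D_def\<close>)
  have "M = M * (P * Q)" using M by (simp add: PQ)
  also have "\<dots> = P * D * Q" using M car MP by (simp flip: assoc_mult_mat)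
  finally have "similar_mat M D"
    unfolding similar_mat_def similar_mat_wit_def using M car PQ QP
    by (intro exI[of _ P] exI[of _ Q]) (auto simp: Let_def)
  then have "char_poly M = char_poly D" by (rule char_poly_similar)
  also have "\<dots> = (\<Prod>a\<leftarrow>diag_mat D. [:- a, 1:])"
    by (rule char_poly_upper_triangular[OF car(3)]) (auto simp: D_def)
  also have "diag_mat D = map (\<lambda>i. \<mu> (i + 1)) [0..<r]"
    by (auto simp: diag_mat_def D_def)
  finally have cp: "char_poly M = (\<Prod>a\<leftarrow>map (\<lambda>i. \<mu> (i + 1)) [0..<r]. [:- a, 1:])" .
  obtain es where es: "char_poly M = (\<Prod>e\<leftarrow>es. [:- e, 1:])" "distinct es"
    using dist unfolding distinct_eigenvalues_def by (elim exE conjE)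
  have "mset es = mset (map (\<lambda>i. \<mu> (i + 1)) [0..<r])"
    using arg_cong[OF cp, of proots] unfolding es(1) proots_prod_linear .
  then have "distinct (map (\<lambda>i. \<mu> (i + 1)) [0..<r])"
    using es(2) mset_eq_imp_distinct_iff by blast
  then have inj: "inj_on (\<lambda>i. \<mu> (i + 1)) {0..<r}" by (simp add: distinct_map)
  show ?thesis
  proof (rule inj_onI)
    fix s t assume "s \<in> {1..r}" "t \<in> {1..r}" "\<mu> s = \<mu> t"
    moreover from this have "s - 1 = t - 1" by (intro inj_onD[OF inj]) auto
    ultimately show "s = t" by auto
  qed
qed

text \<open>A square matrix with independent columns has a two-sided inverse, so its rows are
  independent too.\<close>

lemma lin_indep_family_transpose:
  assumes "lin_indep_family r {1..r} x"
  shows "lin_indep_family r {1..r} (\<lambda>k s. x s k)"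
  unfolding lin_indep_family_def
proof (intro allI impI ballI)
  obtain L where L: "\<forall>i\<in>{1..r}. \<forall>j\<in>{1..r}. (\<Sum>s=1..r. x s i * L s j) = (if i = j then 1 else 0)"
    using square_dual_family_exists[OF assms] by (elim exE conjE)
  fix c j assume c: "\<forall>s\<in>{1..r}. (\<Sum>k=1..r. c k * x s k) = 0" and j: "j \<in> {1..r}"
  have "c j = (\<Sum>k=1..r. if k = j then c k else 0)" using j by simp
  also have "\<dots> = (\<Sum>k=1..r. c k * (\<Sum>s=1..r. x s k * L s j))"
    using L j by (intro sum.cong refl) simp
  also have "\<dots> = (\<Sum>s=1..r. (\<Sum>k=1..r. c k * x s k) * L s j)"
    unfolding sum_distrib_left sum_distrib_right by (subst sum.swap) (simp add: mult.assoc)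
  also have "\<dots> = 0" using c by simp
  finally show "c j = 0" .
qed

lemma lin_indep_family_mono:
  assumes "lin_indep_family r I x" "I \<subseteq> J"
  shows "lin_indep_family r J x"
  unfolding lin_indep_family_def
proof (intro allI impI)
  fix c assume "\<forall>i\<in>J. (\<Sum>s=1..r. c s * x s i) = 0"
  then have "\<forall>i\<in>I. (\<Sum>s=1..r. c s * x s i) = 0" using assms(2) by blast
  then show "\<forall>s\<in>{1..r}. c s = 0" using assms(1) unfolding lin_indep_family_def by blast
qed

lemma lin_indep_family_nonzero:
  assumes "lin_indep_family r I x" "s \<in> {1..r}"
  obtains i where "i \<in> I" "x s i \<noteq> 0"
proof (rule ccontr)
  assume "\<not> thesis"
  then have "x s i = 0" if "i \<in> I" for i using that \<open>\<And>i. i \<in> I \<Longrightarrow> x s i \<noteq> 0 \<Longrightarrow> thesis\<close> by blast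
  moreover define c where "c t = (if t = s then 1 else 0 :: complex)" for t
  ultimately have "\<forall>i\<in>I. (\<Sum>t=1..r. c t * x t i) = 0"
    using assms(2) by (simp add: c_def if_distrib[of "\<lambda>c. c * _"] cong: if_cong)
  then have "c s = 0" using assms unfolding lin_indep_family_def by blast
  then show False by (simp add: c_def)
qed

lemma lin_indep_familyD:
  assumes "lin_indep_family r I x" "\<And>i. i \<in> I \<Longrightarrow> (\<Sum>s=1..r. c s * x s i) = 0" "s \<in> {1..r}"
  shows "c s = 0"
  using assms unfolding lin_indep_family_def by blast

section \<open>Slices of a cube sum and the generating matrix of a family\<close>

text \<open>The block of entries \<open>(0, k, l)\<close> factors through the heads:
  \<open>h\<close> acts only by its pairings with them. This yields the injectivity of the block as
  well as the equations of generating matrices.\<close>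

lemma cube_sum_contract:
  "(\<Sum>k=1..r. cube_sum r q 0 k l * h k) = (\<Sum>s=1..r. (q s 0 * (\<Sum>k=1..r. h k * q s k)) * q s l)"
proof -
  have "(\<Sum>k=1..r. cube_sum r q 0 k l * h k) = (\<Sum>k=1..r. \<Sum>s=1..r. q s 0 * q s k * q s l * h k)"
    by (simp add: cube_sum_def sum_distrib_right)
  also have "\<dots> = (\<Sum>s=1..r. \<Sum>k=1..r. q s 0 * q s k * q s l * h k)" by (rule sum.swap)
  also have "\<dots> = (\<Sum>s=1..r. (q s 0 * (\<Sum>k=1..r. h k * q s k)) * q s l)"
    by (simp add: sum_distrib_left sum_distrib_right algebra_simps)
  finally show ?thesis .
qed

text \<open>Recovers nondegeneracy of an unknown family from its tensor alone. A vector whose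
  pairings with all heads vanish lies in the kernel of the block, and if some leading entry were 0,
  so would the dual vector of that head.\<close>

lemma nondegenerate_of_injective:
  assumes inj: "\<And>h. (\<forall>l\<in>I. (\<Sum>k=1..r. cube_sum r q 0 k l * h k) = 0) \<Longrightarrow> \<forall>k\<in>{1..r}. h k = 0"
  shows "lin_indep_family r {1..r} q" "\<And>s. s \<in> {1..r} \<Longrightarrow> q s 0 \<noteq> 0"
proof -
  have "lin_indep_family r {1..r} (\<lambda>k s. q s k)"
    unfolding lin_indep_family_def by (intro allI impI inj) (simp add: cube_sum_contract)
  from lin_indep_family_transpose[OF this] show ind: "lin_indep_family r {1..r} q" by simp
  fix s assume s: "s \<in> {1..r}"
  obtain L where L: "\<forall>s\<in>{1..r}. \<forall>t\<in>{1..r}. (\<Sum>i=1..r. L s i * q t i) = (if s = t then 1 else 0)"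
    using square_dual_family_exists[OF ind] by (elim exE conjE)
  show "q s 0 \<noteq> 0"
  proof
    assume "q s 0 = 0"
    then have "(\<Sum>t=1..r. (q t 0 * (\<Sum>k=1..r. L s k * q t k)) * q t l) = 0" for l
      using L s by (intro sum.neutral) auto
    then have "\<forall>k\<in>{1..r}. L s k = 0" by (intro inj) (simp add: cube_sum_contract)
    then have "(\<Sum>i=1..r. L s i * q s i) = 0" by simp
    then show False using L s by simp
  qed
qed

text \<open>The equations say that the head of \<open>q s\<close> is an eigenvector of
  \<open>N_mat r G j\<close> with eigenvalue \<open>q s j / q s 0\<close>. They prescribe pairings
  with independent heads, and the dual family solves this interpolation problem.\<close>

lemma generating_matrix_of_family_exists:
  assumes "lin_indep_family r {1..r} q"
  shows "\<exists>G. \<forall>s\<in>{1..r}. \<forall>i j. (\<Sum>k=1..r. G k i j * q s k) = q s i * q s j / q s 0"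
proof -
  obtain L where L: "\<forall>s\<in>{1..r}. \<forall>t\<in>{1..r}. (\<Sum>i=1..r. L s i * q t i) = (if s = t then 1 else 0)"
    using square_dual_family_exists[OF assms] by (elim exE conjE)
  define G where "G k i j = (\<Sum>s=1..r. L s k * (q s i * q s j / q s 0))" for k i j :: nat
  have "(\<Sum>k=1..r. G k i j * q t k) = q t i * q t j / q t 0" if "t \<in> {1..r}" for t i j
  proof -
    have "(\<Sum>k=1..r. G k i j * q t k) = (\<Sum>k=1..r. \<Sum>s=1..r. L s k * q t k * (q s i * q s j / q s 0))"
      unfolding G_def sum_distrib_right by (intro sum.cong refl) (simp add: algebra_simps)
    also have "\<dots> = (\<Sum>s=1..r. (\<Sum>k=1..r. L s k * q t k) * (q s i * q s j / q s 0))"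
      unfolding sum_distrib_right by (rule sum.swap)
    also have "\<dots> = (\<Sum>s=1..r. if s = t then q s i * q s j / q s 0 else 0)"
      using L that by (intro sum.cong refl) simp
    finally show ?thesis using that by simp
  qed
  then show ?thesis by blast
qed

lemma family_generating_equation:
  assumes G: "\<And>s. s \<in> {1..r} \<Longrightarrow> (\<Sum>k=1..r. G k i j * q s k) = q s i * q s j / q s 0"
    and q0: "\<And>s. s \<in> {1..r} \<Longrightarrow> q s 0 \<noteq> 0"
  shows "(\<Sum>k=1..r. cube_sum r q 0 k t * G k i j) = cube_sum r q i j t"
  unfolding cube_sum_contract using assms by (simp add: cube_sum_def)

lemma family_N_comb_eigenvector:
  fixes q :: "nat \<Rightarrow> nat \<Rightarrow> complex"
  assumes G: "\<And>l. l \<in> {r+1..n} \<Longrightarrow> (\<Sum>k=1..r. G k i l * q s k) = q s i * q s l / q s 0"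
  shows "(\<Sum>k=1..r. (\<Sum>l=r+1..n. \<xi> l * G k i l) * q s k) = (\<Sum>l=r+1..n. \<xi> l * (q s l / q s 0)) * q s i"
proof -
  have "(\<Sum>k=1..r. (\<Sum>l=r+1..n. \<xi> l * G k i l) * q s k) = (\<Sum>k=1..r. \<Sum>l=r+1..n. \<xi> l * (G k i l * q s k))"
    by (simp add: sum_distrib_right mult.assoc)
  also have "\<dots> = (\<Sum>l=r+1..n. \<xi> l * (\<Sum>k=1..r. G k i l * q s k))"
    by (subst sum.swap) (simp add: sum_distrib_left)
  also have "\<dots> = (\<Sum>l=r+1..n. \<xi> l * (q s i * q s l / q s 0))"
    using G by (intro sum.cong refl) simp
  also have "\<dots> = (\<Sum>l=r+1..n. \<xi> l * (q s l / q s 0)) * q s i"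
    unfolding sum_distrib_right by (intro sum.cong refl) (simp add: algebra_simps)
  finally show ?thesis .
qed

text \<open>Injectivity is an open condition. A nonzero kernel vector is chosen wherever one exists,
  and 0 elsewhere; stability with gauge 0 makes this choice vanish eventually.\<close>

lemma eventually_injective:
  fixes A :: "'x \<Rightarrow> 'i \<Rightarrow> 's \<Rightarrow> complex"
  assumes fin: "finite I" "finite S"
    and inj: "\<And>c. (\<forall>i\<in>I. (\<Sum>s\<in>S. A0 i s * c s) = 0) \<Longrightarrow> \<forall>s\<in>S. c s = 0"
    and lim: "\<And>i s. i \<in> I \<Longrightarrow> s \<in> S \<Longrightarrow> ((\<lambda>x. A x i s) \<longlongrightarrow> A0 i s) \<FF>"
  shows "eventually (\<lambda>x. \<forall>h. (\<forall>i\<in>I. (\<Sum>s\<in>S. A x i s * h s) = 0) \<longrightarrow> (\<forall>s\<in>S. h s = 0)) \<FF>"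
proof -
  define bad where "bad x h \<longleftrightarrow> (\<forall>i\<in>I. (\<Sum>s\<in>S. A x i s * h s) = 0) \<and> \<not> (\<forall>s\<in>S. h s = 0)" for x h
  define h where "h x = (if Ex (bad x) then Eps (bad x) else (\<lambda>_. 0))" for x
  have badh: "bad x (h x)" if "bad x h'" for x h'
  proof -
    have ex: "Ex (bad x)" using that by blast
    then show ?thesis unfolding h_def using someI_ex[OF ex] by simp
  qed
  have "(\<Sum>s\<in>S. A x i s * h x s) = 0" if "i \<in> I" for x i
  proof (cases "Ex (bad x)")
    case True
    then obtain h' where "bad x h'" ..
    from badh[OF this] that show ?thesis unfolding bad_def by blast
  next
    case False
    then have "h x = (\<lambda>_. 0)" unfolding h_def by (rule if_not_P)
    then show ?thesis by simp
  qed
  \<comment> \<open>Being of order 0 means being eventually equal to 0.\<close>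
  then have "(\<lambda>x. \<Sum>s\<in>S. A x i s * h x s) \<in> O[\<FF>](\<lambda>_. 0)" if "i \<in> I" for i
    using that by simp
  from stable_injective[OF fin inj lim this]
  have "eventually (\<lambda>x. h x s = 0) \<FF>" if "s \<in> S" for s using that by simp
  then have "eventually (\<lambda>x. \<forall>s\<in>S. h x s = 0) \<FF>"
    using fin by (intro eventually_ball_finite) auto
  then show ?thesis
  proof eventually_elim
    case (elim x)
    then have "\<not> bad x h'" for h' using badh[of x h'] by (auto simp: bad_def)
    then show ?case by (auto simp: bad_def)
  qed
qed

section \<open>Uniform thresholds and change of the reference decomposition\<close>

text \<open>This is the filter behind all uniform bounds: it is restricted to \<open>V\<close> and
  sees only the size of \<open>err\<close>. What holds eventually therefore holds with one threshold
  for all admissible data and all choices of the algorithm.\<close>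

lemma eventually_inf_principal_filtercomapD:
  fixes err :: "'x \<Rightarrow> real"
  assumes "eventually P (inf (principal V) (filtercomap err (nhds 0)))" "\<And>x. 0 \<le> err x"
  shows "\<exists>d>0. \<forall>x\<in>V. err x \<le> d \<longrightarrow> P x"
proof -
  have "eventually (\<lambda>x. x \<in> V \<longrightarrow> P x) (filtercomap err (nhds 0))"
    using assms(1) by (simp add: inf.commute[of "principal V"] eventually_inf_principal)
  then obtain Q where Q: "eventually Q (nhds 0)" "\<And>x. Q (err x) \<Longrightarrow> x \<in> V \<Longrightarrow> P x"
    by (auto simp: eventually_filtercomap)
  then obtain d where d: "d > 0" "\<And>y. dist y 0 < d \<Longrightarrow> Q y"
    by (auto simp: eventually_nhds_metric)
  show ?thesis
  \<comment> \<open>Halving passes from a strict bound to a non-strict threshold.\<close>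
  proof (intro exI[of _ "d / 2"] conjI ballI impI)
    fix x assume "x \<in> V" "err x \<le> d / 2"
    then show "P x" using d assms(2)[of x] by (intro Q(2) d(2)) (auto simp: dist_real_def)
  qed (use d in simp)
qed

text \<open>Changes the reference decomposition: exact recovery makes the members of
  \<open>p\<close> relabelled multiples of those of \<open>p'\<close> by cube roots of unity, and
  factors of modulus 1 do not alter the error.\<close>

lemma recovers_within_trans:
  assumes exact: "recovers_within n r p p' 0" and q: "recovers_within n r p q e"
  shows "recovers_within n r p' q e"
proof -
  obtain \<pi> \<tau> where \<pi>: "\<pi> permutes {1..r}" and \<tau>: "\<And>s. s \<in> {1..r} \<Longrightarrow> \<tau> s ^ 3 = 1"
    and vn: "\<And>s. s \<in> {1..r} \<Longrightarrow> vector_norm {0..n} (\<lambda>i. \<tau> s * p' s i - p (\<pi> s) i) \<le> 0"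
    using exact unfolding recovers_within_def by blast
  obtain \<rho> \<tau>' where \<rho>: "\<rho> permutes {1..r}" and \<tau>': "\<And>s. s \<in> {1..r} \<Longrightarrow> \<tau>' s ^ 3 = 1"
    and vn': "\<And>s. s \<in> {1..r} \<Longrightarrow> vector_norm {0..n} (\<lambda>i. \<tau>' s * q s i - p (\<rho> s) i) \<le> e"
    using q unfolding recovers_within_def by blast
  have eq: "p (\<pi> s) i = \<tau> s * p' s i" if "s \<in> {1..r}" "i \<in> {0..n}" for s i
  proof -
    have "vector_norm {0..n} (\<lambda>i. \<tau> s * p' s i - p (\<pi> s) i) = 0"
      using vn[OF that(1)] unfolding vector_norm_def by (intro antisym) auto
    then show ?thesis using that(2) unfolding vector_norm_def by (simp add: L2_set_eq_0_iff)
  qed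
  \<comment> \<open>Label \<open>s\<close> of \<open>q\<close> goes to \<open>\<rho> s\<close> in
    \<open>p\<close>, which is the image under \<open>\<pi>\<close> of the label sought in
    \<open>p'\<close>.\<close>
  define \<kappa> where "\<kappa> = inv_into UNIV \<pi> \<circ> \<rho>"
  have \<kappa>: "\<kappa> permutes {1..r}"
    unfolding \<kappa>_def using permutes_compose[OF \<rho> permutes_inv[OF \<pi>]] by simp
  show ?thesis
    unfolding recovers_within_def
  proof (intro exI[of _ \<kappa>] exI[of _ "\<lambda>s. \<tau>' s / \<tau> (\<kappa> s)"] conjI ballI \<kappa>)
    fix s assume s: "s \<in> {1..r}"
    have \<kappa>s: "\<kappa> s \<in> {1..r}" using \<kappa> s permutes_in_image by metis
    show "(\<tau>' s / \<tau> (\<kappa> s)) ^ 3 = 1" using \<tau>'[OF s] \<tau>[OF \<kappa>s] by (simp add: power_divide)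
    have "cmod (\<tau> (\<kappa> s)) ^ 3 = 1 ^ 3" using \<tau>[OF \<kappa>s] by (simp flip: norm_power)
    then have n1: "cmod (\<tau> (\<kappa> s)) = 1" by (rule power_eq_imp_eq_base) auto
    then have nz: "\<tau> (\<kappa> s) \<noteq> 0" by auto
    have "\<pi> (\<kappa> s) = \<rho> s" using permutes_inverses(1)[OF \<pi>] by (simp add: \<kappa>_def)
    then have "p (\<rho> s) i = \<tau> (\<kappa> s) * p' (\<kappa> s) i" if "i \<in> {0..n}" for i
      using eq[OF \<kappa>s that] by simp
    then have "cmod (\<tau>' s / \<tau> (\<kappa> s) * q s i - p' (\<kappa> s) i) = cmod (\<tau>' s * q s i - p (\<rho> s) i)"
      if "i \<in> {0..n}" for i
    proof -
      have "\<tau>' s * q s i - p (\<rho> s) i = \<tau> (\<kappa> s) * (\<tau>' s / \<tau> (\<kappa> s) * q s i - p' (\<kappa> s) i)"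
        using nz \<open>\<And>i. i \<in> {0..n} \<Longrightarrow> p (\<rho> s) i = \<tau> (\<kappa> s) * p' (\<kappa> s) i\<close>[OF that] by (simp add: field_simps)
      then show ?thesis using n1 by (simp add: norm_mult)
    qed
    then have "L2_set (\<lambda>i. cmod (\<tau>' s / \<tau> (\<kappa> s) * q s i - p' (\<kappa> s) i)) {0..n} =
        L2_set (\<lambda>i. cmod (\<tau>' s * q s i - p (\<rho> s) i)) {0..n}"
      by (intro L2_set_cong refl)
    then show "vector_norm {0..n} (\<lambda>i. \<tau>' s / \<tau> (\<kappa> s) * q s i - p' (\<kappa> s) i) \<le> e"
      using vn'[OF s] unfolding vector_norm_def by simp
  qed
qed

text \<open>Relabelling and multiplication by roots of unity preserve which entries are
  nonzero.\<close>

lemma theta_determined_of_recovers: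
  assumes exact: "recovers_within n r p p' 0" and det: "theta_determined r p'" and rn: "r \<le> n"
  shows "theta_determined r p"
  unfolding theta_determined_def
proof
  obtain \<pi> \<tau> where \<pi>: "\<pi> permutes {1..r}" and \<tau>: "\<And>s. s \<in> {1..r} \<Longrightarrow> \<tau> s ^ 3 = 1"
    and vn: "\<And>s. s \<in> {1..r} \<Longrightarrow> vector_norm {0..n} (\<lambda>i. \<tau> s * p' s i - p (\<pi> s) i) \<le> 0"
    using exact unfolding recovers_within_def by blast
  fix t assume t: "t \<in> {1..r}"
  obtain s where s: "s \<in> {1..r}" "\<pi> s = t"
    using permutes_image[OF \<pi>] t by (metis imageE)
  have "vector_norm {0..n} (\<lambda>i. \<tau> s * p' s i - p t i) = 0"
    using vn[OF s(1)] s(2) unfolding vector_norm_def by (intro antisym) auto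
  then have eq: "p t i = \<tau> s * p' s i" if "i \<in> {1..r}" for i
    using that rn unfolding vector_norm_def by (simp add: L2_set_eq_0_iff)
  obtain i j where ij: "i \<in> {1..r}" "j \<in> {1..r}" "i \<noteq> j" "p' s i \<noteq> 0" "p' s j \<noteq> 0"
    using det s(1) unfolding theta_determined_def by blast
  have "\<tau> s \<noteq> 0" using \<tau>[OF s(1)] by (auto simp: power_0_left)
  then show "\<exists>i\<in>{1..r}. \<exists>j\<in>{1..r}. i \<noteq> j \<and> p t i \<noteq> 0 \<and> p t j \<noteq> 0"
    using ij eq by (intro bexI[of _ i] bexI[of _ j]) auto
qed

section \<open>Injectivity of the limiting least squares problems\<close>

text \<open>The filter remains arbitrary, so that starting points and refined points are treated by
  the same estimates.\<close>

locale cubic_decomposition = approximation \<FF> e for \<FF> :: "'x filter" and e +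
  fixes n r :: nat and p :: "nat \<Rightarrow> nat \<Rightarrow> complex"
  assumes r_less: "r < n"
    and leading: "\<And>s. s \<in> {1..r} \<Longrightarrow> p s 0 \<noteq> 0"
    and indep_head: "lin_indep_family r {1..r} p"
    and indep_tail: "\<And>j. j \<in> {r+1..n} \<Longrightarrow> lin_indep_family r ({r+1..n} - {j}) p"
begin

lemma indep_whole_tail: "lin_indep_family r {r+1..n} p"
  using r_less by (intro lin_indep_family_mono[OF indep_tail[of n]]) auto

text \<open>Independent tails force each pairing of \<open>c\<close> with a head to vanish, and
  independent heads then force \<open>c\<close> to be 0. Row \<open>j\<close> is left out because
  its right hand side in the least squares problem has a repeated label.\<close>

lemma slice_injective:
  assumes j: "j \<in> {r+1..n}"
    and c: "\<forall>l\<in>{r+1..n} - {j}. (\<Sum>k=1..r. cube_sum r p 0 k l * c k) = 0"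
  shows "\<forall>k\<in>{1..r}. c k = 0"
proof
  have "p s 0 * (\<Sum>k=1..r. c k * p s k) = 0" if "s \<in> {1..r}" for s
    by (rule lin_indep_familyD[OF indep_tail[OF j] _ that]) (use c in \<open>simp add: cube_sum_contract\<close>)
  then have "(\<Sum>k=1..r. c k * p s k) = 0" if "s \<in> {1..r}" for s
    using that leading by auto
  then show "c k = 0" if "k \<in> {1..r}" for k
    using lin_indep_familyD[OF lin_indep_family_transpose[OF indep_head], of c k] that by blast
qed

text \<open>Fixing a head label where \<open>p s\<close> does not vanish leaves a relation among the
  tails.\<close>

lemma slice_family_injective:
  assumes "\<forall>i\<in>J1 n r. (\<Sum>s=1..r. (case i of (i0, i1, i2) \<Rightarrow> p s i1 * (p s i2 / p s 0)) * c s) = 0"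
  shows "\<forall>s\<in>{1..r}. c s = 0"
proof
  fix s assume s: "s \<in> {1..r}"
  obtain i where i: "i \<in> {1..r}" "p s i \<noteq> 0" using lin_indep_family_nonzero[OF indep_head s] .
  have "c s * p s i / p s 0 = 0"
  proof (rule lin_indep_familyD[OF indep_whole_tail _ s])
    fix l assume "l \<in> {r+1..n}"
    then have "(0, i, l) \<in> J1 n r" using i by (auto simp: J1_def)
    with assms have "(\<Sum>s=1..r. p s i * (p s l / p s 0) * c s) = 0" by fastforce
    then show "(\<Sum>s=1..r. c s * p s i / p s 0 * p s l) = 0" by (simp add: algebra_simps)
  qed
  then show "c s = 0" using i leading[OF s] by simp
qed

text \<open>Labels in \<open>J2\<close> start with two different head labels, and
  \<open>theta_determined\<close> provides such a pair on which \<open>p s\<close> does not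
  vanish.\<close>

lemma theta_family_injective:
  assumes det: "theta_determined r p"
    and "\<forall>i\<in>J2 n r. (\<Sum>s=1..r. (case i of (i1, i2, i3) \<Rightarrow> p s i1 * p s i2 * (p s i3 / p s 0)) * c s) = 0"
  shows "\<forall>s\<in>{1..r}. c s = 0"
proof
  fix s assume s: "s \<in> {1..r}"
  obtain i j where i: "i \<in> {1..r}" "j \<in> {1..r}" "i \<noteq> j" "p s i \<noteq> 0" "p s j \<noteq> 0"
    using det s unfolding theta_determined_def by blast
  have "c s * p s i * p s j / p s 0 = 0"
  proof (rule lin_indep_familyD[OF indep_whole_tail _ s])
    fix l assume "l \<in> {r+1..n}"
    then have "(i, j, l) \<in> J2 n r" using i by (auto simp: J2_def)
    with assms(2) have "(\<Sum>s=1..r. p s i * p s j * (p s l / p s 0) * c s) = 0" by fastforce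
    then show "(\<Sum>s=1..r. c s * p s i * p s j / p s 0 * p s l) = 0" by (simp add: algebra_simps)
  qed
  then show "c s = 0" using i leading[OF s] by simp
qed

text \<open>Fixing a tail label \<open>j\<close> where \<open>p s\<close> does not vanish leaves a
  relation among the tails without \<open>j\<close>, which are still independent.\<close>

lemma tail_pair_injective:
  assumes "\<forall>i\<in>{(j, l). j \<in> {r+1..n} \<and> l \<in> {r+1..n} \<and> j \<noteq> l}.
      (\<Sum>s=1..r. (case i of (j, l) \<Rightarrow> (p s j / p s 0) * (p s l / p s 0)) * c s) = 0"
  shows "\<forall>s\<in>{1..r}. c s = 0"
proof
  fix s assume s: "s \<in> {1..r}"
  obtain j where j: "j \<in> {r+1..n}" "p s j \<noteq> 0" using lin_indep_family_nonzero[OF indep_whole_tail s] .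
  have "c s * (p s j / p s 0) / p s 0 = 0"
  proof (rule lin_indep_familyD[OF indep_tail[OF j(1)] _ s])
    fix l assume "l \<in> {r+1..n} - {j}"
    then have "(j, l) \<in> {(j, l). j \<in> {r+1..n} \<and> l \<in> {r+1..n} \<and> j \<noteq> l}" using j by auto
    with assms have "(\<Sum>s=1..r. (p s j / p s 0) * (p s l / p s 0) * c s) = 0" by fastforce
    then show "(\<Sum>s=1..r. c s * (p s j / p s 0) / p s 0 * p s l) = 0" by (simp add: algebra_simps)
  qed
  then show "c s = 0" using j leading[OF s] by simp
qed

text \<open>Comparing the coefficients of the independent tails in the defining equations determines
  how a generating matrix acts on the heads: they are common eigenvectors.\<close>

lemma generating_matrix_contract:
  assumes G: "generating_matrix n r (cube_sum r p) G"
    and ij: "i \<in> {1..r}" "j \<in> {r+1..n}" and s: "s \<in> {1..r}"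
  shows "(\<Sum>k=1..r. G k i j * p s k) = p s i * p s j / p s 0"
proof -
  have "p s 0 * (\<Sum>k=1..r. G k i j * p s k) - p s i * p s j = 0"
  proof (rule lin_indep_familyD[OF indep_whole_tail _ s])
    fix t assume "t \<in> {r+1..n}"
    then have "(\<Sum>k=1..r. cube_sum r p 0 k t * G k i j) = cube_sum r p i j t"
      using G ij unfolding generating_matrix_def by (simp add: mult.commute)
    then show "(\<Sum>s=1..r. (p s 0 * (\<Sum>k=1..r. G k i j * p s k) - p s i * p s j) * p s t) = 0"
      unfolding cube_sum_contract by (simp add: cube_sum_def left_diff_distrib sum_subtractf)
  qed
  then show ?thesis using leading[OF s] by (simp add: field_simps)
qed

section \<open>Accuracy of the quantities computed from approximate data\<close>

text \<open>The exact generating matrix solves the limit problem without residual. The row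
  \<open>l = j\<close> is absent, so all data that enter have pairwise distinct labels and are
  controlled.\<close>

lemma estimated_generating_matrix_near:
  assumes T: "\<And>i j k. (i, j, k) \<in> \<Omega> n \<Longrightarrow> near (\<lambda>x. T x i j k) (cube_sum r p i j k)"
    and G: "generating_matrix n r (cube_sum r p) G"
    and est: "eventually (\<lambda>x. estimated_generating_matrix n r (T x) (Gh x)) \<FF>"
    and ij: "i \<in> {1..r}" "j \<in> {r+1..n}" and k: "k \<in> {1..r}"
  shows "near (\<lambda>x. Gh x k i j) (G k i j)"
proof (rule least_squares_near[where I = "{r+1..n} - {j}" and S = "{1..r}"
      and A = "\<lambda>x l k. T x 0 k l" and b = "\<lambda>x l. T x i j l" and ?A0.0 = "\<lambda>l k. cube_sum r p 0 k l"
      and g = "\<lambda>x k. Gh x k i j" and ?g0.0 = "\<lambda>k. G k i j"])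
  show "\<forall>k\<in>{1..r}. c k = 0" if "\<forall>l\<in>{r+1..n} - {j}. (\<Sum>k=1..r. cube_sum r p 0 k l * c k) = 0" for c
    using slice_injective[OF ij(2) that] .
  show "near (\<lambda>x. T x 0 k l) (cube_sum r p 0 k l)" if "l \<in> {r+1..n} - {j}" "k \<in> {1..r}" for l k
    using that by (intro T) (auto simp: \<Omega>_def)
  show "near (\<lambda>x. T x i j l) (\<Sum>k=1..r. cube_sum r p 0 k l * G k i j)" if l: "l \<in> {r+1..n} - {j}" for l
  proof -
    have "(\<Sum>k=1..r. cube_sum r p 0 k l * G k i j) = cube_sum r p i j l"
      using G ij l unfolding generating_matrix_def by (simp add: mult.commute)
    moreover have "(i, j, l) \<in> \<Omega> n" using ij l by (auto simp: \<Omega>_def)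
    ultimately show ?thesis using T by simp
  qed
  show "eventually (\<lambda>x. L2_set (\<lambda>l. cmod (T x i j l - (\<Sum>k=1..r. T x 0 k l * Gh x k i j))) ({r+1..n} - {j})
      \<le> L2_set (\<lambda>l. cmod (T x i j l - (\<Sum>k=1..r. T x 0 k l * G k i j))) ({r+1..n} - {j})) \<FF>"
    using est
  proof eventually_elim
    case (elim x)
    have "(vector_norm ({r+1..n} - {j}) (\<lambda>l. (\<Sum>k=1..r. T x 0 k l * Gh x k i j) - T x i j l))\<^sup>2
        \<le> (vector_norm ({r+1..n} - {j}) (\<lambda>l. (\<Sum>k=1..r. T x 0 k l * G k i j) - T x i j l))\<^sup>2"
      using elim ij unfolding estimated_generating_matrix_def is_arg_min_def A_mat_def b_vec_def
      by (meson not_less)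
    then show ?case
      by (simp add: vector_norm_def norm_minus_commute power2_le_iff_abs_le)
  qed
qed (use k in auto)

text \<open>The family \<open>v\<close> is left open: it stands for the unit eigenvectors of the
  algorithm and also for the heads of an approximate decomposition.\<close>

lemma N_comb_eigenvectors_near:
  assumes G: "generating_matrix n r (cube_sum r p) G"
    and dist: "distinct_eigenvalues (N_comb n r \<xi> G)"
    and Gh: "\<And>i j k. i \<in> {1..r} \<Longrightarrow> j \<in> {r+1..n} \<Longrightarrow> k \<in> {1..r} \<Longrightarrow> near (\<lambda>x. Gh x k i j) (G k i j)"
    and eig: "eventually (\<lambda>x. \<forall>s\<in>{1..r}. \<forall>i\<in>{1..r}.
        (\<Sum>k=1..r. (\<Sum>l=r+1..n. \<xi> l * Gh x k i l) * v x s k) = m x s * v x s i) \<FF>"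
    and indep: "eventually (\<lambda>x. lin_indep_family r {1..r} (v x)) \<FF>"
  shows "\<exists>\<sigma> c. eventually (\<lambda>x. \<sigma> x permutes {1..r} \<and> (\<forall>s\<in>{1..r}. c x s \<noteq> 0)) \<FF> \<and>
           (\<forall>s\<in>{1..r}. \<forall>i\<in>{1..r}. near (\<lambda>x. v x (\<sigma> x s) i / c x s) (p s i))"
proof (rule eigenvectors_near[OF indep_head, where ?M0.0 = "\<lambda>i k. \<Sum>l=r+1..n. \<xi> l * G k i l"])
  define \<mu> where "\<mu> s = (\<Sum>l=r+1..n. \<xi> l * (p s l / p s 0))" for s
  show eig0: "(\<Sum>k=1..r. (\<Sum>l=r+1..n. \<xi> l * G k i l) * p s k) = \<mu> s * p s i"
    if "s \<in> {1..r}" "i \<in> {1..r}" for s i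
    unfolding \<mu>_def using generating_matrix_contract[OF G] that by (intro family_N_comb_eigenvector) auto
  show "inj_on \<mu> {1..r}"
  proof (rule distinct_eigenvalues_imp_inj_on[OF _ indep_head _ dist])
    show "N_comb n r \<xi> G \<in> carrier_mat r r" by (simp add: N_comb_def)
    fix s i assume si: "s \<in> {1..r}" "i \<in> {1..r}"
    have "(\<Sum>k=1..r. N_comb n r \<xi> G $$ (i - 1, k - 1) * p s k) =
        (\<Sum>k=1..r. (\<Sum>l=r+1..n. \<xi> l * G k i l) * p s k)"
      using si by (intro sum.cong refl) (auto simp: N_comb_def N_mat_def)
    then show "(\<Sum>k=1..r. N_comb n r \<xi> G $$ (i - 1, k - 1) * p s k) = \<mu> s * p s i"
      using eig0[OF si] by simp
  qed
  show "near (\<lambda>x. \<Sum>l=r+1..n. \<xi> l * Gh x k i l) (\<Sum>l=r+1..n. \<xi> l * G k i l)"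
    if "i \<in> {1..r}" "k \<in> {1..r}" for i k
    using that by (intro near_intros Gh)
qed (use eig indep in auto)

lemma head_norm_nonzero:
  assumes "s \<in> {1..r}"
  shows "(\<Sum>i=1..r. p s i * cnj (p s i)) \<noteq> 0"
proof -
  obtain i where "i \<in> {1..r}" "p s i \<noteq> 0" using lin_indep_family_nonzero[OF indep_head assms] .
  then have "0 < (\<Sum>i=1..r. (cmod (p s i))\<^sup>2)"
    by (intro sum_pos2[of _ i]) auto
  moreover have "(\<Sum>i=1..r. p s i * cnj (p s i)) = of_real (\<Sum>i=1..r. (cmod (p s i))\<^sup>2)"
    unfolding of_real_sum by (intro sum.cong refl complex_norm_square[symmetric])
  ultimately show ?thesis by (simp only: of_real_eq_0_iff)
qed

text \<open>The quotient does not change when its vector is rescaled, so it may be evaluated at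
  approximations of the exact heads, where its limit is the exact eigenvalue.\<close>

lemma Rayleigh_quotient_near:
  assumes G: "generating_matrix n r (cube_sum r p) G"
    and Gh: "\<And>i j k. i \<in> {1..r} \<Longrightarrow> j \<in> {r+1..n} \<Longrightarrow> k \<in> {1..r} \<Longrightarrow> near (\<lambda>x. Gh x k i j) (G k i j)"
    and Y: "\<And>i. i \<in> {1..r} \<Longrightarrow> near (\<lambda>x. Y x i) (p s i)"
    and s: "s \<in> {1..r}" and l: "l \<in> {r+1..n}"
  shows "near (\<lambda>x. (\<Sum>i=1..r. (\<Sum>k=1..r. Gh x k i l * Y x k) * cnj (Y x i)) / (\<Sum>i=1..r. Y x i * cnj (Y x i)))
    (p s l / p s 0)"
proof -
  define N where "N = (\<Sum>i=1..r. p s i * cnj (p s i))"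
  have N0: "N \<noteq> 0" unfolding N_def using s by (rule head_norm_nonzero)
  have "near (\<lambda>x. (\<Sum>i=1..r. (\<Sum>k=1..r. Gh x k i l * Y x k) * cnj (Y x i)) / (\<Sum>i=1..r. Y x i * cnj (Y x i)))
     ((\<Sum>i=1..r. (\<Sum>k=1..r. G k i l * p s k) * cnj (p s i)) / (\<Sum>i=1..r. p s i * cnj (p s i)))"
    using N0 l unfolding N_def by (intro near_divide near_intros Gh Y) auto
  moreover have "(\<Sum>i=1..r. (\<Sum>k=1..r. G k i l * p s k) * cnj (p s i)) = (p s l / p s 0) * N"
    unfolding N_def sum_distrib_left
    using generating_matrix_contract[OF G _ l s] by (intro sum.cong refl) simp
  ultimately show ?thesis using N0 by (simp add: N_def)
qed

text \<open>The square arises from writing \<open>p s 0 * p s k * p s l\<close> through the limit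
  factors \<open>p s k\<close> and \<open>p s l / p s 0\<close>.\<close>

lemma J1_coefficients_near:
  assumes T: "\<And>i j k. (i, j, k) \<in> \<Omega> n \<Longrightarrow> near (\<lambda>x. T x i j k) (cube_sum r p i j k)"
    and Y: "\<And>s i. s \<in> {1..r} \<Longrightarrow> i \<in> {1..r} \<Longrightarrow> near (\<lambda>x. Y x s i) (p s i)"
    and W: "\<And>s l. s \<in> {1..r} \<Longrightarrow> l \<in> {r+1..n} \<Longrightarrow> near (\<lambda>x. W x s l) (p s l / p s 0)"
    and opt: "eventually (\<lambda>x. \<forall>b'.
        subtensor_norm (J1 n r) (\<lambda>i0 i1 i2. T x i0 i1 i2 - (\<Sum>s=1..r. Y x s i1 * W x s i2 * b x s))
        \<le> subtensor_norm (J1 n r) (\<lambda>i0 i1 i2. T x i0 i1 i2 - (\<Sum>s=1..r. Y x s i1 * W x s i2 * b' s))) \<FF>"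
    and s: "s \<in> {1..r}"
  shows "near (\<lambda>x. b x s) ((p s 0)\<^sup>2)"
proof (rule least_squares_near[where I = "J1 n r" and S = "{1..r}"
      and A = "\<lambda>x (i0, i1, i2) s. Y x s i1 * W x s i2" and b = "\<lambda>x (i0, i1, i2). T x i0 i1 i2"
      and ?A0.0 = "\<lambda>(i0, i1, i2) s. p s i1 * (p s i2 / p s 0)" and g = b and ?g0.0 = "\<lambda>s. (p s 0)\<^sup>2"])
  show "finite (J1 n r)"
    by (rule finite_subset[of _ "{0..n} \<times> {0..n} \<times> {0..n}"]) (use r_less in \<open>auto simp: J1_def\<close>)
  show "\<forall>s\<in>{1..r}. c s = 0"
    if "\<forall>i\<in>J1 n r. (\<Sum>s=1..r. (case i of (i0, i1, i2) \<Rightarrow> \<lambda>s. p s i1 * (p s i2 / p s 0)) s * c s) = 0" for c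
  proof (rule slice_family_injective, rule ballI)
    fix i assume "i \<in> J1 n r"
    with that show "(\<Sum>s=1..r. (case i of (i0, i1, i2) \<Rightarrow> p s i1 * (p s i2 / p s 0)) * c s) = 0"
      by (cases i) force
  qed
  show "near (\<lambda>x. (case i of (i0, i1, i2) \<Rightarrow> \<lambda>s. Y x s i1 * W x s i2) s)
      ((case i of (i0, i1, i2) \<Rightarrow> \<lambda>s. p s i1 * (p s i2 / p s 0)) s)"
    if "i \<in> J1 n r" "s \<in> {1..r}" for i s
  proof -
    obtain i1 i2 where "i = (0, i1, i2)" "i1 \<in> {1..r}" "i2 \<in> {r+1..n}"
      using \<open>i \<in> J1 n r\<close> by (auto simp: J1_def)
    then show ?thesis using that(2) by (simp only: prod.case) (intro near_mult Y W)
  qed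
  show "near (\<lambda>x. case i of (i0, i1, i2) \<Rightarrow> T x i0 i1 i2)
      (\<Sum>s=1..r. (case i of (i0, i1, i2) \<Rightarrow> \<lambda>s. p s i1 * (p s i2 / p s 0)) s * (p s 0)\<^sup>2)"
    if i: "i \<in> J1 n r" for i
  proof -
    obtain k l where kl: "i = (0, k, l)" "k \<in> {1..r}" "l \<in> {r+1..n}" using i by (auto simp: J1_def)
    then have "near (\<lambda>x. T x 0 k l) (cube_sum r p 0 k l)" by (intro T) (auto simp: \<Omega>_def)
    moreover have "cube_sum r p 0 k l = (\<Sum>s=1..r. p s k * (p s l / p s 0) * (p s 0)\<^sup>2)"
      unfolding cube_sum_def by (intro sum.cong refl) (simp add: leading power2_eq_square)
    ultimately show ?thesis by (simp add: kl)
  qed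
  show "eventually (\<lambda>x.
      L2_set (\<lambda>i. cmod ((case i of (i0, i1, i2) \<Rightarrow> T x i0 i1 i2) -
        (\<Sum>s=1..r. (case i of (i0, i1, i2) \<Rightarrow> \<lambda>s. Y x s i1 * W x s i2) s * b x s))) (J1 n r)
      \<le> L2_set (\<lambda>i. cmod ((case i of (i0, i1, i2) \<Rightarrow> T x i0 i1 i2) -
        (\<Sum>s=1..r. (case i of (i0, i1, i2) \<Rightarrow> \<lambda>s. Y x s i1 * W x s i2) s * (p s 0)\<^sup>2))) (J1 n r)) \<FF>"
    using opt
    by eventually_elim (drule spec[of _ "\<lambda>s. (p s 0)\<^sup>2"], simp add: subtensor_norm_def case_prod_unfold)
qed (use s in auto)

text \<open>No label in \<open>J2\<close> is 0, so a single factor \<open>p s 0\<close> compensates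
  the division in \<open>p s l / p s 0\<close>.\<close>

lemma J2_coefficients_near:
  assumes det: "theta_determined r p"
    and T: "\<And>i j k. (i, j, k) \<in> \<Omega> n \<Longrightarrow> near (\<lambda>x. T x i j k) (cube_sum r p i j k)"
    and Y: "\<And>s i. s \<in> {1..r} \<Longrightarrow> i \<in> {1..r} \<Longrightarrow> near (\<lambda>x. Y x s i) (p s i)"
    and W: "\<And>s l. s \<in> {1..r} \<Longrightarrow> l \<in> {r+1..n} \<Longrightarrow> near (\<lambda>x. W x s l) (p s l / p s 0)"
    and opt: "eventually (\<lambda>x. \<forall>b'.
        subtensor_norm (J2 n r) (\<lambda>i1 i2 i3. T x i1 i2 i3 - (\<Sum>s=1..r. Y x s i1 * Y x s i2 * W x s i3 * b x s))
        \<le> subtensor_norm (J2 n r) (\<lambda>i1 i2 i3. T x i1 i2 i3 - (\<Sum>s=1..r. Y x s i1 * Y x s i2 * W x s i3 * b' s))) \<FF>"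
    and s: "s \<in> {1..r}"
  shows "near (\<lambda>x. b x s) (p s 0)"
proof (rule least_squares_near[where I = "J2 n r" and S = "{1..r}"
      and A = "\<lambda>x (i1, i2, i3) s. Y x s i1 * Y x s i2 * W x s i3" and b = "\<lambda>x (i1, i2, i3). T x i1 i2 i3"
      and ?A0.0 = "\<lambda>(i1, i2, i3) s. p s i1 * p s i2 * (p s i3 / p s 0)" and g = b and ?g0.0 = "\<lambda>s. p s 0"])
  show "finite (J2 n r)"
    by (rule finite_subset[of _ "{0..n} \<times> {0..n} \<times> {0..n}"]) (use r_less in \<open>auto simp: J2_def\<close>)
  show "\<forall>s\<in>{1..r}. c s = 0"
    if "\<forall>i\<in>J2 n r. (\<Sum>s=1..r. (case i of (i1, i2, i3) \<Rightarrow> \<lambda>s. p s i1 * p s i2 * (p s i3 / p s 0)) s * c s) = 0" for c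
  proof (rule theta_family_injective[OF det], rule ballI)
    fix i assume "i \<in> J2 n r"
    with that show "(\<Sum>s=1..r. (case i of (i1, i2, i3) \<Rightarrow> p s i1 * p s i2 * (p s i3 / p s 0)) * c s) = 0"
      by (cases i) force
  qed
  show "near (\<lambda>x. (case i of (i1, i2, i3) \<Rightarrow> \<lambda>s. Y x s i1 * Y x s i2 * W x s i3) s)
      ((case i of (i1, i2, i3) \<Rightarrow> \<lambda>s. p s i1 * p s i2 * (p s i3 / p s 0)) s)"
    if "i \<in> J2 n r" "s \<in> {1..r}" for i s
  proof -
    obtain i1 i2 i3 where "i = (i1, i2, i3)" "i1 \<in> {1..r}" "i2 \<in> {1..r}" "i3 \<in> {r+1..n}"
      using \<open>i \<in> J2 n r\<close> by (auto simp: J2_def)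
    then show ?thesis using that(2) by (simp only: prod.case) (intro near_mult Y W)
  qed
  show "near (\<lambda>x. case i of (i1, i2, i3) \<Rightarrow> T x i1 i2 i3)
      (\<Sum>s=1..r. (case i of (i1, i2, i3) \<Rightarrow> \<lambda>s. p s i1 * p s i2 * (p s i3 / p s 0)) s * p s 0)"
    if i: "i \<in> J2 n r" for i
  proof -
    obtain j k l where jkl: "i = (j, k, l)" "j \<noteq> k" "j \<in> {1..r}" "k \<in> {1..r}" "l \<in> {r+1..n}"
      using i by (auto simp: J2_def)
    then have "near (\<lambda>x. T x j k l) (cube_sum r p j k l)" by (intro T) (auto simp: \<Omega>_def)
    moreover have "cube_sum r p j k l = (\<Sum>s=1..r. p s j * p s k * (p s l / p s 0) * p s 0)"
      unfolding cube_sum_def by (intro sum.cong refl) (simp add: leading)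
    ultimately show ?thesis by (simp add: jkl)
  qed
  show "eventually (\<lambda>x.
      L2_set (\<lambda>i. cmod ((case i of (i1, i2, i3) \<Rightarrow> T x i1 i2 i3) -
        (\<Sum>s=1..r. (case i of (i1, i2, i3) \<Rightarrow> \<lambda>s. Y x s i1 * Y x s i2 * W x s i3) s * b x s))) (J2 n r)
      \<le> L2_set (\<lambda>i. cmod ((case i of (i1, i2, i3) \<Rightarrow> T x i1 i2 i3) -
        (\<Sum>s=1..r. (case i of (i1, i2, i3) \<Rightarrow> \<lambda>s. Y x s i1 * Y x s i2 * W x s i3) s * p s 0))) (J2 n r)) \<FF>"
    using opt
    by eventually_elim (drule spec[of _ "\<lambda>s. p s 0"], simp add: subtensor_norm_def case_prod_unfold)
qed (use s in auto)

text \<open>A substitute for the coefficients on \<open>J2\<close> where these may be undetermined.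
  Both tail factors are divided by the leading entry, hence its cube. The data are represented
  exactly, so the residual is 0 and the least squares estimate applies.\<close>

lemma tail_pair_coefficients_near:
  assumes T: "\<And>i j k. (i, j, k) \<in> \<Omega> n \<Longrightarrow> near (\<lambda>x. T x i j k) (cube_sum r p i j k)"
    and W: "\<And>s l. s \<in> {1..r} \<Longrightarrow> l \<in> {r+1..n} \<Longrightarrow> near (\<lambda>x. W x s l) (p s l / p s 0)"
    and eq: "eventually (\<lambda>x. \<forall>j l. T x 0 j l = (\<Sum>s=1..r. W x s j * W x s l * b x s)) \<FF>"
    and s: "s \<in> {1..r}"
  shows "near (\<lambda>x. b x s) (p s 0 ^ 3)"
proof (rule least_squares_near[where I = "{(j, l). j \<in> {r+1..n} \<and> l \<in> {r+1..n} \<and> j \<noteq> l}" and S = "{1..r}"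
      and A = "\<lambda>x (j, l) s. W x s j * W x s l" and b = "\<lambda>x (j, l). T x 0 j l"
      and ?A0.0 = "\<lambda>(j, l) s. (p s j / p s 0) * (p s l / p s 0)" and g = b and ?g0.0 = "\<lambda>s. p s 0 ^ 3"])
  let ?I = "{(j, l). j \<in> {r+1..n} \<and> l \<in> {r+1..n} \<and> j \<noteq> l}"
  show "finite ?I"
    by (rule finite_subset[of _ "{0..n} \<times> {0..n}"]) auto
  show "\<forall>s\<in>{1..r}. c s = 0"
    if "\<forall>i\<in>?I. (\<Sum>s=1..r. (case i of (j, l) \<Rightarrow> \<lambda>s. (p s j / p s 0) * (p s l / p s 0)) s * c s) = 0" for c
  proof (rule tail_pair_injective, rule ballI)
    fix i assume "i \<in> ?I"
    with that show "(\<Sum>s=1..r. (case i of (j, l) \<Rightarrow> (p s j / p s 0) * (p s l / p s 0)) * c s) = 0"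
      by (cases i) force
  qed
  show "near (\<lambda>x. (case i of (j, l) \<Rightarrow> \<lambda>s. W x s j * W x s l) s)
      ((case i of (j, l) \<Rightarrow> \<lambda>s. (p s j / p s 0) * (p s l / p s 0)) s)"
    if "i \<in> ?I" "s \<in> {1..r}" for i s
  proof -
    obtain j l where "i = (j, l)" "j \<in> {r+1..n}" "l \<in> {r+1..n}" using \<open>i \<in> ?I\<close> by blast
    then show ?thesis using that(2) by (simp only: prod.case) (intro near_mult W)
  qed
  show "near (\<lambda>x. case i of (j, l) \<Rightarrow> T x 0 j l)
      (\<Sum>s=1..r. (case i of (j, l) \<Rightarrow> \<lambda>s. (p s j / p s 0) * (p s l / p s 0)) s * p s 0 ^ 3)"
    if i: "i \<in> ?I" for i
  proof -
    obtain j l where jl: "i = (j, l)" "j \<noteq> l" "j \<in> {r+1..n}" "l \<in> {r+1..n}" using i by blast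
    then have "near (\<lambda>x. T x 0 j l) (cube_sum r p 0 j l)" by (intro T) (auto simp: \<Omega>_def)
    moreover have "cube_sum r p 0 j l = (\<Sum>s=1..r. (p s j / p s 0) * (p s l / p s 0) * p s 0 ^ 3)"
      unfolding cube_sum_def by (intro sum.cong refl) (simp add: leading power3_eq_cube)
    ultimately show ?thesis by (simp add: jl)
  qed
  show "eventually (\<lambda>x.
      L2_set (\<lambda>i. cmod ((case i of (j, l) \<Rightarrow> T x 0 j l) -
        (\<Sum>s=1..r. (case i of (j, l) \<Rightarrow> \<lambda>s. W x s j * W x s l) s * b x s))) ?I
      \<le> L2_set (\<lambda>i. cmod ((case i of (j, l) \<Rightarrow> T x 0 j l) -
        (\<Sum>s=1..r. (case i of (j, l) \<Rightarrow> \<lambda>s. W x s j * W x s l) s * p s 0 ^ 3))) ?I) \<FF>"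
    using eq
  proof eventually_elim
    case (elim x)
    have "L2_set (\<lambda>i. cmod ((case i of (j, l) \<Rightarrow> T x 0 j l) -
        (\<Sum>s=1..r. (case i of (j, l) \<Rightarrow> \<lambda>s. W x s j * W x s l) s * b x s))) ?I = 0"
      using elim by (intro L2_set_0') (auto split: prod.split)
    then show ?case by simp
  qed
qed (use s in auto)

lemma recovers_within_of_near:
  assumes \<sigma>: "eventually (\<lambda>x. \<sigma> x permutes {1..r}) \<FF>"
    and \<tau>: "\<And>x s. s \<in> {1..r} \<Longrightarrow> \<tau> x s ^ 3 = 1"
    and near: "\<And>s i. s \<in> {1..r} \<Longrightarrow> i \<in> {0..n} \<Longrightarrow> near (\<lambda>x. \<tau> x s * q x (\<sigma> x s) i) (p s i)"
  shows "\<exists>C>0. eventually (\<lambda>x. recovers_within n r p (q x) (C * cmod (e x))) \<FF>"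
proof -
  define Q where "Q s i c \<longleftrightarrow> c > 0 \<and>
      eventually (\<lambda>x. cmod (\<tau> x s * q x (\<sigma> x s) i - p s i) \<le> c * cmod (e x)) \<FF>" for s i c
  have "\<exists>c. Q s i c" if "s \<in> {1..r}" "i \<in> {0..n}" for s i
    using near[OF that] unfolding near_def Q_def by (elim landau_o.bigE) blast
  then obtain c where "\<And>s i. s \<in> {1..r} \<Longrightarrow> i \<in> {0..n} \<Longrightarrow> Q s i (c s i)"
    using that[of "\<lambda>s i. SOME c. Q s i c"] by (simp add: someI_ex)
  then have c: "c s i > 0" "eventually (\<lambda>x. cmod (\<tau> x s * q x (\<sigma> x s) i - p s i) \<le> c s i * cmod (e x)) \<FF>"
    if "s \<in> {1..r}" "i \<in> {0..n}" for s i
    using that unfolding Q_def by blast+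
  \<comment> \<open>The summand 1 keeps \<open>C\<close> positive for \<open>r = 0\<close>.\<close>
  define C where "C = 1 + (\<Sum>s=1..r. \<Sum>i=0..n. c s i)"
  have c0: "0 \<le> (\<Sum>i=0..n. c s i)" if "s \<in> {1..r}" for s
    using c(1)[OF that] by (intro sum_nonneg less_imp_le)
  have "eventually (\<lambda>x. \<forall>s\<in>{1..r}. \<forall>i\<in>{0..n}. cmod (\<tau> x s * q x (\<sigma> x s) i - p s i) \<le> c s i * cmod (e x)) \<FF>"
    by (intro eventually_ball_finite ballI c(2)) auto
  then have "eventually (\<lambda>x. recovers_within n r p (q x) (C * cmod (e x))) \<FF>"
    using \<sigma>
  proof eventually_elim
    case (elim x)
    \<comment> \<open>\<open>\<sigma> x\<close> relabels \<open>q x\<close>, whereas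
      \<open>recovers_within\<close> relabels \<open>p\<close>; hence the inverse.\<close>
    let ?\<pi> = "inv_into UNIV (\<sigma> x)"
    have \<pi>: "?\<pi> permutes {1..r}" using elim(2) by (rule permutes_inv)
    show ?case
      unfolding recovers_within_def
    proof (intro exI[of _ ?\<pi>] exI[of _ "\<lambda>s. \<tau> x (?\<pi> s)"] conjI ballI \<pi>)
      fix s assume "s \<in> {1..r}"
      then have t: "?\<pi> s \<in> {1..r}" using permutes_in_image[OF \<pi>] by simp
      then show "\<tau> x (?\<pi> s) ^ 3 = 1" by (rule \<tau>)
      have \<sigma>\<pi>: "\<sigma> x (?\<pi> s) = s" using permutes_inverses(1)[OF elim(2)] .
      have "vector_norm {0..n} (\<lambda>i. \<tau> x (?\<pi> s) * q x s i - p (?\<pi> s) i)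
          \<le> (\<Sum>i=0..n. cmod (\<tau> x (?\<pi> s) * q x s i - p (?\<pi> s) i))"
        unfolding vector_norm_def by (rule L2_set_le_sum) auto
      also have "\<dots> \<le> (\<Sum>i=0..n. c (?\<pi> s) i * cmod (e x))"
      proof (rule sum_mono)
        fix i assume "i \<in> {0..n}"
        then have "cmod (\<tau> x (?\<pi> s) * q x (\<sigma> x (?\<pi> s)) i - p (?\<pi> s) i) \<le> c (?\<pi> s) i * cmod (e x)"
          using elim(1) t by blast
        then show "cmod (\<tau> x (?\<pi> s) * q x s i - p (?\<pi> s) i) \<le> c (?\<pi> s) i * cmod (e x)"
          unfolding \<sigma>\<pi> .
      qed
      also have "\<dots> \<le> C * cmod (e x)"
      proof -
        have "(\<Sum>i=0..n. c (?\<pi> s) i) \<le> (\<Sum>s=1..r. \<Sum>i=0..n. c s i)"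
          using t c0 by (intro member_le_sum[of "?\<pi> s" _ "\<lambda>s. \<Sum>i=0..n. c s i"]) auto
        then show ?thesis
          unfolding sum_distrib_right[symmetric] C_def by (intro mult_right_mono) auto
      qed
      finally show "vector_norm {0..n} (\<lambda>i. \<tau> x (?\<pi> s) * q x s i - p (?\<pi> s) i) \<le> C * cmod (e x)" .
    qed
  qed
  moreover have "0 \<le> (\<Sum>s=1..r. \<Sum>i=0..n. c s i)" by (rule sum_nonneg) (rule c0)
  then have "C > 0" unfolding C_def by simp
  ultimately show ?thesis by blast
qed

end

section \<open>The algorithm\<close>

lemma is_arg_min_square_le:
  fixes f :: "'a \<Rightarrow> real"
  assumes "is_arg_min (\<lambda>b. (f b)\<^sup>2) (\<lambda>_. True) b" "\<And>b. 0 \<le> f b"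
  shows "f b \<le> f b'"
proof -
  have "(f b)\<^sup>2 \<le> (f b')\<^sup>2" using assms(1) unfolding is_arg_min_def by (meson not_less)
  then show ?thesis using assms(2) by (rule power2_le_imp_le)
qed

lemma subtensor_norm_nonneg [simp]: "0 \<le> subtensor_norm J T"
  by (simp add: subtensor_norm_def)

lemma eigenvector_N_comb:
  assumes "eigenvector (N_comb n r \<xi> G) v m" "i \<in> {1..r}"
  shows "(\<Sum>k=1..r. (\<Sum>l=r+1..n. \<xi> l * G k i l) * vec_index v (k - 1)) = m * vec_index v (i - 1)"
proof -
  have v: "dim_vec v = r" "N_comb n r \<xi> G *\<^sub>v v = m \<cdot>\<^sub>v v"
    using assms(1) by (auto simp: eigenvector_def N_comb_def)
  have i: "i - 1 < r" using assms(2) by auto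
  have "(\<Sum>k=1..r. (\<Sum>l=r+1..n. \<xi> l * G k i l) * vec_index v (k - 1)) =
      (\<Sum>k=0..<r. (\<Sum>l=r+1..n. \<xi> l * G (k + 1) i l) * vec_index v k)"
    by (subst sum_shift_index[symmetric]) simp
  also have "\<dots> = vec_index (N_comb n r \<xi> G *\<^sub>v v) (i - 1)"
    using i v(1) assms(2) by (auto simp: N_comb_def N_mat_def scalar_prod_def intro!: sum.cong)
  also have "\<dots> = m * vec_index v (i - 1)" using i v by simp
  finally show ?thesis .
qed

lemma w_vec_eq:
  assumes "dim_vec (v s) = r"
  shows "w_vec r G v s l = (\<Sum>i=1..r. (\<Sum>k=1..r. G k i l * vec_index (v s) (k - 1)) * cnj (vec_index (v s) (i - 1)))"
proof -
  have "w_vec r G v s l = (\<Sum>i=0..<r. (\<Sum>k=0..<r. G (k + 1) (i + 1) l * vec_index (v s) k) * cnj (vec_index (v s) i))"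
    using assms by (auto simp: w_vec_def N_mat_def scalar_prod_def intro!: sum.cong)
  also have "\<dots> = (\<Sum>i=0..<r. (\<Sum>k=1..r. G k (i + 1) l * vec_index (v s) (k - 1)) * cnj (vec_index (v s) i))"
    by (subst sum_shift_index[symmetric]) simp
  also have "\<dots> = (\<Sum>i=1..r. (\<Sum>k=1..r. G k i l * vec_index (v s) (k - 1)) * cnj (vec_index (v s) (i - 1)))"
    by (subst sum_shift_index[symmetric]) simp
  finally show ?thesis .
qed

lemma unit_norm_sum:
  assumes "vector_norm {0..<r} (vec_index v) = 1"
  shows "(\<Sum>i=1..r. vec_index v (i - 1) * cnj (vec_index v (i - 1))) = 1"
proof -
  have "(\<Sum>i=0..<r. (cmod (vec_index v i))\<^sup>2) = 1"
    using assms unfolding vector_norm_def L2_set_def by simp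
  then have "complex_of_real (\<Sum>i=0..<r. (cmod (vec_index v i))\<^sup>2) = 1" by simp
  then have "(\<Sum>i=0..<r. vec_index v i * cnj (vec_index v i)) = 1"
    unfolding of_real_sum complex_norm_square .
  then show ?thesis by (subst sum_shift_index[symmetric]) simp
qed

lemma lin_indep_family_shift:
  assumes "lin_indep_family r {0..<r} x"
  shows "lin_indep_family r {1..r} (\<lambda>s i. x s (i - 1))"
  unfolding lin_indep_family_def
proof (intro allI impI)
  fix c assume c: "\<forall>i\<in>{1..r}. (\<Sum>s=1..r. c s * x s (i - 1)) = 0"
  have "\<forall>i\<in>{0..<r}. (\<Sum>s=1..r. c s * x s i) = 0"
  proof
    fix i assume "i \<in> {0..<r}"
    then show "(\<Sum>s=1..r. c s * x s i) = 0" using c[THEN bspec, of "i + 1"] by simp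
  qed
  then show "\<forall>s\<in>{1..r}. c s = 0" using assms unfolding lin_indep_family_def by blast
qed

lemma powr_third_cubed: "(z powr (1/3)) ^ 3 = (z :: complex)"
proof (cases "z = 0")
  case False
  have "(z powr (1/3)) ^ 3 = exp (of_nat 3 * (1/3 * Ln z))"
    using False unfolding powr_def exp_of_nat_mult by simp
  then show ?thesis using False by simp
qed simp

section \<open>Relabelling and rescaling the fitted families\<close>

text \<open>Dividing a vector by its scale is compensated in its coefficient; the fit on
  \<open>J1\<close> uses this with the scale itself, the fit on \<open>J2\<close> with its
  square.\<close>

lemma rescaled_sum_permute:
  fixes V W :: "nat \<Rightarrow> complex"
  assumes "\<sigma> permutes {1..r}" "\<forall>s\<in>{1..r}. c s \<noteq> 0"
  shows "(\<Sum>s=1..r. V (\<sigma> s) / c s * W (\<sigma> s) * (c s * f (\<sigma> s))) = (\<Sum>s=1..r. f s * V s * W s)"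
proof -
  have "(\<Sum>s=1..r. f s * V s * W s) = (\<Sum>s=1..r. f (\<sigma> s) * V (\<sigma> s) * W (\<sigma> s))"
    using sum.permute[OF assms(1), of "\<lambda>s. f s * V s * W s"] by (simp add: o_def)
  also have "\<dots> = (\<Sum>s=1..r. V (\<sigma> s) / c s * W (\<sigma> s) * (c s * f (\<sigma> s)))"
    using assms(2) by (intro sum.cong refl) simp
  finally show ?thesis ..
qed


text \<open>The substitution of coefficients is a bijection, so optimality in the original scale
  carries over.\<close>

lemma beta_optimal_rescaled:
  assumes opt: "beta_optimal n r T v W \<beta>"
    and \<sigma>: "\<sigma> permutes {1..r}" and c: "\<forall>s\<in>{1..r}. c s \<noteq> 0"
  shows "subtensor_norm (J1 n r) (\<lambda>i0 i1 i2. T i0 i1 i2 -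
           (\<Sum>s=1..r. vec_index (v (\<sigma> s)) (i1 - 1) / c s * W (\<sigma> s) i2 * (c s * \<beta> (\<sigma> s))))
       \<le> subtensor_norm (J1 n r) (\<lambda>i0 i1 i2. T i0 i1 i2 -
           (\<Sum>s=1..r. vec_index (v (\<sigma> s)) (i1 - 1) / c s * W (\<sigma> s) i2 * b s))"
proof -
  \<comment> \<open>Coefficients in the original labels and scale that reproduce the competitor
    \<open>b\<close>.\<close>
  define f where "f t = b (inv_into UNIV \<sigma> t) / c (inv_into UNIV \<sigma> t)" for t
  have "c s * f (\<sigma> s) = b s" if "s \<in> {1..r}" for s
    using c that permutes_inverses(2)[OF \<sigma>] by (simp add: f_def)
  then have resb: "(\<Sum>s=1..r. vec_index (v (\<sigma> s)) i / c s * W (\<sigma> s) k * b s) = (\<Sum>s=1..r. f s * vec_index (v s) i * W s k)" for i k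
    by (subst rescaled_sum_permute[OF \<sigma> c, where V = "\<lambda>s. vec_index (v s) i" and W = "\<lambda>s. W s k" and f = f, symmetric])
      (intro sum.cong refl, simp)
  have resc: "(\<Sum>s=1..r. vec_index (v (\<sigma> s)) i / c s * W (\<sigma> s) k * (c s * \<beta> (\<sigma> s))) = (\<Sum>s=1..r. \<beta> s * vec_index (v s) i * W s k)" for i k
    by (rule rescaled_sum_permute[OF \<sigma> c, where V = "\<lambda>s. vec_index (v s) i" and W = "\<lambda>s. W s k"])
  show ?thesis unfolding resc resb
    using is_arg_min_square_le[OF opt[unfolded beta_optimal_def], of f] by simp
qed

text \<open>Each eigenvector occurs twice in a term, so the scale enters squared.\<close>

lemma theta_optimal_rescaled:
  assumes opt: "theta_optimal n r T v W \<theta>"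
    and \<sigma>: "\<sigma> permutes {1..r}" and c: "\<forall>s\<in>{1..r}. c s \<noteq> 0"
  shows "subtensor_norm (J2 n r) (\<lambda>i1 i2 i3. T i1 i2 i3 -
           (\<Sum>s=1..r. vec_index (v (\<sigma> s)) (i1 - 1) / c s * (vec_index (v (\<sigma> s)) (i2 - 1) / c s) * W (\<sigma> s) i3 * ((c s)\<^sup>2 * \<theta> (\<sigma> s))))
       \<le> subtensor_norm (J2 n r) (\<lambda>i1 i2 i3. T i1 i2 i3 -
           (\<Sum>s=1..r. vec_index (v (\<sigma> s)) (i1 - 1) / c s * (vec_index (v (\<sigma> s)) (i2 - 1) / c s) * W (\<sigma> s) i3 * b s))"
proof -
  define f where "f t = b (inv_into UNIV \<sigma> t) / (c (inv_into UNIV \<sigma> t))\<^sup>2" for t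
  have f: "(c s)\<^sup>2 * f (\<sigma> s) = b s" if "s \<in> {1..r}" for s
    using c that permutes_inverses(2)[OF \<sigma>] by (simp add: f_def)
  have c2: "\<forall>s\<in>{1..r}. (c s)\<^sup>2 \<noteq> 0" using c by simp
  have resc: "(\<Sum>s=1..r. vec_index (v (\<sigma> s)) i / c s * (vec_index (v (\<sigma> s)) j / c s) * W (\<sigma> s) k * ((c s)\<^sup>2 * g (\<sigma> s))) =
      (\<Sum>s=1..r. g s * vec_index (v s) i * vec_index (v s) j * W s k)" for i j k g
    using rescaled_sum_permute[OF \<sigma> c2, where V = "\<lambda>s. vec_index (v s) i * vec_index (v s) j" and W = "\<lambda>s. W s k" and f = g]
    by (simp add: power2_eq_square mult.assoc)
  have resb: "(\<Sum>s=1..r. vec_index (v (\<sigma> s)) i / c s * (vec_index (v (\<sigma> s)) j / c s) * W (\<sigma> s) k * b s) =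
      (\<Sum>s=1..r. f s * vec_index (v s) i * vec_index (v s) j * W s k)" for i j k
    by (subst resc[symmetric]) (intro sum.cong refl, simp add: f)
  show ?thesis unfolding resc resb
    using is_arg_min_square_le[OF opt[unfolded theta_optimal_def], of f] by simp
qed

section \<open>Accuracy of the starting points and of the refined points\<close>

context cubic_decomposition
begin

text \<open>The unknown scale of the unit eigenvectors enters \<open>\<beta>\<close>,
  \<open>\<theta>\<close> and \<open>v\<close> in such powers that it cancels from the assembled
  vectors, so rescaled quantities with known limits can be used throughout.\<close>

lemma algorithm_start_recovers:
  assumes T: "\<And>i j k. (i, j, k) \<in> \<Omega> n \<Longrightarrow> near (\<lambda>x. T x i j k) (cube_sum r p i j k)"
    and det: "theta_determined r p"
    and G: "generating_matrix n r (cube_sum r p) G"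
    and dist: "distinct_eigenvalues (N_comb n r \<xi> G)"
    and est: "eventually (\<lambda>x. estimated_generating_matrix n r (T x) (Gh x)) \<FF>"
    and unit: "eventually (\<lambda>x. unit_eigenvectors r (N_comb n r \<xi> (Gh x)) (v x)) \<FF>"
    and beta: "eventually (\<lambda>x. beta_optimal n r (T x) (v x) (w_vec r (Gh x) (v x)) (\<beta> x)) \<FF>"
    and theta: "eventually (\<lambda>x. theta_optimal n r (T x) (v x) (w_vec r (Gh x) (v x)) (\<theta> x)) \<FF>"
    and q: "eventually (\<lambda>x. \<forall>s\<in>{1..r}. \<forall>i\<in>{0..n}. q x s i =
        assembled_vector r ((\<beta> x s)\<^sup>2 / \<theta> x s) (\<theta> x s / \<beta> x s) (v x s) (w_vec r (Gh x) (v x) s) i) \<FF>"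
  shows "\<exists>C>0. eventually (\<lambda>x. recovers_within n r p (q x) (C * cmod (e x))) \<FF>"
proof -
  define V where "V x s i = vec_index (v x s) (i - 1)" for x s i
  define w where "w x s l = w_vec r (Gh x) (v x) s l" for x s l
  define m where "m x s = (SOME \<mu>. eigenvector (N_comb n r \<xi> (Gh x)) (v x s) \<mu>)" for x s
  note Gh = estimated_generating_matrix_near[OF T G est]
  have ev: "eventually (\<lambda>x. \<forall>s\<in>{1..r}. eigenvector (N_comb n r \<xi> (Gh x)) (v x s) (m x s)) \<FF>"
    using unit
  proof eventually_elim
    case (elim x)
    show ?case
    proof
      fix s assume "s \<in> {1..r}"
      then have "\<exists>\<mu>. eigenvector (N_comb n r \<xi> (Gh x)) (v x s) \<mu>"
        using elim unfolding unit_eigenvectors_def by blast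
      then show "eigenvector (N_comb n r \<xi> (Gh x)) (v x s) (m x s)"
        unfolding m_def by (rule someI_ex)
    qed
  qed
  have eig: "eventually (\<lambda>x. \<forall>s\<in>{1..r}. \<forall>i\<in>{1..r}.
        (\<Sum>k=1..r. (\<Sum>l=r+1..n. \<xi> l * Gh x k i l) * V x s k) = m x s * V x s i) \<FF>"
    using ev by eventually_elim (auto simp: V_def intro!: eigenvector_N_comb)
  have indep: "eventually (\<lambda>x. lin_indep_family r {1..r} (V x)) \<FF>"
    using unit
  proof eventually_elim
    case (elim x)
    then show ?case unfolding unit_eigenvectors_def V_def
      by (intro lin_indep_family_shift[where x = "\<lambda>s. vec_index (v x s)"]) blast
  qed
  obtain \<sigma> c where
      perm: "eventually (\<lambda>x. \<sigma> x permutes {1..r} \<and> (\<forall>s\<in>{1..r}. c x s \<noteq> 0)) \<FF>"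
    and VY: "\<forall>s\<in>{1..r}. \<forall>i\<in>{1..r}. near (\<lambda>x. V x (\<sigma> x s) i / c x s) (p s i)"
    using N_comb_eigenvectors_near[OF G dist Gh eig indep] by blast
  \<comment> \<open>Only the eigenvectors are rescaled; \<open>W\<close> consists of Rayleigh
    quotients, which keep their values.\<close>
  define Y where "Y x s i = V x (\<sigma> x s) i / c x s" for x s i
  define W where "W x s l = w x (\<sigma> x s) l" for x s l
  have Y: "near (\<lambda>x. Y x s i) (p s i)" if "s \<in> {1..r}" "i \<in> {1..r}" for s i
    using VY that by (simp add: Y_def)
  have \<sigma>in: "eventually (\<lambda>x. \<sigma> x s \<in> {1..r} \<and> c x s \<noteq> 0) \<FF>" if s: "s \<in> {1..r}" for s
    using perm
  proof eventually_elim
    case (elim x)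
    then have "\<sigma> x s \<in> {1..r}" using s by (simp only: permutes_in_image)
    then show ?case using elim s by blast
  qed
  have W: "near (\<lambda>x. W x s l) (p s l / p s 0)" if sl: "s \<in> {1..r}" "l \<in> {r+1..n}" for s l
  proof (rule near_cong[OF _ Rayleigh_quotient_near[OF G Gh Y[OF sl(1)] sl]])
    show "eventually (\<lambda>x. (\<Sum>i=1..r. (\<Sum>k=1..r. Gh x k i l * Y x s k) * cnj (Y x s i)) /
        (\<Sum>i=1..r. Y x s i * cnj (Y x s i)) = W x s l) \<FF>"
      using \<sigma>in[OF sl(1)] unit ev
    proof eventually_elim
      case (elim x)
      let ?t = "\<sigma> x s"
      have t: "?t \<in> {1..r}" and c: "c x s \<noteq> 0" using elim(1) by auto
      have dim: "dim_vec (v x ?t) = r"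
        using elim(3) t by (auto simp: eigenvector_def N_comb_def)
      have one: "(\<Sum>i=1..r. V x ?t i * cnj (V x ?t i)) = 1"
        unfolding V_def using elim(2) t by (intro unit_norm_sum) (auto simp: unit_eigenvectors_def)
      \<comment> \<open>Numerator and denominator scale alike, and unit length makes the unscaled
        denominator 1.\<close>
      have num: "(\<Sum>i=1..r. (\<Sum>k=1..r. Gh x k i l * Y x s k) * cnj (Y x s i)) = W x s l / (c x s * cnj (c x s))"
        unfolding W_def w_def w_vec_eq[where v = "v x" and s = "\<sigma> x s", OF dim] Y_def V_def
        by (simp add: sum_divide_distrib sum_distrib_right)
      have den: "(\<Sum>i=1..r. Y x s i * cnj (Y x s i)) = 1 / (c x s * cnj (c x s))"
        unfolding one[symmetric] Y_def by (simp add: sum_divide_distrib)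
      show ?case unfolding num den using c by simp
    qed
  qed
  have b: "near (\<lambda>x. c x s * \<beta> x (\<sigma> x s)) ((p s 0)\<^sup>2)" if s: "s \<in> {1..r}" for s
  proof (rule J1_coefficients_near[OF T Y W, where b = "\<lambda>x s. c x s * \<beta> x (\<sigma> x s)" and s = s])
    show "eventually (\<lambda>x. \<forall>b'.
        subtensor_norm (J1 n r) (\<lambda>i0 i1 i2. T x i0 i1 i2 - (\<Sum>s=1..r. Y x s i1 * W x s i2 * (c x s * \<beta> x (\<sigma> x s))))
        \<le> subtensor_norm (J1 n r) (\<lambda>i0 i1 i2. T x i0 i1 i2 - (\<Sum>s=1..r. Y x s i1 * W x s i2 * b' s))) \<FF>"
      using perm beta
    proof eventually_elim
      case (elim x)
      then show ?case unfolding Y_def V_def W_def w_def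
        by (intro allI beta_optimal_rescaled) auto
    qed
  qed (use s in auto)
  have th: "near (\<lambda>x. (c x s)\<^sup>2 * \<theta> x (\<sigma> x s)) (p s 0)" if s: "s \<in> {1..r}" for s
  proof (rule J2_coefficients_near[OF det T Y W, where b = "\<lambda>x s. (c x s)\<^sup>2 * \<theta> x (\<sigma> x s)" and s = s])
    show "eventually (\<lambda>x. \<forall>b'.
        subtensor_norm (J2 n r) (\<lambda>i1 i2 i3. T x i1 i2 i3 -
          (\<Sum>s=1..r. Y x s i1 * Y x s i2 * W x s i3 * ((c x s)\<^sup>2 * \<theta> x (\<sigma> x s))))
        \<le> subtensor_norm (J2 n r) (\<lambda>i1 i2 i3. T x i1 i2 i3 - (\<Sum>s=1..r. Y x s i1 * Y x s i2 * W x s i3 * b' s))) \<FF>"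
      using perm theta
    proof eventually_elim
      case (elim x)
      then show ?case unfolding Y_def V_def W_def w_def
        by (intro allI theta_optimal_rescaled) auto
    qed
  qed (use s in auto)
  define z where "z x s = ((\<beta> x (\<sigma> x s))\<^sup>2 / \<theta> x (\<sigma> x s)) powr (1/3)" for x s
  have z: "near (\<lambda>x. z x s ^ 3) (p s 0 ^ 3)" if s: "s \<in> {1..r}" for s
  proof -
    \<comment> \<open>The scale cancels in \<open>\<beta>\<^sup>2 / \<theta>\<close>, and the limit
      is the fourth power of the leading entry divided by that entry.\<close>
    have "near (\<lambda>x. (c x s * \<beta> x (\<sigma> x s))\<^sup>2 / ((c x s)\<^sup>2 * \<theta> x (\<sigma> x s))) (((p s 0)\<^sup>2)\<^sup>2 / p s 0)"
      using leading[OF s] by (intro near_divide near_power b th s)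
    moreover have "((p s 0)\<^sup>2)\<^sup>2 / p s 0 = p s 0 ^ 3"
      using leading[OF s] by (simp add: power2_eq_square power3_eq_cube)
    moreover have "eventually (\<lambda>x. (c x s * \<beta> x (\<sigma> x s))\<^sup>2 / ((c x s)\<^sup>2 * \<theta> x (\<sigma> x s)) = z x s ^ 3) \<FF>"
      using \<sigma>in[OF s] by eventually_elim (simp add: z_def powr_third_cubed power_mult_distrib)
    ultimately show ?thesis by (auto intro: near_cong)
  qed
  \<comment> \<open>The principal cube root approximates \<open>p s 0\<close> only up to a cube root
    of unity, which \<open>\<tau>\<close> corrects.\<close>
  have "\<forall>s. \<exists>\<tau>. s \<in> {1..r} \<longrightarrow> (\<forall>x. \<tau> x ^ 3 = 1) \<and> near (\<lambda>x. \<tau> x * z x s) (p s 0)"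
    using cube_root_of_near[OF z leading] by blast
  from choice[OF this] obtain \<tau> where \<tau>: "\<And>s x. s \<in> {1..r} \<Longrightarrow> \<tau> s x ^ 3 = 1"
      "\<And>s. s \<in> {1..r} \<Longrightarrow> near (\<lambda>x. \<tau> s x * z x s) (p s 0)"
    by blast
  show ?thesis
  proof (rule recovers_within_of_near[where \<sigma> = \<sigma> and \<tau> = "\<lambda>x s. \<tau> s x"])
    show "eventually (\<lambda>x. \<sigma> x permutes {1..r}) \<FF>" using perm by (rule eventually_mono) simp
    show "\<tau> s x ^ 3 = 1" if "s \<in> {1..r}" for x s using \<tau>(1)[OF that] .
    fix s i assume s: "s \<in> {1..r}" and i: "i \<in> {0..n}"
    have qe: "eventually (\<lambda>x. c x s \<noteq> 0 \<and> q x (\<sigma> x s) i = z x s * (if i = 0 then 1 else if i \<le> r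
          then \<theta> x (\<sigma> x s) / \<beta> x (\<sigma> x s) * V x (\<sigma> x s) i else W x s i)) \<FF>"
      using q \<sigma>in[OF s]
      by eventually_elim (use i in \<open>auto simp: assembled_vector_def z_def V_def W_def w_def\<close>)
    consider "i = 0" | "i \<in> {1..r}" | "i \<in> {r+1..n}" using i by fastforce
    then show "near (\<lambda>x. \<tau> s x * q x (\<sigma> x s) i) (p s i)"
    proof cases
      case 1
      have "eventually (\<lambda>x. \<tau> s x * z x s = \<tau> s x * q x (\<sigma> x s) i) \<FF>"
        using qe by eventually_elim (simp add: 1)
      from near_cong[OF this \<tau>(2)[OF s]] show ?thesis by (simp add: 1)
    next
      case 2
      \<comment> \<open>The product is rewritten through quantities with known limits; the remaining
        factor \<open>c x s\<close> cancels against the scale in \<open>Y\<close>.\<close>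
      have "eventually (\<lambda>x. \<tau> s x * z x s * ((c x s)\<^sup>2 * \<theta> x (\<sigma> x s) / (c x s * \<beta> x (\<sigma> x s)) * Y x s i)
          = \<tau> s x * q x (\<sigma> x s) i) \<FF>"
        using qe by eventually_elim (use 2 in \<open>auto simp: Y_def power2_eq_square\<close>)
      moreover have "near (\<lambda>x. \<tau> s x * z x s * ((c x s)\<^sup>2 * \<theta> x (\<sigma> x s) / (c x s * \<beta> x (\<sigma> x s)) * Y x s i))
          (p s 0 * (p s 0 / (p s 0)\<^sup>2 * p s i))"
        using leading[OF s] 2 s by (intro near_mult near_divide \<tau> b th Y) auto
      ultimately have "near (\<lambda>x. \<tau> s x * q x (\<sigma> x s) i) (p s 0 * (p s 0 / (p s 0)\<^sup>2 * p s i))"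
        by (rule near_cong)
      then show ?thesis using leading[OF s] by (simp add: power2_eq_square)
    next
      case 3
      have "eventually (\<lambda>x. \<tau> s x * z x s * W x s i = \<tau> s x * q x (\<sigma> x s) i) \<FF>"
        using qe by eventually_elim (use 3 in auto)
      from near_cong[OF this near_mult[OF \<tau>(2)[OF s] W[OF s 3]]]
      show ?thesis using leading[OF s] by simp
    qed
  qed
qed

text \<open>\<open>q x\<close> decomposes nearby data exactly, so its own generating matrix, heads
  and ratios take the place of the computed quantities. Their scale is fixed by the coefficients on
  \<open>J1\<close> together with those on pairs of tail labels.\<close>

lemma approximate_decomposition_recovers:
  assumes T: "\<And>i j k. (i, j, k) \<in> \<Omega> n \<Longrightarrow> near (\<lambda>x. cube_sum r (q x) i j k) (cube_sum r p i j k)"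
    and G: "generating_matrix n r (cube_sum r p) G"
    and dist: "distinct_eigenvalues (N_comb n r \<xi> G)"
  shows "\<exists>C>0. eventually (\<lambda>x. recovers_within n r p (q x) (C * cmod (e x))) \<FF>"
proof -
  \<comment> \<open>Injectivity of the block of entries \<open>(0, k, l)\<close> survives small
    perturbations and makes \<open>q x\<close> nondegenerate.\<close>
  have "eventually (\<lambda>x. \<forall>h. (\<forall>l\<in>{r+1..n}. (\<Sum>k=1..r. cube_sum r (q x) 0 k l * h k) = 0) \<longrightarrow>
      (\<forall>k\<in>{1..r}. h k = 0)) \<FF>"
  proof (rule eventually_injective[where A = "\<lambda>x l k. cube_sum r (q x) 0 k l" and ?A0.0 = "\<lambda>l k. cube_sum r p 0 k l"])
    show "\<forall>k\<in>{1..r}. c k = 0" if "\<forall>l\<in>{r+1..n}. (\<Sum>k=1..r. cube_sum r p 0 k l * c k) = 0" for c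
      using that r_less by (intro slice_injective[of n]) auto
    show "((\<lambda>x. cube_sum r (q x) 0 k l) \<longlongrightarrow> cube_sum r p 0 k l) \<FF>"
      if "l \<in> {r+1..n}" "k \<in> {1..r}" for l k
      using that by (intro near_tendsto T) (auto simp: \<Omega>_def)
  qed auto
  then have nd: "eventually (\<lambda>x. lin_indep_family r {1..r} (q x) \<and> (\<forall>s\<in>{1..r}. q x s 0 \<noteq> 0)) \<FF>"
  proof eventually_elim
    case (elim x)
    then have "\<forall>k\<in>{1..r}. h k = 0" if "\<forall>l\<in>{r+1..n}. (\<Sum>k=1..r. cube_sum r (q x) 0 k l * h k) = 0" for h
      using that by blast
    from nondegenerate_of_injective[OF this] show ?case by blast
  qed
  define GP where "GP x G \<longleftrightarrow> (\<forall>s\<in>{1..r}. \<forall>i j. (\<Sum>k=1..r. G k i j * q x s k) = q x s i * q x s j / q x s 0)"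
    for x and G :: "nat \<Rightarrow> nat \<Rightarrow> nat \<Rightarrow> complex"
  define Gh where "Gh x = (SOME G. GP x G)" for x
  have GP: "eventually (\<lambda>x. GP x (Gh x)) \<FF>"
    using nd
  proof eventually_elim
    case (elim x)
    then have "\<exists>G. GP x G" unfolding GP_def by (intro generating_matrix_of_family_exists) blast
    then show ?case unfolding Gh_def by (rule someI_ex)
  qed
  \<comment> \<open>A matrix with zero residual is an optimizer, so the estimate for computed
    generating matrices applies to it.\<close>
  have est: "eventually (\<lambda>x. estimated_generating_matrix n r (cube_sum r (q x)) (Gh x)) \<FF>"
    using GP nd
  proof eventually_elim
    case (elim x)
    have "(\<Sum>k=1..r. cube_sum r (q x) 0 k l * Gh x k i j) = cube_sum r (q x) i j l" for i j l
      using elim unfolding GP_def by (intro family_generating_equation) auto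
    then show ?case
      unfolding estimated_generating_matrix_def is_arg_min_def A_mat_def b_vec_def vector_norm_def
      by (auto simp: not_less L2_set_0')
  qed
  note Gh = estimated_generating_matrix_near[OF T G est]
  define m where "m x s = (\<Sum>l=r+1..n. \<xi> l * (q x s l / q x s 0))" for x s
  have eig: "eventually (\<lambda>x. \<forall>s\<in>{1..r}. \<forall>i\<in>{1..r}.
        (\<Sum>k=1..r. (\<Sum>l=r+1..n. \<xi> l * Gh x k i l) * q x s k) = m x s * q x s i) \<FF>"
    using GP
  proof eventually_elim
    case (elim x)
    then show ?case unfolding GP_def m_def by (intro ballI family_N_comb_eigenvector) blast
  qed
  have indep: "eventually (\<lambda>x. lin_indep_family r {1..r} (q x)) \<FF>"
    using nd by (rule eventually_mono) blast
  obtain \<sigma> c where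
      perm: "eventually (\<lambda>x. \<sigma> x permutes {1..r} \<and> (\<forall>s\<in>{1..r}. c x s \<noteq> 0)) \<FF>"
    and VY: "\<forall>s\<in>{1..r}. \<forall>i\<in>{1..r}. near (\<lambda>x. q x (\<sigma> x s) i / c x s) (p s i)"
    using N_comb_eigenvectors_near[OF G dist Gh eig indep] by blast
  define Y where "Y x s i = q x (\<sigma> x s) i / c x s" for x s i
  define W where "W x s l = q x (\<sigma> x s) l / q x (\<sigma> x s) 0" for x s l
  have Y: "near (\<lambda>x. Y x s i) (p s i)" if "s \<in> {1..r}" "i \<in> {1..r}" for s i
    using VY that by (simp add: Y_def)
  have \<sigma>in: "eventually (\<lambda>x. \<sigma> x s \<in> {1..r} \<and> c x s \<noteq> 0 \<and> q x (\<sigma> x s) 0 \<noteq> 0) \<FF>" if s: "s \<in> {1..r}" for s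
    using perm nd
  proof eventually_elim
    case (elim x)
    then have "\<sigma> x s \<in> {1..r}" using s by (simp only: permutes_in_image)
    then show ?case using elim s by blast
  qed
  have W: "near (\<lambda>x. W x s l) (p s l / p s 0)" if sl: "s \<in> {1..r}" "l \<in> {r+1..n}" for s l
  proof (rule near_cong[OF _ Rayleigh_quotient_near[OF G Gh Y[OF sl(1)] sl]])
    \<comment> \<open>The heads need not have unit length; the denominator stays away from 0 because
      of its limit.\<close>
    have "near (\<lambda>x. \<Sum>i=1..r. Y x s i * cnj (Y x s i)) (\<Sum>i=1..r. p s i * cnj (p s i))"
      by (intro near_intros Y sl)
    from near_eventually_nonzero[OF this head_norm_nonzero[OF sl(1)]]
    show "eventually (\<lambda>x. (\<Sum>i=1..r. (\<Sum>k=1..r. Gh x k i l * Y x s k) * cnj (Y x s i)) /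
        (\<Sum>i=1..r. Y x s i * cnj (Y x s i)) = W x s l) \<FF>"
      using \<sigma>in[OF sl(1)] GP
    proof eventually_elim
      case (elim x)
      \<comment> \<open>The rescaled head is an exact eigenvector with eigenvalue
        \<open>W x s l\<close>, which the quotient returns.\<close>
      have "(\<Sum>k=1..r. Gh x k i l * Y x s k) = W x s l * Y x s i" for i
      proof -
        have "(\<Sum>k=1..r. Gh x k i l * Y x s k) = (\<Sum>k=1..r. Gh x k i l * q x (\<sigma> x s) k) / c x s"
          by (simp add: Y_def sum_divide_distrib)
        also have "\<dots> = q x (\<sigma> x s) i * q x (\<sigma> x s) l / q x (\<sigma> x s) 0 / c x s"
          using elim(2,3) unfolding GP_def by simp
        finally show ?thesis by (simp add: W_def Y_def)
      qed
      then have "(\<Sum>i=1..r. (\<Sum>k=1..r. Gh x k i l * Y x s k) * cnj (Y x s i)) =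
          W x s l * (\<Sum>i=1..r. Y x s i * cnj (Y x s i))"
        by (simp add: sum_distrib_left mult.assoc)
      then show ?case using elim(1) by simp
    qed
  qed
  have perm': "eventually (\<lambda>x. \<sigma> x permutes {1..r} \<and> (\<forall>s\<in>{1..r}. c x s \<noteq> 0 \<and> q x (\<sigma> x s) 0 \<noteq> 0)) \<FF>"
    using perm nd
  proof eventually_elim
    case (elim x)
    then have "\<sigma> x s \<in> {1..r}" if "s \<in> {1..r}" for s using that by (simp only: permutes_in_image)
    then show ?case using elim by blast
  qed
  \<comment> \<open>This limit ties the unknown scale \<open>c x s\<close> to the leading
    entry.\<close>
  have b: "near (\<lambda>x. c x s * (q x (\<sigma> x s) 0)\<^sup>2) ((p s 0)\<^sup>2)" if s: "s \<in> {1..r}" for s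
  proof (rule J1_coefficients_near[OF T Y W, where b = "\<lambda>x s. c x s * (q x (\<sigma> x s) 0)\<^sup>2" and s = s])
    show "eventually (\<lambda>x. \<forall>b'.
        subtensor_norm (J1 n r) (\<lambda>i0 i1 i2. cube_sum r (q x) i0 i1 i2 - (\<Sum>s=1..r. Y x s i1 * W x s i2 * (c x s * (q x (\<sigma> x s) 0)\<^sup>2)))
        \<le> subtensor_norm (J1 n r) (\<lambda>i0 i1 i2. cube_sum r (q x) i0 i1 i2 - (\<Sum>s=1..r. Y x s i1 * W x s i2 * b' s))) \<FF>"
      using perm'
    proof eventually_elim
      case (elim x)
      have "(\<Sum>s=1..r. Y x s k * W x s l * (c x s * (q x (\<sigma> x s) 0)\<^sup>2)) = cube_sum r (q x) 0 k l" for k l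
      proof -
        have "cube_sum r (q x) 0 k l = (\<Sum>s=1..r. q x (\<sigma> x s) 0 * q x (\<sigma> x s) k * q x (\<sigma> x s) l)"
          unfolding cube_sum_def
          using sum.permute[of "\<sigma> x" "{1..r}" "\<lambda>s. q x s 0 * q x s k * q x s l"] elim by (simp add: o_def)
        also have "\<dots> = (\<Sum>s=1..r. Y x s k * W x s l * (c x s * (q x (\<sigma> x s) 0)\<^sup>2))"
          using elim by (intro sum.cong refl) (simp add: Y_def W_def power2_eq_square)
        finally show ?thesis ..
      qed
      then have "subtensor_norm (J1 n r) (\<lambda>i0 i1 i2. cube_sum r (q x) i0 i1 i2 -
          (\<Sum>s=1..r. Y x s i1 * W x s i2 * (c x s * (q x (\<sigma> x s) 0)\<^sup>2))) = 0"
        unfolding subtensor_norm_def by (intro L2_set_0') (auto simp: J1_def)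
      then show ?case by simp
    qed
  qed (use s in auto)
  \<comment> \<open>Determines the leading entry up to a cube root of unity.\<close>
  have cube: "near (\<lambda>x. q x (\<sigma> x s) 0 ^ 3) (p s 0 ^ 3)" if s: "s \<in> {1..r}" for s
  proof (rule tail_pair_coefficients_near[OF T W, where b = "\<lambda>x s. q x (\<sigma> x s) 0 ^ 3" and s = s])
    show "eventually (\<lambda>x. \<forall>j l. cube_sum r (q x) 0 j l =
        (\<Sum>s=1..r. W x s j * W x s l * q x (\<sigma> x s) 0 ^ 3)) \<FF>"
      using perm'
    proof (eventually_elim, intro allI)
      fix x j l
      assume elim: "\<sigma> x permutes {1..r} \<and> (\<forall>s\<in>{1..r}. c x s \<noteq> 0 \<and> q x (\<sigma> x s) 0 \<noteq> 0)"
      have "cube_sum r (q x) 0 j l = (\<Sum>s=1..r. q x (\<sigma> x s) 0 * q x (\<sigma> x s) j * q x (\<sigma> x s) l)"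
        unfolding cube_sum_def
        using sum.permute[of "\<sigma> x" "{1..r}" "\<lambda>s. q x s 0 * q x s j * q x s l"] elim by (simp add: o_def)
      also have "\<dots> = (\<Sum>s=1..r. W x s j * W x s l * q x (\<sigma> x s) 0 ^ 3)"
        using elim by (intro sum.cong refl) (simp add: W_def power3_eq_cube)
      finally show "cube_sum r (q x) 0 j l = (\<Sum>s=1..r. W x s j * W x s l * q x (\<sigma> x s) 0 ^ 3)" .
    qed
  qed (use s in auto)
  have "\<forall>s. \<exists>\<tau>. s \<in> {1..r} \<longrightarrow> (\<forall>x. \<tau> x ^ 3 = 1) \<and> near (\<lambda>x. \<tau> x * q x (\<sigma> x s) 0) (p s 0)"
    using cube_root_of_near[OF cube leading] by blast
  from choice[OF this] obtain \<tau> where \<tau>: "\<And>s x. s \<in> {1..r} \<Longrightarrow> \<tau> s x ^ 3 = 1"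
      "\<And>s. s \<in> {1..r} \<Longrightarrow> near (\<lambda>x. \<tau> s x * q x (\<sigma> x s) 0) (p s 0)"
    by blast
  show ?thesis
  proof (rule recovers_within_of_near[where \<sigma> = \<sigma> and \<tau> = "\<lambda>x s. \<tau> s x"])
    show "eventually (\<lambda>x. \<sigma> x permutes {1..r}) \<FF>" using perm by (rule eventually_mono) simp
    show "\<tau> s x ^ 3 = 1" if "s \<in> {1..r}" for x s using \<tau>(1)[OF that] .
    fix s i assume s: "s \<in> {1..r}" and i: "i \<in> {0..n}"
    consider "i = 0" | "i \<in> {1..r}" | "i \<in> {r+1..n}" using i by fastforce
    then show "near (\<lambda>x. \<tau> s x * q x (\<sigma> x s) i) (p s i)"
    proof cases
      case 1
      then show ?thesis using \<tau>(2)[OF s] by simp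
    next
      case 2
      \<comment> \<open>The leading entries and the scale cancel, and \<open>\<tau> ^ 3 = 1\<close>
        turns the inverse square of the root into the root itself.\<close>
      have "eventually (\<lambda>x. c x s * (q x (\<sigma> x s) 0)\<^sup>2 / (\<tau> s x * q x (\<sigma> x s) 0)\<^sup>2 * Y x s i
          = \<tau> s x * q x (\<sigma> x s) i) \<FF>"
        using \<sigma>in[OF s]
      proof eventually_elim
        case (elim x)
        have "\<tau> s x \<noteq> 0" using \<tau>(1)[OF s, of x] by auto
        moreover have "\<tau> s x * (\<tau> s x * \<tau> s x) = 1"
          using \<tau>(1)[OF s, of x] by (simp add: power3_eq_cube mult.assoc)
        ultimately have "1 / (\<tau> s x)\<^sup>2 = \<tau> s x" by (simp add: power2_eq_square divide_eq_eq)
        then have "c x s * (q x (\<sigma> x s) 0)\<^sup>2 / (\<tau> s x * q x (\<sigma> x s) 0)\<^sup>2 = c x s * \<tau> s x"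
          using elim by (simp add: power_mult_distrib divide_inverse)
        then show ?case using elim by (simp add: Y_def)
      qed
      moreover have "near (\<lambda>x. c x s * (q x (\<sigma> x s) 0)\<^sup>2 / (\<tau> s x * q x (\<sigma> x s) 0)\<^sup>2 * Y x s i)
          ((p s 0)\<^sup>2 / (p s 0)\<^sup>2 * p s i)"
        using leading[OF s] 2 s by (intro near_mult near_divide near_power \<tau> b Y) auto
      ultimately have "near (\<lambda>x. \<tau> s x * q x (\<sigma> x s) i) ((p s 0)\<^sup>2 / (p s 0)\<^sup>2 * p s i)"
        by (rule near_cong)
      then show ?thesis using leading[OF s] by simp
    next
      case 3
      have "eventually (\<lambda>x. \<tau> s x * q x (\<sigma> x s) 0 * W x s i = \<tau> s x * q x (\<sigma> x s) i) \<FF>"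
        using \<sigma>in[OF s] by eventually_elim (simp add: W_def)
      from near_cong[OF this near_mult[OF \<tau>(2)[OF s] W[OF s 3]]]
      show ?thesis using leading[OF s] by simp
    qed
  qed
qed

end

section \<open>From filters to uniform bounds for one decomposition\<close>

lemma entry_le_subtensor_norm: "finite J \<Longrightarrow> (i, j, k) \<in> J \<Longrightarrow> cmod (T i j k) \<le> subtensor_norm J T"
  unfolding subtensor_norm_def using member_le_L2_set[of J "(i, j, k)" "\<lambda>(i, j, k). cmod (T i j k)"] by simp

lemma finite_\<Omega>: "finite (\<Omega> n)"
  by (rule finite_subset[of _ "{0..n} \<times> {0..n} \<times> {0..n}"]) (auto simp: \<Omega>_def)

lemma subtensor_norm_cong:
  assumes "\<And>i j k. (i, j, k) \<in> J \<Longrightarrow> cmod (S i j k) = cmod (T i j k)"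
  shows "subtensor_norm J S = subtensor_norm J T"
  unfolding subtensor_norm_def using assms by (intro L2_set_cong) auto

lemma subtensor_norm_zero [simp]: "subtensor_norm J (\<lambda>i j k. 0) = 0"
  unfolding subtensor_norm_def by (rule L2_set_0') auto

locale decomposed_tensor =
  fixes n r :: nat and \<xi> :: "nat \<Rightarrow> complex" and F :: tensor3
    and p :: "nat \<Rightarrow> nat \<Rightarrow> complex" and G :: "nat \<Rightarrow> nat \<Rightarrow> nat \<Rightarrow> complex"
  assumes r_less: "r < n"
    and F: "\<forall>i\<in>{0..n}. \<forall>j\<in>{0..n}. \<forall>k\<in>{0..n}. F i j k = cube_sum r p i j k"
    and leading: "\<forall>s\<in>{1..r}. p s 0 \<noteq> 0"
    and indep_head: "lin_indep_family r {1..r} p"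
    and indep_tail: "\<forall>j\<in>{r+1..n}. lin_indep_family r ({r+1..n} - {j}) p"
    and generating: "generating_matrix n r F G"
    and distinct: "distinct_eigenvalues (N_comb n r \<xi> G)"
begin

lemma F_\<Omega>: "(i, j, k) \<in> \<Omega> n \<Longrightarrow> F i j k = cube_sum r p i j k"
  using F by (auto simp: \<Omega>_def)

lemma generating': "generating_matrix n r (cube_sum r p) G"
  unfolding generating_matrix_def
proof (intro ballI)
  fix i j t assume it: "i \<in> {1..r}" "j \<in> {r+1..n}" "t \<in> {0..n}"
  have "(\<Sum>k=1..r. G k i j * cube_sum r p 0 k t) = (\<Sum>k=1..r. G k i j * F 0 k t)"
    using F r_less it by (intro sum.cong refl) auto
  also have "\<dots> = F i j t" using generating it unfolding generating_matrix_def by blast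
  also have "\<dots> = cube_sum r p i j t" using F r_less it by auto
  finally show "(\<Sum>k=1..r. G k i j * cube_sum r p 0 k t) = cube_sum r p i j t" .
qed

text \<open>The error tends to 0 by the construction of the filter, whatever set \<open>A\<close>
  restricts it; \<open>A\<close> will collect data together with outputs.\<close>

lemma cubic_decomposition_filter:
  fixes err :: "'x \<Rightarrow> real"
  shows "cubic_decomposition (inf (principal A) (filtercomap err (nhds 0))) (\<lambda>x. complex_of_real (err x)) n r p"
proof unfold_locales
  have "filterlim err (nhds 0) (inf (principal A) (filtercomap err (nhds 0)))"
    by (rule filterlim_mono[OF filterlim_filtercomap order_refl]) simp
  then show "((\<lambda>x. complex_of_real (err x)) \<longlongrightarrow> 0) (inf (principal A) (filtercomap err (nhds 0)))"
    using tendsto_of_real by fastforce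
qed (use r_less leading indep_head indep_tail in auto)

text \<open>The filter runs over pairs of data and minimizer, so that one constant serves all of
  them.\<close>

lemma refined_bound:
  "\<exists>\<epsilon>0>0. \<exists>C>0. \<forall>Fhat q. subtensor_norm (\<Omega> n) (\<lambda>i j k. Fhat i j k - F i j k) \<le> \<epsilon>0 \<longrightarrow>
     algorithm_refined n r Fhat q \<longrightarrow>
     recovers_within n r p q (C * subtensor_norm (\<Omega> n) (\<lambda>i j k. Fhat i j k - F i j k))"
proof -
  define err where "err = (\<lambda>(Fhat, q :: nat \<Rightarrow> nat \<Rightarrow> complex). subtensor_norm (\<Omega> n) (\<lambda>i j k. Fhat i j k - F i j k))"
  define A where "A = {(Fhat, q). algorithm_refined n r Fhat q}"
  let ?F = "inf (principal A) (filtercomap err (nhds 0))"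
  interpret cubic_decomposition ?F "\<lambda>x. complex_of_real (err x)" n r p
    by (rule cubic_decomposition_filter)
  have err0: "0 \<le> err x" for x by (simp add: err_def split: prod.split)
  have close: "near (\<lambda>x. cube_sum r (snd x) i j k) (cube_sum r p i j k)" if ijk: "(i, j, k) \<in> \<Omega> n" for i j k
    unfolding near_def
  \<comment> \<open>One error comes from the data and one from the residual of the minimizer, which
    is at most that of \<open>p\<close>.\<close>
  proof (rule bigoI[where c = 2])
    have "eventually (\<lambda>x. x \<in> A) ?F" by (simp add: eventually_inf_principal inf.commute[of "principal A"])
    then show "eventually (\<lambda>x. cmod (cube_sum r (snd x) i j k - cube_sum r p i j k)
        \<le> 2 * cmod (complex_of_real (err x))) ?F"
    proof eventually_elim
      case (elim x)
      obtain Fhat q where x: "x = (Fhat, q)" by (cases x)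
      have "subtensor_norm (\<Omega> n) (\<lambda>i j k. cube_sum r q i j k - Fhat i j k)
          \<le> subtensor_norm (\<Omega> n) (\<lambda>i j k. cube_sum r p i j k - Fhat i j k)"
        using elim unfolding A_def x algorithm_refined_def
        by (intro is_arg_min_square_le[where f = "\<lambda>q. subtensor_norm (\<Omega> n) (\<lambda>i j k. cube_sum r q i j k - Fhat i j k)"]) auto
      also have "\<dots> = err x"
        unfolding x err_def prod.case
        by (rule subtensor_norm_cong) (simp add: F_\<Omega> norm_minus_commute)
      finally have "cmod (cube_sum r q i j k - Fhat i j k) \<le> err x"
        using entry_le_subtensor_norm[OF finite_\<Omega> ijk, of "\<lambda>i j k. cube_sum r q i j k - Fhat i j k"] by simp
      moreover have "cmod (Fhat i j k - F i j k) \<le> err x"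
        using entry_le_subtensor_norm[OF finite_\<Omega> ijk, of "\<lambda>i j k. Fhat i j k - F i j k"] by (simp add: x err_def)
      ultimately have "cmod (cube_sum r q i j k - F i j k) \<le> 2 * err x"
        using norm_triangle_ineq[of "cube_sum r q i j k - Fhat i j k" "Fhat i j k - F i j k"] by simp
      then show ?case using err0[of x] F_\<Omega>[OF ijk] by (simp add: x)
    qed
  qed
  from approximate_decomposition_recovers[OF close generating' distinct]
  obtain C where C: "C > 0"
      "eventually (\<lambda>x. recovers_within n r p (snd x) (C * cmod (complex_of_real (err x)))) ?F"
    by blast
  from eventually_inf_principal_filtercomapD[OF C(2) err0] obtain d where
      d: "d > 0" "\<forall>x\<in>A. err x \<le> d \<longrightarrow> recovers_within n r p (snd x) (C * cmod (complex_of_real (err x)))"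
    by blast
  show ?thesis
  proof (rule exI[of _ d], rule conjI[OF d(1)], rule exI[of _ C], rule conjI[OF C(1)], intro allI impI)
    fix Fhat q
    assume "subtensor_norm (\<Omega> n) (\<lambda>i j k. Fhat i j k - F i j k) \<le> d" "algorithm_refined n r Fhat q"
    then show "recovers_within n r p q (C * subtensor_norm (\<Omega> n) (\<lambda>i j k. Fhat i j k - F i j k))"
      using d(2)[THEN bspec, of "(Fhat, q)"] err0[of "(Fhat, q)"] by (simp add: A_def err_def)
  qed
qed

text \<open>Points of the filter also record the intermediate choices, since the bound must not
  depend on which optimizers and eigenvectors are taken.\<close>

lemma start_bound:
  assumes det: "theta_determined r p"
  shows "\<exists>\<epsilon>0>0. \<exists>C>0. \<forall>Fhat q. subtensor_norm (\<Omega> n) (\<lambda>i j k. Fhat i j k - F i j k) \<le> \<epsilon>0 \<longrightarrow>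
     algorithm_start n r \<xi> Fhat q \<longrightarrow>
     recovers_within n r p q (C * subtensor_norm (\<Omega> n) (\<lambda>i j k. Fhat i j k - F i j k))"
proof -
  define err where "err = (\<lambda>(Fhat, q :: nat \<Rightarrow> nat \<Rightarrow> complex,
      G :: nat \<Rightarrow> nat \<Rightarrow> nat \<Rightarrow> complex, v :: nat \<Rightarrow> complex Matrix.vec, \<beta> :: nat \<Rightarrow> complex, \<theta> :: nat \<Rightarrow> complex).
      subtensor_norm (\<Omega> n) (\<lambda>i j k. Fhat i j k - F i j k))"
  define A where "A = {(Fhat, q, G, v, \<beta>, \<theta>).
        estimated_generating_matrix n r Fhat G \<and>
        unit_eigenvectors r (N_comb n r \<xi> G) v \<and>
        beta_optimal n r Fhat v (w_vec r G v) \<beta> \<and>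
        theta_optimal n r Fhat v (w_vec r G v) \<theta> \<and>
        (\<forall>s\<in>{1..r}. \<forall>i\<in>{0..n}.
           q s i = assembled_vector r ((\<beta> s)\<^sup>2 / \<theta> s) (\<theta> s / \<beta> s) (v s) (w_vec r G v s) i)}"
  let ?F = "inf (principal A) (filtercomap err (nhds 0))"
  interpret cubic_decomposition ?F "\<lambda>x. complex_of_real (err x)" n r p
    by (rule cubic_decomposition_filter)
  have err0: "0 \<le> err x" for x by (simp add: err_def split: prod.split)
  have close: "near (\<lambda>x. fst x i j k) (cube_sum r p i j k)" if ijk: "(i, j, k) \<in> \<Omega> n" for i j k
    unfolding near_def
  proof (rule bigoI[where c = 1], rule always_eventually, rule allI)
    fix x
    have "cmod (fst x i j k - F i j k) \<le> err x"
      using entry_le_subtensor_norm[OF finite_\<Omega> ijk, of "\<lambda>i j k. fst x i j k - F i j k"]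
      by (simp add: err_def case_prod_unfold)
    then show "cmod (fst x i j k - cube_sum r p i j k) \<le> 1 * cmod (complex_of_real (err x))"
      using F_\<Omega>[OF ijk] err0[of x] by simp
  qed
  define Gh where "Gh x = fst (snd (snd x))" for x :: "tensor3 \<times> (nat \<Rightarrow> nat \<Rightarrow> complex) \<times>
      (nat \<Rightarrow> nat \<Rightarrow> nat \<Rightarrow> complex) \<times> (nat \<Rightarrow> complex Matrix.vec) \<times> (nat \<Rightarrow> complex) \<times> (nat \<Rightarrow> complex)"
  define v where "v x = fst (snd (snd (snd x)))" for x :: "tensor3 \<times> (nat \<Rightarrow> nat \<Rightarrow> complex) \<times>
      (nat \<Rightarrow> nat \<Rightarrow> nat \<Rightarrow> complex) \<times> (nat \<Rightarrow> complex Matrix.vec) \<times> (nat \<Rightarrow> complex) \<times> (nat \<Rightarrow> complex)"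
  define \<beta> where "\<beta> x = fst (snd (snd (snd (snd x))))" for x :: "tensor3 \<times> (nat \<Rightarrow> nat \<Rightarrow> complex) \<times>
      (nat \<Rightarrow> nat \<Rightarrow> nat \<Rightarrow> complex) \<times> (nat \<Rightarrow> complex Matrix.vec) \<times> (nat \<Rightarrow> complex) \<times> (nat \<Rightarrow> complex)"
  define \<theta> where "\<theta> x = snd (snd (snd (snd (snd x))))" for x :: "tensor3 \<times> (nat \<Rightarrow> nat \<Rightarrow> complex) \<times>
      (nat \<Rightarrow> nat \<Rightarrow> nat \<Rightarrow> complex) \<times> (nat \<Rightarrow> complex Matrix.vec) \<times> (nat \<Rightarrow> complex) \<times> (nat \<Rightarrow> complex)"
  have inA: "eventually (\<lambda>x. x \<in> A) ?F"
    by (simp add: eventually_inf_principal inf.commute[of "principal A"])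
  have "\<exists>C>0. eventually (\<lambda>x. recovers_within n r p (fst (snd x)) (C * cmod (complex_of_real (err x)))) ?F"
  proof (rule algorithm_start_recovers[OF close det generating' distinct])
    show "eventually (\<lambda>x. estimated_generating_matrix n r (fst x) (Gh x)) ?F"
      using inA by eventually_elim (auto simp: A_def Gh_def)
    show "eventually (\<lambda>x. unit_eigenvectors r (N_comb n r \<xi> (Gh x)) (v x)) ?F"
      using inA by eventually_elim (auto simp: A_def Gh_def v_def)
    show "eventually (\<lambda>x. beta_optimal n r (fst x) (v x) (w_vec r (Gh x) (v x)) (\<beta> x)) ?F"
      using inA by eventually_elim (auto simp: A_def Gh_def v_def \<beta>_def)
    show "eventually (\<lambda>x. theta_optimal n r (fst x) (v x) (w_vec r (Gh x) (v x)) (\<theta> x)) ?F"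
      using inA by eventually_elim (auto simp: A_def Gh_def v_def \<theta>_def)
    show "eventually (\<lambda>x. \<forall>s\<in>{1..r}. \<forall>i\<in>{0..n}. fst (snd x) s i =
        assembled_vector r ((\<beta> x s)\<^sup>2 / \<theta> x s) (\<theta> x s / \<beta> x s) (v x s) (w_vec r (Gh x) (v x) s) i) ?F"
      using inA by eventually_elim (auto simp: A_def Gh_def v_def \<beta>_def \<theta>_def)
  qed
  then obtain C where C: "C > 0"
      "eventually (\<lambda>x. recovers_within n r p (fst (snd x)) (C * cmod (complex_of_real (err x)))) ?F"
    by blast
  from eventually_inf_principal_filtercomapD[OF C(2) err0] obtain d where
      d: "d > 0" "\<forall>x\<in>A. err x \<le> d \<longrightarrow> recovers_within n r p (fst (snd x)) (C * cmod (complex_of_real (err x)))"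
    by blast
  show ?thesis
  proof (rule exI[of _ d], rule conjI[OF d(1)], rule exI[of _ C], rule conjI[OF C(1)], intro allI impI)
    fix Fhat q
    assume le: "subtensor_norm (\<Omega> n) (\<lambda>i j k. Fhat i j k - F i j k) \<le> d" and "algorithm_start n r \<xi> Fhat q"
    then obtain G v \<beta> \<theta> where "(Fhat, q, G, v, \<beta>, \<theta>) \<in> A"
      unfolding algorithm_start_def A_def by blast
    then show "recovers_within n r p q (C * subtensor_norm (\<Omega> n) (\<lambda>i j k. Fhat i j k - F i j k))"
      using d(2)[THEN bspec, of "(Fhat, q, G, v, \<beta>, \<theta>)"] err0[of "(Fhat, q, G, v, \<beta>, \<theta>)"] le
      by (simp add: err_def)
  qed
qed

text \<open>Another exact decomposition is a minimizer for the data \<open>F\<close> itself, whose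
  error is 0, so the refined bound leaves no room between the two.\<close>

lemma exact_recovers:
  assumes F': "\<forall>i\<in>{0..n}. \<forall>j\<in>{0..n}. \<forall>k\<in>{0..n}. F i j k = cube_sum r p' i j k"
  shows "recovers_within n r p p' 0"
proof -
  have "subtensor_norm (\<Omega> n) (\<lambda>i j k. cube_sum r p' i j k - F i j k) = 0"
    unfolding subtensor_norm_def using F' by (intro L2_set_0') (auto simp: \<Omega>_def)
  then have "algorithm_refined n r F p'"
    unfolding algorithm_refined_def is_arg_min_def by (simp add: not_less)
  moreover obtain e C where eC: "e > 0" "\<And>Fhat q. subtensor_norm (\<Omega> n) (\<lambda>i j k. Fhat i j k - F i j k) \<le> e \<Longrightarrow>
     algorithm_refined n r Fhat q \<Longrightarrow>
     recovers_within n r p q (C * subtensor_norm (\<Omega> n) (\<lambda>i j k. Fhat i j k - F i j k))"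
    using refined_bound by blast
  ultimately have "recovers_within n r p p' (C * subtensor_norm (\<Omega> n) (\<lambda>i j k. F i j k - F i j k))"
    by (intro eC(2)) simp_all
  then show ?thesis by simp
qed

end

section \<open>Constants depending only on the tensor and on the vector \<open>\<xi>\<close>\<close>

theorem theorem4p2:
  fixes d n r :: nat and F :: tensor3 and \<xi> :: "nat \<Rightarrow> complex"
  assumes "real r \<le> real d / 2 - 1" and "n = d - 1"
  shows "\<exists>\<epsilon>0 > 0. \<exists>C > 0. \<forall>p G.
    (\<forall>i\<in>{0..n}. \<forall>j\<in>{0..n}. \<forall>k\<in>{0..n}. F i j k = cube_sum r p i j k) \<and>
    (\<forall>s\<in>{1..r}. p s 0 \<noteq> 0) \<and>
    lin_indep_family r {1..r} p \<and>
    (\<forall>j\<in>{r+1..n}. lin_indep_family r ({r+1..n} - {j}) p) \<and>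
    generating_matrix n r F G \<and>
    distinct_eigenvalues (N_comb n r \<xi> G) \<longrightarrow>
    (\<forall>Fhat \<epsilon>.
      symmetric_on_\<Omega> n Fhat \<and>
      \<epsilon> = subtensor_norm (\<Omega> n) (\<lambda>i j k. Fhat i j k - F i j k) \<and>
      \<epsilon> \<le> \<epsilon>0 \<longrightarrow>
      (\<forall>phat. theta_determined r p \<and> algorithm_start n r \<xi> Fhat phat \<longrightarrow>
        recovers_within n r p phat (C * \<epsilon>)) \<and>
      (\<forall>pstar. algorithm_refined n r Fhat pstar \<longrightarrow>
        recovers_within n r p pstar (C * \<epsilon>)))"
proof -
  \<comment> \<open>The bound on \<open>r\<close> gives \<open>2 * r + 2 \<le> d\<close>, so
    \<open>n = d - 1\<close> is at least \<open>2 * r + 1\<close>.\<close>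
  have rn: "r < n" using assms by linarith
  show ?thesis
  \<comment> \<open>The constants are fixed before \<open>p\<close> and \<open>G\<close>, so one
    decomposition is selected as a reference; if there is none, the claim is empty.\<close>
  proof (cases "\<exists>p G. decomposed_tensor n r \<xi> F p G")
    case False
    have none: "\<not> ((\<forall>i\<in>{0..n}. \<forall>j\<in>{0..n}. \<forall>k\<in>{0..n}. F i j k = cube_sum r p i j k) \<and>
        (\<forall>s\<in>{1..r}. p s 0 \<noteq> 0) \<and> lin_indep_family r {1..r} p \<and>
        (\<forall>j\<in>{r+1..n}. lin_indep_family r ({r+1..n} - {j}) p) \<and>
        generating_matrix n r F G \<and> distinct_eigenvalues (N_comb n r \<xi> G))" for p G
      using False rn decomposed_tensor.intro[of r n F p G \<xi>] by blast
    show ?thesis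
      by (intro exI[of _ "1 :: real"] conjI, simp, simp) (use none in blast)
  next
    case True
    then obtain p0 G0 where "decomposed_tensor n r \<xi> F p0 G0" by blast
    then interpret decomposed_tensor n r \<xi> F p0 G0 .
    let ?err = "\<lambda>Fhat. subtensor_norm (\<Omega> n) (\<lambda>i j k. Fhat i j k - F i j k)"
    obtain e1 C1 where e1: "e1 > 0" "C1 > 0"
        "\<And>Fhat q. ?err Fhat \<le> e1 \<Longrightarrow> algorithm_refined n r Fhat q \<Longrightarrow> recovers_within n r p0 q (C1 * ?err Fhat)"
      using refined_bound by blast
    obtain e2 C2 where e2: "e2 > 0" "C2 > 0"
        "\<And>Fhat q. theta_determined r p0 \<Longrightarrow> ?err Fhat \<le> e2 \<Longrightarrow> algorithm_start n r \<xi> Fhat q \<Longrightarrow>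
          recovers_within n r p0 q (C2 * ?err Fhat)"
    proof (cases "theta_determined r p0")
      case True
      then show ?thesis using start_bound that by blast
    next
      case False
      \<comment> \<open>Nothing is claimed in this case, so the constants 1 serve.\<close>
      then show ?thesis using that[of 1 1] by simp
    qed
    have mono: "recovers_within n r p q b" if "recovers_within n r p q a" "a \<le> b" for p q a b
      using that unfolding recovers_within_def by (meson order_trans)
    have main: "(theta_determined r p \<and> algorithm_start n r \<xi> Fhat q \<longrightarrow> recovers_within n r p q (max C1 C2 * ?err Fhat)) \<and>
        (algorithm_refined n r Fhat q \<longrightarrow> recovers_within n r p q (max C1 C2 * ?err Fhat))"
      if F': "\<forall>i\<in>{0..n}. \<forall>j\<in>{0..n}. \<forall>k\<in>{0..n}. F i j k = cube_sum r p i j k"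
        and le: "?err Fhat \<le> min e1 e2" for p Fhat q
    proof (intro conjI impI)
      \<comment> \<open>Any other decomposition agrees with the reference up to order and cube roots
        of unity, so the bounds for \<open>p0\<close> pass to \<open>p\<close> with the same
        constants.\<close>
      note exact = exact_recovers[OF F']
      show "recovers_within n r p q (max C1 C2 * ?err Fhat)"
        if "theta_determined r p \<and> algorithm_start n r \<xi> Fhat q"
      proof -
        have "theta_determined r p0"
          using that theta_determined_of_recovers[OF exact] rn by simp
        then have "recovers_within n r p0 q (C2 * ?err Fhat)" using that le by (intro e2(3)) auto
        then have "recovers_within n r p q (C2 * ?err Fhat)" by (rule recovers_within_trans[OF exact])
        then show ?thesis by (rule mono) (intro mult_right_mono, auto)
      qed
      show "recovers_within n r p q (max C1 C2 * ?err Fhat)" if "algorithm_refined n r Fhat q"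
      proof -
        have "recovers_within n r p0 q (C1 * ?err Fhat)" using that le by (intro e1(3)) auto
        then have "recovers_within n r p q (C1 * ?err Fhat)" by (rule recovers_within_trans[OF exact])
        then show ?thesis by (rule mono) (intro mult_right_mono, auto)
      qed
    qed
    show ?thesis
    proof (rule exI[of _ "min e1 e2"], rule conjI[OF _ exI[of _ "max C1 C2"]])
      show "0 < min e1 e2" using e1 e2 by simp
    qed (use main e1 in \<open>auto simp: less_max_iff_disj\<close>)
  qed
qed

end
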